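(* Let $T$ be an additive ternary $\Gamma$-ring; write $\mathcal A=\mathcal A(T,\Gamma)$, $\mathcal R=\mathcal R_T$ for its regular operator ring, $K=\ker(\mathcal A\twoheadrightarrow\mathcal R)$ for its unital regular defect and $\mathcal C(T,\Gamma)=K/K^2$. Let $M$ be a left $\mathcal R$-module, viewed as a left $\mathcal A$-module through the quotient map $\mathcal A\twoheadrightarrow\mathcal R$. Then there are natural isomorphisms $$\operatorname{Tor}^{\mathcal A}_1(\mathcal R,M)\cong\mathcal C(T,\Gamma)\otimes_{\mathcal R}M,\qquad \operatorname{Ext}^1_{\mathcal A}(\mathcal R,M)\cong\operatorname{Hom}_{\mathcal R}(\mathcal C(T,\Gamma),M).$$
   Context: An additive ternary $\Gamma$-ring consists of abelian groups $(T,+)$, $(\Gamma,+)$ and a map $T\times\Gamma\times T\times\Gamma\times T\to T$, $(x,\alpha,y,\beta,z)\mapsto x\alpha y\beta z$, additive in each of the five variables, with $(x\alpha y\beta z)\gamma u\delta v=x\alpha(y\beta z\gamma u)\delta v=x\alpha y\beta(z\gamma u\delta v)$. Let $F(T,\Gamma)=T\otimes_{\mathbb Z}\Gamma\otimes_{\mathbb Z}T\otimes_{\mathbb Z}\Gamma$ with the associative bilinear multiplication $(a\otimes\alpha\otimes b\otimes\beta)(c\otimes\gamma\otimes d\otimes\delta)=(a\alpha b\beta c)\otimes\gamma\otimes d\otimes\delta$, let $J(T,\Gamma)$ be the two-sided ideal generated by all $(a\alpha b\beta c)\otimes\gamma\otimes d\otimes\delta-a\otimes\alpha\otimes(b\beta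 c\gamma d)\otimes\delta$, and let $\mathcal O(T,\Gamma)=F(T,\Gamma)/J(T,\Gamma)$; $[a,\alpha,b,\beta]$ is the class of a pure tensor. The unital ring $\mathcal A(T,\Gamma)=\mathbb Z\ltimes\mathcal O(T,\Gamma)$ is $\mathbb Z\oplus\mathcal O(T,\Gamma)$ with $(n,r)(m,s)=(nm,ns+mr+rs)$. The regular representation is $\rho_T:\mathcal O(T,\Gamma)\to\operatorname{End}_{\mathbb Z}(T)$, $\rho_T([a,\alpha,b,\beta])(x)=a\alpha b\beta x$, and its unital extension is $\widehat\rho_T:\mathcal A(T,\Gamma)\to\operatorname{End}_{\mathbb Z}(T)$, $\widehat\rho_T(n,u)=n\operatorname{id}_T+\rho_T(u)$. The unital regular defect is $K=\ker\widehat\rho_T$ and the regular operator ring is $\mathcal R_T=\operatorname{im}\widehat\rho_T\cong\mathcal A/K$. The conormal operator defect $\mathcal C(T,\Gamma)=K/K^2$ is an $\mathcal R_T$-bimodule via lifts of elements of $\mathcal R_T$ to $\mathcal A$. In $\operatorname{Tor}$, $\mathcal R$ is a right $\mathcal A$-module; in $\operatorname{Ext}$, it is a left $\mathcal A$-module. *)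

theory Defs
  imports
    "HOL-Algebra.Free_Abelian_Groups"
    "HOL-Algebra.QuotRing"
    "HOL-Algebra.Ideal_Product"
    "HOL-Algebra.Module"
begin

section \<open>Modules over arbitrary rings\<close>

text \<open>
  The locale \<open>module\<close> of HOL-Algebra is restricted to commutative rings, so modules over a
  noncommutative unital ring are introduced here, on the same record type.  As there, only the
  additive part and the scalar multiplication of the record matter.  A right module over \<open>R\<close> is a
  left module over the opposite ring; in it, \<open>smult M r x\<close> stands for \<open>x r\<close>.
\<close>

locale left_module = R?: ring R + M?: abelian_group M
  for R :: "('a, 'r) ring_scheme" (structure) and M :: "('a, 'm, 'x) module_scheme" (structure) +
  assumes smult_closed: "\<lbrakk>a \<in> carrier R; x \<in> carrier M\<rbrakk> \<Longrightarrow> a \<odot>\<^bsub>M\<^esub> x \<in> carrier M"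
    and smult_l_distr: "\<lbrakk>a \<in> carrier R; b \<in> carrier R; x \<in> carrier M\<rbrakk>
      \<Longrightarrow> (a \<oplus>\<^bsub>R\<^esub> b) \<odot>\<^bsub>M\<^esub> x = a \<odot>\<^bsub>M\<^esub> x \<oplus>\<^bsub>M\<^esub> b \<odot>\<^bsub>M\<^esub> x"
    and smult_r_distr: "\<lbrakk>a \<in> carrier R; x \<in> carrier M; y \<in> carrier M\<rbrakk>
      \<Longrightarrow> a \<odot>\<^bsub>M\<^esub> (x \<oplus>\<^bsub>M\<^esub> y) = a \<odot>\<^bsub>M\<^esub> x \<oplus>\<^bsub>M\<^esub> a \<odot>\<^bsub>M\<^esub> y"
    and smult_assoc: "\<lbrakk>a \<in> carrier R; b \<in> carrier R; x \<in> carrier M\<rbrakk>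
      \<Longrightarrow> (a \<otimes>\<^bsub>R\<^esub> b) \<odot>\<^bsub>M\<^esub> x = a \<odot>\<^bsub>M\<^esub> (b \<odot>\<^bsub>M\<^esub> x)"
    and smult_one: "x \<in> carrier M \<Longrightarrow> \<one>\<^bsub>R\<^esub> \<odot>\<^bsub>M\<^esub> x = x"

definition op_ring :: "'a ring \<Rightarrow> 'a ring" where
  "op_ring R = R\<lparr>mult := \<lambda>x y. y \<otimes>\<^bsub>R\<^esub> x\<rparr>"

definition self_module :: "'a ring \<Rightarrow> ('a, 'a) module" where
  "self_module R = \<lparr>carrier = carrier R, mult = mult R, one = \<one>\<^bsub>R\<^esub>, zero = \<zero>\<^bsub>R\<^esub>,
    add = add R, smult = mult R\<rparr>"

definition restrict_scalars :: "('a \<Rightarrow> 'b) \<Rightarrow> ('b, 'm) module \<Rightarrow> ('a, 'm) module" where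
  "restrict_scalars h M = \<lparr>carrier = carrier M, mult = mult M, one = \<one>\<^bsub>M\<^esub>, zero = \<zero>\<^bsub>M\<^esub>,
    add = add M, smult = \<lambda>a x. h a \<odot>\<^bsub>M\<^esub> x\<rparr>"

definition linear_maps :: "'a ring \<Rightarrow> ('a, 'm) module \<Rightarrow> ('a, 'n) module \<Rightarrow> ('m \<Rightarrow> 'n) set" where
  "linear_maps R M N = {f \<in> carrier M \<rightarrow> carrier N.
     (\<forall>x\<in>carrier M. \<forall>y\<in>carrier M. f (x \<oplus>\<^bsub>M\<^esub> y) = f x \<oplus>\<^bsub>N\<^esub> f y) \<and>
     (\<forall>a\<in>carrier R. \<forall>x\<in>carrier M. f (a \<odot>\<^bsub>M\<^esub> x) = a \<odot>\<^bsub>N\<^esub> f x)}"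

definition hom_group :: "'a ring \<Rightarrow> ('a, 'm) module \<Rightarrow> ('a, 'n) module \<Rightarrow> ('m \<Rightarrow> 'n) monoid" where
  "hom_group R M N = \<lparr>carrier = linear_maps R M N \<inter> extensional (carrier M),
     mult = \<lambda>f g. \<lambda>x\<in>carrier M. f x \<oplus>\<^bsub>N\<^esub> g x,
     one = \<lambda>x\<in>carrier M. \<zero>\<^bsub>N\<^esub>\<rparr>"

definition free_module :: "'a ring \<Rightarrow> ('a, 'm) module \<Rightarrow> bool" where
  "free_module R F \<longleftrightarrow> left_module R F \<and>
     (\<exists>B\<subseteq>carrier F. \<forall>x\<in>carrier F.
        \<exists>!c. c \<in> UNIV \<rightarrow> carrier R \<and> finite {b. c b \<noteq> \<zero>\<^bsub>R\<^esub>} \<and> {b. c b \<noteq> \<zero>\<^bsub>R\<^esub>} \<subseteq> B \<and>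
             x = (\<Oplus>\<^bsub>F\<^esub>b\<in>{b. c b \<noteq> \<zero>\<^bsub>R\<^esub>}. c b \<odot>\<^bsub>F\<^esub> b))"

text \<open>
  Projective: direct summand of a free module.  The carrier type \<open>'p \<Rightarrow> 'a\<close> of the free module is
  no restriction, since it has room for the free module on the underlying set of \<open>P\<close>, of which
  \<open>P\<close> is a direct summand as soon as it is a direct summand of any free module.
\<close>

definition projective_module :: "'a ring \<Rightarrow> ('a, 'p) module \<Rightarrow> bool" where
  "projective_module R P \<longleftrightarrow> left_module R P \<and>
     (\<exists>(F :: ('a, 'p \<Rightarrow> 'a) module) i r. free_module R F \<and> i \<in> linear_maps R P F \<and>
        r \<in> linear_maps R F P \<and> (\<forall>x\<in>carrier P. r (i x) = x))"

text \<open>Exactness of \<open>\<dots> \<rightarrow> P 2 \<rightarrow> P 1 \<rightarrow> P 0 \<rightarrow> N \<rightarrow> 0\<close>, with \<open>d n : P (n + 1) \<rightarrow> P n\<close>.\<close>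

definition projective_resolution ::
    "'a ring \<Rightarrow> ('a, 'n) module \<Rightarrow> (nat \<Rightarrow> ('a, 'p) module) \<Rightarrow> (nat \<Rightarrow> 'p \<Rightarrow> 'p) \<Rightarrow> ('p \<Rightarrow> 'n) \<Rightarrow> bool"
  where "projective_resolution R N P d \<epsilon> \<longleftrightarrow>
     left_module R N \<and> (\<forall>n. projective_module R (P n)) \<and>
     (\<forall>n. d n \<in> linear_maps R (P (Suc n)) (P n)) \<and> \<epsilon> \<in> linear_maps R (P 0) N \<and>
     \<epsilon> ` carrier (P 0) = carrier N \<and>
     {x \<in> carrier (P 0). \<epsilon> x = \<zero>\<^bsub>N\<^esub>} = d 0 ` carrier (P (Suc 0)) \<and>
     (\<forall>n. {x \<in> carrier (P (Suc n)). d n x = \<zero>\<^bsub>P n\<^esub>} = d (Suc n) ` carrier (P (Suc (Suc n))))"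


section \<open>Tensor products, Tor and Ext\<close>

text \<open>
  The map between quotients that \<open>h\<close> induces on representatives; \<open>H\<close> is the subgroup of \<open>G\<close> by
  which the target is the quotient, \<open>X\<close> an element of the source.
\<close>

definition quot_map :: "('b, 'x) monoid_scheme \<Rightarrow> 'b set \<Rightarrow> ('a \<Rightarrow> 'b) \<Rightarrow> 'a set \<Rightarrow> 'b set" where
  "quot_map G H h X = the_elem ((\<lambda>x. H #>\<^bsub>G\<^esub> h x) ` X)"

definition tensor_relators :: "'a ring \<Rightarrow> ('a, 'q) module \<Rightarrow> ('a, 'm) module \<Rightarrow> ('q \<times> 'm \<Rightarrow>\<^sub>0 int) set"
  where "tensor_relators R Q M =
    {frag_of (x \<oplus>\<^bsub>Q\<^esub> y, m) - frag_of (x, m) - frag_of (y, m) | x y m.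
       x \<in> carrier Q \<and> y \<in> carrier Q \<and> m \<in> carrier M} \<union>
    {frag_of (x, m \<oplus>\<^bsub>M\<^esub> n) - frag_of (x, m) - frag_of (x, n) | x m n.
       x \<in> carrier Q \<and> m \<in> carrier M \<and> n \<in> carrier M} \<union>
    {frag_of (a \<odot>\<^bsub>Q\<^esub> x, m) - frag_of (x, a \<odot>\<^bsub>M\<^esub> m) | a x m.
       a \<in> carrier R \<and> x \<in> carrier Q \<and> m \<in> carrier M}"

definition tensor_null :: "'a ring \<Rightarrow> ('a, 'q) module \<Rightarrow> ('a, 'm) module \<Rightarrow> ('q \<times> 'm \<Rightarrow>\<^sub>0 int) set"
  where "tensor_null R Q M =
    generate (free_Abelian_group (carrier Q \<times> carrier M)) (tensor_relators R Q M)"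

text \<open>The abelian group \<open>Q \<otimes>\<^sub>R M\<close> for a right module \<open>Q\<close> and a left module \<open>M\<close>.\<close>

definition tensor :: "'a ring \<Rightarrow> ('a, 'q) module \<Rightarrow> ('a, 'm) module \<Rightarrow> ('q \<times> 'm \<Rightarrow>\<^sub>0 int) set monoid"
  where "tensor R Q M = free_Abelian_group (carrier Q \<times> carrier M) Mod tensor_null R Q M"

text \<open>The map \<open>f \<otimes> g\<close> into \<open>Q \<otimes>\<^sub>R M\<close>.\<close>

definition tensor_map :: "'a ring \<Rightarrow> ('a, 'q) module \<Rightarrow> ('a, 'm) module \<Rightarrow> ('p \<Rightarrow> 'q) \<Rightarrow> ('l \<Rightarrow> 'm) \<Rightarrow>
    ('p \<times> 'l \<Rightarrow>\<^sub>0 int) set \<Rightarrow> ('q \<times> 'm \<Rightarrow>\<^sub>0 int) set"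
  where "tensor_map R Q M f g =
    quot_map (free_Abelian_group (carrier Q \<times> carrier M)) (tensor_null R Q M)
      (frag_extend (\<lambda>(x, m). frag_of (f x, g m)))"

text \<open>
  \<open>tor R P d M n\<close> is the \<open>n\<close>-th homology of \<open>P \<otimes>\<^sub>R M\<close>.  When \<open>P\<close> is a projective resolution of a
  right module \<open>N\<close> with differential \<open>d\<close>, this is \<open>Tor\<^sub>n\<^sup>R(N, M)\<close>, and \<open>tor_map\<close> is its functoriality in
  the second argument.  No resolution is singled out: statements about Tor and Ext are to be made for
  every projective resolution, in every carrier type.
\<close>

definition tor_cycles :: "'a ring \<Rightarrow> (nat \<Rightarrow> ('a, 'p) module) \<Rightarrow> (nat \<Rightarrow> 'p \<Rightarrow> 'p) \<Rightarrow>
    ('a, 'm) module \<Rightarrow> nat \<Rightarrow> ('p \<times> 'm \<Rightarrow>\<^sub>0 int) set set"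
  where "tor_cycles R P d M n = (case n of
      0 \<Rightarrow> carrier (tensor R (P 0) M)
    | Suc k \<Rightarrow> kernel (tensor R (P n) M) (tensor R (P k) M) (tensor_map R (P k) M (d k) id))"

definition tor_boundaries :: "'a ring \<Rightarrow> (nat \<Rightarrow> ('a, 'p) module) \<Rightarrow> (nat \<Rightarrow> 'p \<Rightarrow> 'p) \<Rightarrow>
    ('a, 'm) module \<Rightarrow> nat \<Rightarrow> ('p \<times> 'm \<Rightarrow>\<^sub>0 int) set set"
  where "tor_boundaries R P d M n =
    tensor_map R (P n) M (d n) id ` carrier (tensor R (P (Suc n)) M)"

definition tor :: "'a ring \<Rightarrow> (nat \<Rightarrow> ('a, 'p) module) \<Rightarrow> (nat \<Rightarrow> 'p \<Rightarrow> 'p) \<Rightarrow>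
    ('a, 'm) module \<Rightarrow> nat \<Rightarrow> ('p \<times> 'm \<Rightarrow>\<^sub>0 int) set set monoid"
  where "tor R P d M n =
    (tensor R (P n) M)\<lparr>carrier := tor_cycles R P d M n\<rparr> Mod tor_boundaries R P d M n"

definition tor_map :: "'a ring \<Rightarrow> (nat \<Rightarrow> ('a, 'p) module) \<Rightarrow> (nat \<Rightarrow> 'p \<Rightarrow> 'p) \<Rightarrow>
    ('a, 'm) module \<Rightarrow> ('l \<Rightarrow> 'm) \<Rightarrow> nat \<Rightarrow>
    ('p \<times> 'l \<Rightarrow>\<^sub>0 int) set set \<Rightarrow> ('p \<times> 'm \<Rightarrow>\<^sub>0 int) set set"
  where "tor_map R P d M f n =
    quot_map (tensor R (P n) M) (tor_boundaries R P d M n) (tensor_map R (P n) M id f)"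

text \<open>
  \<open>ext R P d M n\<close> is the \<open>n\<close>-th cohomology of \<open>Hom\<^sub>R(P, M)\<close>.  When \<open>P\<close> is a projective resolution of a
  left module \<open>N\<close> with differential \<open>d\<close>, this is \<open>Ext\<^sup>n\<^sub>R(N, M)\<close>, and \<open>ext_map\<close> is its functoriality in
  the second argument.
\<close>

definition ext_cocycles :: "'a ring \<Rightarrow> (nat \<Rightarrow> ('a, 'p) module) \<Rightarrow> (nat \<Rightarrow> 'p \<Rightarrow> 'p) \<Rightarrow>
    ('a, 'm) module \<Rightarrow> nat \<Rightarrow> ('p \<Rightarrow> 'm) set"
  where "ext_cocycles R P d M n =
    kernel (hom_group R (P n) M) (hom_group R (P (Suc n)) M)
      (\<lambda>\<phi>. compose (carrier (P (Suc n))) \<phi> (d n))"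

definition ext_coboundaries :: "'a ring \<Rightarrow> (nat \<Rightarrow> ('a, 'p) module) \<Rightarrow> (nat \<Rightarrow> 'p \<Rightarrow> 'p) \<Rightarrow>
    ('a, 'm) module \<Rightarrow> nat \<Rightarrow> ('p \<Rightarrow> 'm) set"
  where "ext_coboundaries R P d M n = (case n of
      0 \<Rightarrow> {\<one>\<^bsub>hom_group R (P 0) M\<^esub>}
    | Suc k \<Rightarrow> (\<lambda>\<phi>. compose (carrier (P n)) \<phi> (d k)) ` carrier (hom_group R (P k) M))"

definition ext :: "'a ring \<Rightarrow> (nat \<Rightarrow> ('a, 'p) module) \<Rightarrow> (nat \<Rightarrow> 'p \<Rightarrow> 'p) \<Rightarrow>
    ('a, 'm) module \<Rightarrow> nat \<Rightarrow> ('p \<Rightarrow> 'm) set monoid"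
  where "ext R P d M n =
    (hom_group R (P n) M)\<lparr>carrier := ext_cocycles R P d M n\<rparr> Mod ext_coboundaries R P d M n"

definition ext_map :: "'a ring \<Rightarrow> (nat \<Rightarrow> ('a, 'p) module) \<Rightarrow> (nat \<Rightarrow> 'p \<Rightarrow> 'p) \<Rightarrow>
    ('a, 'm) module \<Rightarrow> ('l \<Rightarrow> 'm) \<Rightarrow> nat \<Rightarrow> ('p \<Rightarrow> 'l) set \<Rightarrow> ('p \<Rightarrow> 'm) set"
  where "ext_map R P d M f n =
    quot_map (hom_group R (P n) M) (ext_coboundaries R P d M n)
      (\<lambda>\<phi>. compose (carrier (P n)) f \<phi>)"

text \<open>
  Natural isomorphism of two functors from left \<open>R\<close>-modules to abelian groups.  A functor is given
  by its values \<open>F M\<close> on modules and \<open>F' M N f\<close> on linear maps \<open>f : M \<rightarrow> N\<close>.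
\<close>

definition naturally_isomorphic :: "'a ring \<Rightarrow>
    (('a, 'm) module \<Rightarrow> 'x monoid) \<Rightarrow> (('a, 'm) module \<Rightarrow> ('a, 'm) module \<Rightarrow> ('m \<Rightarrow> 'm) \<Rightarrow> 'x \<Rightarrow> 'x) \<Rightarrow>
    (('a, 'm) module \<Rightarrow> 'y monoid) \<Rightarrow> (('a, 'm) module \<Rightarrow> ('a, 'm) module \<Rightarrow> ('m \<Rightarrow> 'm) \<Rightarrow> 'y \<Rightarrow> 'y) \<Rightarrow>
    bool"
  where "naturally_isomorphic R F F' G G' \<longleftrightarrow>
    (\<exists>\<Phi>. (\<forall>M. left_module R M \<longrightarrow> \<Phi> M \<in> iso (F M) (G M)) \<and>
         (\<forall>M N. left_module R M \<longrightarrow> left_module R N \<longrightarrow>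
           (\<forall>f\<in>linear_maps R M N. \<forall>x\<in>carrier (F M). \<Phi> N (F' M N f x) = G' M N f (\<Phi> M x))))"


section \<open>Ternary \<open>\<Gamma>\<close>-rings and their operator rings\<close>

text \<open>
  The abelian groups \<open>T\<close> and \<open>\<Gamma>\<close> are carried by ring records of which only the additive part is used.
\<close>

locale ternary_gamma_ring = T?: abelian_group T + \<Gamma>?: abelian_group \<Gamma>
  for T :: "'t ring" (structure) and \<Gamma> :: "'g ring" (structure) +
  fixes tp :: "'t \<Rightarrow> 'g \<Rightarrow> 't \<Rightarrow> 'g \<Rightarrow> 't \<Rightarrow> 't"
  assumes tp_closed:
    "\<lbrakk>x \<in> carrier T; y \<in> carrier T; z \<in> carrier T; \<alpha> \<in> carrier \<Gamma>; \<beta> \<in> carrier \<Gamma>\<rbrakk>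
      \<Longrightarrow> tp x \<alpha> y \<beta> z \<in> carrier T"
    and tp_add_1:
    "\<lbrakk>x \<in> carrier T; x' \<in> carrier T; y \<in> carrier T; z \<in> carrier T; \<alpha> \<in> carrier \<Gamma>; \<beta> \<in> carrier \<Gamma>\<rbrakk>
      \<Longrightarrow> tp (x \<oplus>\<^bsub>T\<^esub> x') \<alpha> y \<beta> z = tp x \<alpha> y \<beta> z \<oplus>\<^bsub>T\<^esub> tp x' \<alpha> y \<beta> z"
    and tp_add_2:
    "\<lbrakk>x \<in> carrier T; y \<in> carrier T; z \<in> carrier T; \<alpha> \<in> carrier \<Gamma>; \<alpha>' \<in> carrier \<Gamma>; \<beta> \<in> carrier \<Gamma>\<rbrakk>
      \<Longrightarrow> tp x (\<alpha> \<oplus>\<^bsub>\<Gamma>\<^esub> \<alpha>') y \<beta> z = tp x \<alpha> y \<beta> z \<oplus>\<^bsub>T\<^esub> tp x \<alpha>' y \<beta> z"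
    and tp_add_3:
    "\<lbrakk>x \<in> carrier T; y \<in> carrier T; y' \<in> carrier T; z \<in> carrier T; \<alpha> \<in> carrier \<Gamma>; \<beta> \<in> carrier \<Gamma>\<rbrakk>
      \<Longrightarrow> tp x \<alpha> (y \<oplus>\<^bsub>T\<^esub> y') \<beta> z = tp x \<alpha> y \<beta> z \<oplus>\<^bsub>T\<^esub> tp x \<alpha> y' \<beta> z"
    and tp_add_4:
    "\<lbrakk>x \<in> carrier T; y \<in> carrier T; z \<in> carrier T; \<alpha> \<in> carrier \<Gamma>; \<beta> \<in> carrier \<Gamma>; \<beta>' \<in> carrier \<Gamma>\<rbrakk>
      \<Longrightarrow> tp x \<alpha> y (\<beta> \<oplus>\<^bsub>\<Gamma>\<^esub> \<beta>') z = tp x \<alpha> y \<beta> z \<oplus>\<^bsub>T\<^esub> tp x \<alpha> y \<beta>' z"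
    and tp_add_5:
    "\<lbrakk>x \<in> carrier T; y \<in> carrier T; z \<in> carrier T; z' \<in> carrier T; \<alpha> \<in> carrier \<Gamma>; \<beta> \<in> carrier \<Gamma>\<rbrakk>
      \<Longrightarrow> tp x \<alpha> y \<beta> (z \<oplus>\<^bsub>T\<^esub> z') = tp x \<alpha> y \<beta> z \<oplus>\<^bsub>T\<^esub> tp x \<alpha> y \<beta> z'"
    and tp_assoc_12:
    "\<lbrakk>x \<in> carrier T; y \<in> carrier T; z \<in> carrier T; u \<in> carrier T; v \<in> carrier T;
      \<alpha> \<in> carrier \<Gamma>; \<beta> \<in> carrier \<Gamma>; \<gamma> \<in> carrier \<Gamma>; \<delta> \<in> carrier \<Gamma>\<rbrakk>
      \<Longrightarrow> tp (tp x \<alpha> y \<beta> z) \<gamma> u \<delta> v = tp x \<alpha> (tp y \<beta> z \<gamma> u) \<delta> v"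
    and tp_assoc_23:
    "\<lbrakk>x \<in> carrier T; y \<in> carrier T; z \<in> carrier T; u \<in> carrier T; v \<in> carrier T;
      \<alpha> \<in> carrier \<Gamma>; \<beta> \<in> carrier \<Gamma>; \<gamma> \<in> carrier \<Gamma>; \<delta> \<in> carrier \<Gamma>\<rbrakk>
      \<Longrightarrow> tp x \<alpha> (tp y \<beta> z \<gamma> u) \<delta> v = tp x \<alpha> y \<beta> (tp z \<gamma> u \<delta> v)"

type_synonym ('t, 'g) quad = "'t \<times> 'g \<times> 't \<times> 'g"
type_synonym ('t, 'g) four_tensor = "(('t, 'g) quad \<Rightarrow>\<^sub>0 int) set"
type_synonym ('t, 'g) operator = "('t, 'g) four_tensor set"
type_synonym ('t, 'g) unital_operator = "int \<times> ('t, 'g) operator"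

text \<open>
  \<open>F(T, \<Gamma>) = T \<otimes> \<Gamma> \<otimes> T \<otimes> \<Gamma>\<close> is the free abelian group on quadruples modulo additivity in each of the
  four positions.  Its multiplication is induced by the one which extends
  \<open>(a, \<alpha>, b, \<beta>) (c, \<gamma>, d, \<delta>) = (a \<alpha> b \<beta> c, \<gamma>, d, \<delta>)\<close> bilinearly to the free abelian group.  The rings
  \<open>quad_ring\<close>, \<open>tensor_ring\<close> and \<open>operator_ring\<close> have no unit; the field \<open>one\<close> of their records is
  meaningless.
\<close>

definition quads :: "'t ring \<Rightarrow> 'g ring \<Rightarrow> ('t, 'g) quad set" where
  "quads T \<Gamma> = carrier T \<times> carrier \<Gamma> \<times> carrier T \<times> carrier \<Gamma>"

fun quad_mult :: "('t \<Rightarrow> 'g \<Rightarrow> 't \<Rightarrow> 'g \<Rightarrow> 't \<Rightarrow> 't) \<Rightarrow> ('t, 'g) quad \<Rightarrow> ('t, 'g) quad \<Rightarrow> ('t, 'g) quad"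
  where "quad_mult tp (a, \<alpha>, b, \<beta>) (c, \<gamma>, d, \<delta>) = (tp a \<alpha> b \<beta> c, \<gamma>, d, \<delta>)"

definition quad_ring :: "'t ring \<Rightarrow> 'g ring \<Rightarrow> ('t \<Rightarrow> 'g \<Rightarrow> 't \<Rightarrow> 'g \<Rightarrow> 't \<Rightarrow> 't) \<Rightarrow>
    (('t, 'g) quad \<Rightarrow>\<^sub>0 int) ring"
  where "quad_ring T \<Gamma> tp = \<lparr>carrier = {c. Poly_Mapping.keys c \<subseteq> quads T \<Gamma>},
    mult = \<lambda>c d. frag_extend (\<lambda>p. frag_extend (\<lambda>q. frag_of (quad_mult tp p q)) d) c,
    one = undefined, zero = 0, add = (+)\<rparr>"

definition quad_relators :: "'t ring \<Rightarrow> 'g ring \<Rightarrow> (('t, 'g) quad \<Rightarrow>\<^sub>0 int) set" where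
  "quad_relators T \<Gamma> =
    {frag_of (a \<oplus>\<^bsub>T\<^esub> a', \<alpha>, b, \<beta>) - frag_of (a, \<alpha>, b, \<beta>) - frag_of (a', \<alpha>, b, \<beta>) | a a' \<alpha> b \<beta>.
       a \<in> carrier T \<and> a' \<in> carrier T \<and> \<alpha> \<in> carrier \<Gamma> \<and> b \<in> carrier T \<and> \<beta> \<in> carrier \<Gamma>} \<union>
    {frag_of (a, \<alpha> \<oplus>\<^bsub>\<Gamma>\<^esub> \<alpha>', b, \<beta>) - frag_of (a, \<alpha>, b, \<beta>) - frag_of (a, \<alpha>', b, \<beta>) | a \<alpha> \<alpha>' b \<beta>.
       a \<in> carrier T \<and> \<alpha> \<in> carrier \<Gamma> \<and> \<alpha>' \<in> carrier \<Gamma> \<and> b \<in> carrier T \<and> \<beta> \<in> carrier \<Gamma>} \<union>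
    {frag_of (a, \<alpha>, b \<oplus>\<^bsub>T\<^esub> b', \<beta>) - frag_of (a, \<alpha>, b, \<beta>) - frag_of (a, \<alpha>, b', \<beta>) | a \<alpha> b b' \<beta>.
       a \<in> carrier T \<and> \<alpha> \<in> carrier \<Gamma> \<and> b \<in> carrier T \<and> b' \<in> carrier T \<and> \<beta> \<in> carrier \<Gamma>} \<union>
    {frag_of (a, \<alpha>, b, \<beta> \<oplus>\<^bsub>\<Gamma>\<^esub> \<beta>') - frag_of (a, \<alpha>, b, \<beta>) - frag_of (a, \<alpha>, b, \<beta>') | a \<alpha> b \<beta> \<beta>'.
       a \<in> carrier T \<and> \<alpha> \<in> carrier \<Gamma> \<and> b \<in> carrier T \<and> \<beta> \<in> carrier \<Gamma> \<and> \<beta>' \<in> carrier \<Gamma>}"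

definition quad_null :: "'t ring \<Rightarrow> 'g ring \<Rightarrow> ('t \<Rightarrow> 'g \<Rightarrow> 't \<Rightarrow> 'g \<Rightarrow> 't \<Rightarrow> 't) \<Rightarrow>
    (('t, 'g) quad \<Rightarrow>\<^sub>0 int) set"
  where "quad_null T \<Gamma> tp = generate (add_monoid (quad_ring T \<Gamma> tp)) (quad_relators T \<Gamma>)"

definition tensor_ring :: "'t ring \<Rightarrow> 'g ring \<Rightarrow> ('t \<Rightarrow> 'g \<Rightarrow> 't \<Rightarrow> 'g \<Rightarrow> 't \<Rightarrow> 't) \<Rightarrow>
    ('t, 'g) four_tensor ring"
  where "tensor_ring T \<Gamma> tp = quad_ring T \<Gamma> tp Quot quad_null T \<Gamma> tp"

definition pure_tensor :: "'t ring \<Rightarrow> 'g ring \<Rightarrow> ('t \<Rightarrow> 'g \<Rightarrow> 't \<Rightarrow> 'g \<Rightarrow> 't \<Rightarrow> 't) \<Rightarrow>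
    't \<Rightarrow> 'g \<Rightarrow> 't \<Rightarrow> 'g \<Rightarrow> ('t, 'g) four_tensor"
  where "pure_tensor T \<Gamma> tp a \<alpha> b \<beta> = quad_null T \<Gamma> tp +>\<^bsub>quad_ring T \<Gamma> tp\<^esub> frag_of (a, \<alpha>, b, \<beta>)"

text \<open>
  Two-sided ideals of a ring that need not have a unit (\<open>ideal\<close> and \<open>genideal\<close> of HOL-Algebra
  presuppose one).
\<close>

definition two_sided_ideal :: "'a set \<Rightarrow> 'a ring \<Rightarrow> bool" where
  "two_sided_ideal I R \<longleftrightarrow> additive_subgroup I R \<and>
     (\<forall>a\<in>I. \<forall>x\<in>carrier R. x \<otimes>\<^bsub>R\<^esub> a \<in> I \<and> a \<otimes>\<^bsub>R\<^esub> x \<in> I)"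

definition generated_ideal :: "'a ring \<Rightarrow> 'a set \<Rightarrow> 'a set" where
  "generated_ideal R S = \<Inter>{I. two_sided_ideal I R \<and> S \<subseteq> I}"

definition J_ideal :: "'t ring \<Rightarrow> 'g ring \<Rightarrow> ('t \<Rightarrow> 'g \<Rightarrow> 't \<Rightarrow> 'g \<Rightarrow> 't \<Rightarrow> 't) \<Rightarrow>
    ('t, 'g) four_tensor set"
  where "J_ideal T \<Gamma> tp = generated_ideal (tensor_ring T \<Gamma> tp)
    {pure_tensor T \<Gamma> tp (tp a \<alpha> b \<beta> c) \<gamma> d \<delta> \<ominus>\<^bsub>tensor_ring T \<Gamma> tp\<^esub>
       pure_tensor T \<Gamma> tp a \<alpha> (tp b \<beta> c \<gamma> d) \<delta> | a \<alpha> b \<beta> c \<gamma> d \<delta>.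
       a \<in> carrier T \<and> b \<in> carrier T \<and> c \<in> carrier T \<and> d \<in> carrier T \<and>
       \<alpha> \<in> carrier \<Gamma> \<and> \<beta> \<in> carrier \<Gamma> \<and> \<gamma> \<in> carrier \<Gamma> \<and> \<delta> \<in> carrier \<Gamma>}"

definition operator_ring :: "'t ring \<Rightarrow> 'g ring \<Rightarrow> ('t \<Rightarrow> 'g \<Rightarrow> 't \<Rightarrow> 'g \<Rightarrow> 't \<Rightarrow> 't) \<Rightarrow>
    ('t, 'g) operator ring"
  where "operator_ring T \<Gamma> tp = tensor_ring T \<Gamma> tp Quot J_ideal T \<Gamma> tp"

definition unital_operator_ring :: "'t ring \<Rightarrow> 'g ring \<Rightarrow> ('t \<Rightarrow> 'g \<Rightarrow> 't \<Rightarrow> 'g \<Rightarrow> 't \<Rightarrow> 't) \<Rightarrow>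
    ('t, 'g) unital_operator ring"
  where "unital_operator_ring T \<Gamma> tp = (let S = operator_ring T \<Gamma> tp in
    \<lparr>carrier = UNIV \<times> carrier S,
     mult = \<lambda>(n, r) (m, s). (n * m, [n] \<cdot>\<^bsub>S\<^esub> s \<oplus>\<^bsub>S\<^esub> [m] \<cdot>\<^bsub>S\<^esub> r \<oplus>\<^bsub>S\<^esub> r \<otimes>\<^bsub>S\<^esub> s),
     one = (1, \<zero>\<^bsub>S\<^esub>), zero = (0, \<zero>\<^bsub>S\<^esub>),
     add = \<lambda>(n, r) (m, s). (n + m, r \<oplus>\<^bsub>S\<^esub> s)\<rparr>)"

text \<open>Endomorphisms are represented by functions that are \<open>undefined\<close> outside the carrier.\<close>

definition End_ring :: "'t ring \<Rightarrow> ('t \<Rightarrow> 't) ring" where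
  "End_ring T = \<lparr>carrier = hom (add_monoid T) (add_monoid T) \<inter> extensional (carrier T),
     mult = compose (carrier T), one = \<lambda>x\<in>carrier T. x,
     zero = \<lambda>x\<in>carrier T. \<zero>\<^bsub>T\<^esub>, add = \<lambda>f g. \<lambda>x\<in>carrier T. f x \<oplus>\<^bsub>T\<^esub> g x\<rparr>"

definition quad_action :: "'t ring \<Rightarrow> ('t \<Rightarrow> 'g \<Rightarrow> 't \<Rightarrow> 'g \<Rightarrow> 't \<Rightarrow> 't) \<Rightarrow>
    (('t, 'g) quad \<Rightarrow>\<^sub>0 int) \<Rightarrow> 't \<Rightarrow> 't"
  where "quad_action T tp c = (\<lambda>x\<in>carrier T. \<Oplus>\<^bsub>T\<^esub>q\<in>Poly_Mapping.keys c.
    [Poly_Mapping.lookup c q] \<cdot>\<^bsub>T\<^esub> (case q of (a, \<alpha>, b, \<beta>) \<Rightarrow> tp a \<alpha> b \<beta> x))"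

text \<open>
  An element \<open>u\<close> of \<open>O(T, \<Gamma>)\<close> is a coset of cosets, so \<open>\<Union>u\<close> is the set of all formal sums of
  quadruples that represent it.
\<close>

definition regular_rep :: "'t ring \<Rightarrow> ('t \<Rightarrow> 'g \<Rightarrow> 't \<Rightarrow> 'g \<Rightarrow> 't \<Rightarrow> 't) \<Rightarrow>
    ('t, 'g) operator \<Rightarrow> 't \<Rightarrow> 't"
  where "regular_rep T tp u = the_elem (quad_action T tp ` \<Union>u)"

definition unital_regular_rep :: "'t ring \<Rightarrow> ('t \<Rightarrow> 'g \<Rightarrow> 't \<Rightarrow> 'g \<Rightarrow> 't \<Rightarrow> 't) \<Rightarrow>
    ('t, 'g) unital_operator \<Rightarrow> 't \<Rightarrow> 't"
  where "unital_regular_rep T tp = (\<lambda>(n, u).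
    [n] \<cdot>\<^bsub>End_ring T\<^esub> \<one>\<^bsub>End_ring T\<^esub> \<oplus>\<^bsub>End_ring T\<^esub> regular_rep T tp u)"

definition regular_operator_ring :: "'t ring \<Rightarrow> 'g ring \<Rightarrow> ('t \<Rightarrow> 'g \<Rightarrow> 't \<Rightarrow> 'g \<Rightarrow> 't \<Rightarrow> 't) \<Rightarrow>
    ('t \<Rightarrow> 't) ring"
  where "regular_operator_ring T \<Gamma> tp = (End_ring T)
    \<lparr>carrier := unital_regular_rep T tp ` carrier (unital_operator_ring T \<Gamma> tp)\<rparr>"

definition unital_regular_defect :: "'t ring \<Rightarrow> 'g ring \<Rightarrow> ('t \<Rightarrow> 'g \<Rightarrow> 't \<Rightarrow> 'g \<Rightarrow> 't \<Rightarrow> 't) \<Rightarrow>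
    ('t, 'g) unital_operator set"
  where "unital_regular_defect T \<Gamma> tp =
    a_kernel (unital_operator_ring T \<Gamma> tp) (End_ring T) (unital_regular_rep T tp)"

text \<open>\<open>R\<close> as a left and as a right module over \<open>A\<close>.\<close>

definition regular_left :: "'t ring \<Rightarrow> 'g ring \<Rightarrow> ('t \<Rightarrow> 'g \<Rightarrow> 't \<Rightarrow> 'g \<Rightarrow> 't \<Rightarrow> 't) \<Rightarrow>
    (('t, 'g) unital_operator, 't \<Rightarrow> 't) module"
  where "regular_left T \<Gamma> tp =
    restrict_scalars (unital_regular_rep T tp) (self_module (regular_operator_ring T \<Gamma> tp))"

definition regular_right :: "'t ring \<Rightarrow> 'g ring \<Rightarrow> ('t \<Rightarrow> 'g \<Rightarrow> 't \<Rightarrow> 'g \<Rightarrow> 't \<Rightarrow> 't) \<Rightarrow>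
    (('t, 'g) unital_operator, 't \<Rightarrow> 't) module"
  where "regular_right T \<Gamma> tp =
    restrict_scalars (unital_regular_rep T tp) (self_module (op_ring (regular_operator_ring T \<Gamma> tp)))"

text \<open>
  The bimodule \<open>C = K / K\<^sup>2\<close>, as a left and as a right module.  An element of \<open>R\<close> acts through its
  lifts to \<open>A\<close>: like \<open>rcoset_mult\<close>, the union below is over cosets that all coincide.
\<close>

definition conormal_left :: "'t ring \<Rightarrow> 'g ring \<Rightarrow> ('t \<Rightarrow> 'g \<Rightarrow> 't \<Rightarrow> 'g \<Rightarrow> 't \<Rightarrow> 't) \<Rightarrow>
    ('t \<Rightarrow> 't, ('t, 'g) unital_operator set) module"
  where "conormal_left T \<Gamma> tp =
    (let A = unital_operator_ring T \<Gamma> tp; K = unital_regular_defect T \<Gamma> tp; K2 = ideal_prod A K K in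
     \<lparr>carrier = (\<lambda>k. K2 +>\<^bsub>A\<^esub> k) ` K, mult = undefined, one = undefined, zero = K2,
      add = set_add A,
      smult = \<lambda>r X. \<Union>a\<in>{a \<in> carrier A. unital_regular_rep T tp a = r}. \<Union>k\<in>X. K2 +>\<^bsub>A\<^esub> (a \<otimes>\<^bsub>A\<^esub> k)\<rparr>)"

definition conormal_right :: "'t ring \<Rightarrow> 'g ring \<Rightarrow> ('t \<Rightarrow> 'g \<Rightarrow> 't \<Rightarrow> 'g \<Rightarrow> 't \<Rightarrow> 't) \<Rightarrow>
    ('t \<Rightarrow> 't, ('t, 'g) unital_operator set) module"
  where "conormal_right T \<Gamma> tp =
    (let A = unital_operator_ring T \<Gamma> tp; K = unital_regular_defect T \<Gamma> tp; K2 = ideal_prod A K K in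
     \<lparr>carrier = (\<lambda>k. K2 +>\<^bsub>A\<^esub> k) ` K, mult = undefined, one = undefined, zero = K2,
      add = set_add A,
      smult = \<lambda>r X. \<Union>a\<in>{a \<in> carrier A. unital_regular_rep T tp a = r}. \<Union>k\<in>X. K2 +>\<^bsub>A\<^esub> (k \<otimes>\<^bsub>A\<^esub> a)\<rparr>)"

end

theory Submission
  imports Defs
begin

text \<open>
  Let \<open>P\<close> be a projective resolution of \<open>R = A / K\<close>.  Choose \<open>p \<in> P 0\<close> over \<open>1 \<in> R\<close>.  For \<open>k \<in> K\<close> the
  element \<open>k p\<close> is the boundary of some \<open>y \<in> P 1\<close>, unique up to the image of \<open>P 2\<close>, and \<open>k \<mapsto> y\<close>
  induces both isomorphisms: \<open>[k] \<otimes> m \<mapsto> [y \<otimes> m]\<close> from \<open>C \<otimes> M\<close> to \<open>Tor\<^sub>1\<close>, and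
  \<open>[\<phi>] \<mapsto> ([k] \<mapsto> \<phi> y)\<close> from \<open>Ext\<^sup>1\<close> to \<open>Hom (C, M)\<close>.  They are well defined on \<open>C = K / K\<^sup>2\<close> because
  products \<open>k l\<close> can be lifted to multiples \<open>k y\<close>, which vanish as \<open>K\<close> annihilates \<open>M\<close>.  The inverses
  come from \<open>P 1 \<rightarrow> C\<close>, \<open>x \<mapsto> [s (d x)]\<close>, where \<open>s : P 0 \<rightarrow> A\<close> lifts the augmentation: the
  endomorphism \<open>x \<mapsto> s x p\<close> of \<open>P 0\<close> is homotopic to the identity, and \<open>s p \<equiv> 1\<close> modulo \<open>K\<close>.
\<close>

text \<open>The resolution is arbitrary, so no second resolution and no long exact sequence is
  invoked: all happens between \<open>P 2\<close> and \<open>P 0\<close>, where exactness makes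
  lifts unique up to the image of \<open>P 2\<close> and projectivity of \<open>P 0\<close> supplies
  the augmentation lift and the homotopy. A lift of \<open>k\<close> is still a choice, so every map
  is built by composing with some \<open>\<psi>\<close> out of \<open>P 1\<close> that is blind to
  the choice. For Ext, \<open>\<psi>\<close> is a cocycle; for Tor, it is
  \<open>x \<mapsto> x \<otimes> m\<close> modulo boundaries, with \<open>m\<close> fixed. The
  homotopy gives one identity, \<open>\<psi> x = \<psi> (lift (c x)) + \<psi> (H (d x))\<close>. Its
  last term is a coboundary in the first case and vanishes on cycles in the second, which yields
  injectivity in both. Right modules are left modules over the opposite ring, so a single comparison
  serves both halves. That the unital operator ring is a ring and the representation multiplicative
  is not computed with formal sums: both are contained in the assertion that the resolved object is
  a module over it.\<close>

section \<open>Linear maps between modules over a noncommutative ring\<close>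

lemma linear_mapsI:
  assumes "\<And>x. x \<in> carrier M \<Longrightarrow> f x \<in> carrier N"
    and "\<And>x y. \<lbrakk>x \<in> carrier M; y \<in> carrier M\<rbrakk> \<Longrightarrow> f (x \<oplus>\<^bsub>M\<^esub> y) = f x \<oplus>\<^bsub>N\<^esub> f y"
    and "\<And>a x. \<lbrakk>a \<in> carrier R; x \<in> carrier M\<rbrakk> \<Longrightarrow> f (a \<odot>\<^bsub>M\<^esub> x) = a \<odot>\<^bsub>N\<^esub> f x"
  shows "f \<in> linear_maps R M N"
  using assms by (simp add: linear_maps_def)

lemma linear_mapsD:
  assumes "f \<in> linear_maps R M N"
  shows linear_closed: "x \<in> carrier M \<Longrightarrow> f x \<in> carrier N"
    and linear_add: "\<lbrakk>x \<in> carrier M; y \<in> carrier M\<rbrakk> \<Longrightarrow> f (x \<oplus>\<^bsub>M\<^esub> y) = f x \<oplus>\<^bsub>N\<^esub> f y"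
    and linear_smult: "\<lbrakk>a \<in> carrier R; x \<in> carrier M\<rbrakk> \<Longrightarrow> f (a \<odot>\<^bsub>M\<^esub> x) = a \<odot>\<^bsub>N\<^esub> f x"
  using assms by (auto simp: linear_maps_def)

lemma left_moduleI:
  assumes "ring R" "abelian_group M"
    and "\<And>a x. \<lbrakk>a \<in> carrier R; x \<in> carrier M\<rbrakk> \<Longrightarrow> a \<odot>\<^bsub>M\<^esub> x \<in> carrier M"
    and "\<And>a b x. \<lbrakk>a \<in> carrier R; b \<in> carrier R; x \<in> carrier M\<rbrakk>
      \<Longrightarrow> (a \<oplus>\<^bsub>R\<^esub> b) \<odot>\<^bsub>M\<^esub> x = a \<odot>\<^bsub>M\<^esub> x \<oplus>\<^bsub>M\<^esub> b \<odot>\<^bsub>M\<^esub> x"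
    and "\<And>a x y. \<lbrakk>a \<in> carrier R; x \<in> carrier M; y \<in> carrier M\<rbrakk>
      \<Longrightarrow> a \<odot>\<^bsub>M\<^esub> (x \<oplus>\<^bsub>M\<^esub> y) = a \<odot>\<^bsub>M\<^esub> x \<oplus>\<^bsub>M\<^esub> a \<odot>\<^bsub>M\<^esub> y"
    and "\<And>a b x. \<lbrakk>a \<in> carrier R; b \<in> carrier R; x \<in> carrier M\<rbrakk>
      \<Longrightarrow> (a \<otimes>\<^bsub>R\<^esub> b) \<odot>\<^bsub>M\<^esub> x = a \<odot>\<^bsub>M\<^esub> (b \<odot>\<^bsub>M\<^esub> x)"
    and "\<And>x. x \<in> carrier M \<Longrightarrow> \<one>\<^bsub>R\<^esub> \<odot>\<^bsub>M\<^esub> x = x"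
  shows "left_module R M"
  using assms by (simp add: left_module_def left_module_axioms_def)

lemma left_moduleD:
  assumes "left_module R M"
  shows "ring R" "abelian_group M"
  using assms by (simp_all add: left_module_def)

context left_module
begin

lemma smult_zero_right: "a \<in> carrier R \<Longrightarrow> a \<odot>\<^bsub>M\<^esub> \<zero>\<^bsub>M\<^esub> = \<zero>\<^bsub>M\<^esub>"
  using smult_r_distr[of a "\<zero>\<^bsub>M\<^esub>" "\<zero>\<^bsub>M\<^esub>"] smult_closed[of a "\<zero>\<^bsub>M\<^esub>"]
  by (metis M.add.l_cancel_one M.l_zero M.zero_closed)

lemma smult_zero_left: "x \<in> carrier M \<Longrightarrow> \<zero>\<^bsub>R\<^esub> \<odot>\<^bsub>M\<^esub> x = \<zero>\<^bsub>M\<^esub>"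
  using smult_l_distr[of "\<zero>\<^bsub>R\<^esub>" "\<zero>\<^bsub>R\<^esub>" x] smult_closed[of "\<zero>\<^bsub>R\<^esub>" x]
  by (metis M.add.l_cancel_one R.l_zero R.zero_closed)

lemma smult_finsum:
  assumes "finite D" "a \<in> carrier R" "u \<in> D \<rightarrow> carrier M"
  shows "a \<odot>\<^bsub>M\<^esub> (\<Oplus>\<^bsub>M\<^esub>b\<in>D. u b) = (\<Oplus>\<^bsub>M\<^esub>b\<in>D. a \<odot>\<^bsub>M\<^esub> u b)"
  using assms
proof (induction D rule: finite_induct)
  case empty
  then show ?case by (simp add: smult_zero_right)
next
  case (insert b D)
  have "u b \<in> carrier M" "u \<in> D \<rightarrow> carrier M" using insert by auto
  moreover have "(\<lambda>b. a \<odot>\<^bsub>M\<^esub> u b) \<in> D \<rightarrow> carrier M" "a \<odot>\<^bsub>M\<^esub> u b \<in> carrier M"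
    using insert smult_closed by auto
  ultimately show ?case using insert by (simp add: smult_r_distr)
qed

end

lemma linear_zero:
  assumes "abelian_group M" "abelian_group N" "f \<in> linear_maps R M N"
  shows "f \<zero>\<^bsub>M\<^esub> = \<zero>\<^bsub>N\<^esub>"
proof -
  interpret M: abelian_group M by fact
  interpret N: abelian_group N by fact
  show ?thesis
    using linear_add[OF assms(3), of "\<zero>\<^bsub>M\<^esub>" "\<zero>\<^bsub>M\<^esub>"] linear_closed[OF assms(3), of "\<zero>\<^bsub>M\<^esub>"]
    by (metis M.l_zero M.zero_closed N.add.l_cancel_one)
qed

lemma linear_minus:
  assumes "abelian_group M" "abelian_group N" "f \<in> linear_maps R M N"
    and "x \<in> carrier M" "y \<in> carrier M"
  shows "f (x \<ominus>\<^bsub>M\<^esub> y) = f x \<ominus>\<^bsub>N\<^esub> f y"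
proof -
  interpret M: abelian_group M by fact
  interpret N: abelian_group N by fact
  have "f (\<ominus>\<^bsub>M\<^esub> y) \<oplus>\<^bsub>N\<^esub> f y = \<zero>\<^bsub>N\<^esub>"
    using linear_add[OF assms(3), of "\<ominus>\<^bsub>M\<^esub> y" y] linear_zero[OF assms(1-3)] assms(5)
    by (simp add: M.l_neg)
  then have "f (\<ominus>\<^bsub>M\<^esub> y) = \<ominus>\<^bsub>N\<^esub> f y"
    using assms linear_closed[OF assms(3)] by (simp add: N.minus_equality)
  then show ?thesis
    using linear_add[OF assms(3), of x "\<ominus>\<^bsub>M\<^esub> y"] assms(4,5) by (simp add: a_minus_def)
qed

lemma linear_finsum:
  assumes "abelian_group M" "abelian_group N" "f \<in> linear_maps R M N"
    and "finite D" "u \<in> D \<rightarrow> carrier M"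
  shows "f (\<Oplus>\<^bsub>M\<^esub>b\<in>D. u b) = (\<Oplus>\<^bsub>N\<^esub>b\<in>D. f (u b))"
proof -
  interpret M: abelian_group M by fact
  interpret N: abelian_group N by fact
  show ?thesis
    using assms(4,5)
  proof (induction D rule: finite_induct)
    case empty
    then show ?case using linear_zero[OF assms(1-3)] by simp
  next
    case (insert b D)
    have "u b \<in> carrier M" "u \<in> D \<rightarrow> carrier M" using insert by auto
    moreover have "(\<lambda>b. f (u b)) \<in> D \<rightarrow> carrier N" "f (u b) \<in> carrier N"
      using insert linear_closed[OF assms(3)] by auto
    ultimately show ?case using insert by (simp add: linear_add[OF assms(3)])
  qed
qed

lemma linear_maps_compose:
  assumes "f \<in> linear_maps R L M" "g \<in> linear_maps R M N"
  shows "(\<lambda>x. g (f x)) \<in> linear_maps R L N"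
  using linear_mapsD[OF assms(1)] linear_mapsD[OF assms(2)] by (intro linear_mapsI) auto

lemma linear_maps_minus:
  assumes "left_module R N" "f \<in> linear_maps R M N" "g \<in> linear_maps R M N"
  shows "(\<lambda>x. f x \<ominus>\<^bsub>N\<^esub> g x) \<in> linear_maps R M N"
proof -
  interpret left_module R N by fact
  note f = linear_mapsD[OF assms(2)] and g = linear_mapsD[OF assms(3)]
  show ?thesis
  proof (rule linear_mapsI)
    fix x y assume "x \<in> carrier M" "y \<in> carrier M"
    then show "f (x \<oplus>\<^bsub>M\<^esub> y) \<ominus>\<^bsub>N\<^esub> g (x \<oplus>\<^bsub>M\<^esub> y) = (f x \<ominus>\<^bsub>N\<^esub> g x) \<oplus>\<^bsub>N\<^esub> (f y \<ominus>\<^bsub>N\<^esub> g y)"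
      using f g by (simp add: a_minus_def M.minus_add M.a_ac)
  next
    fix a x assume ax: "a \<in> carrier R" "x \<in> carrier M"
    \<comment> \<open>Multiplication by \<open>a\<close> is additive but in general not linear over
      a noncommutative ring. With an empty set of scalars, \<open>linear_maps\<close> consists of
      additive maps, so \<open>linear_minus\<close> applies.\<close>
    have "(\<lambda>x. a \<odot>\<^bsub>N\<^esub> x) \<in> linear_maps (R\<lparr>carrier := {}\<rparr>) N N"
      by (rule linear_mapsI) (simp_all add: ax smult_closed smult_r_distr)
    then have "a \<odot>\<^bsub>N\<^esub> (f x \<ominus>\<^bsub>N\<^esub> g x) = a \<odot>\<^bsub>N\<^esub> f x \<ominus>\<^bsub>N\<^esub> a \<odot>\<^bsub>N\<^esub> g x"
      using ax f g by (intro linear_minus[OF M.abelian_group_axioms M.abelian_group_axioms])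
    then show "f (a \<odot>\<^bsub>M\<^esub> x) \<ominus>\<^bsub>N\<^esub> g (a \<odot>\<^bsub>M\<^esub> x) = a \<odot>\<^bsub>N\<^esub> (f x \<ominus>\<^bsub>N\<^esub> g x)"
      using ax f g by simp
  qed (use f g in auto)
qed


section \<open>Lifting along projective modules\<close>

text \<open>Additional indices contribute zero. This brings combinations with different supports to
  a common index set.\<close>

lemma linear_combination_superset:
  assumes "left_module R X" "finite D" "{b. c b \<noteq> \<zero>\<^bsub>R\<^esub>} \<subseteq> D"
    and "c \<in> UNIV \<rightarrow> carrier R" "\<And>b. b \<in> D \<Longrightarrow> u b \<in> carrier X"
  shows "(\<Oplus>\<^bsub>X\<^esub>b\<in>{b. c b \<noteq> \<zero>\<^bsub>R\<^esub>}. c b \<odot>\<^bsub>X\<^esub> u b) = (\<Oplus>\<^bsub>X\<^esub>b\<in>D. c b \<odot>\<^bsub>X\<^esub> u b)"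
proof -
  interpret left_module R X by fact
  have "c b \<in> carrier R" for b using assms(4) by auto
  then show ?thesis
    using assms by (intro M.add.finprod_mono_neutral_cong_left)
      (auto simp: smult_zero_left smult_closed)
qed

text \<open>Preimages under \<open>g\<close> of the values of \<open>f\<close> on a basis are chosen
  and extended by the coefficients. Linearity comes from uniqueness of the coefficients.\<close>

lemma free_module_lift:
  fixes F :: "('a, 'f) module"
  assumes F: "free_module R F" and X: "left_module R X" and Y: "left_module R Y"
    and g: "g \<in> linear_maps R X Y" and f: "f \<in> linear_maps R F Y"
    and fg: "f ` carrier F \<subseteq> g ` carrier X"
  shows "\<exists>\<phi>\<in>linear_maps R F X. \<forall>x\<in>carrier F. g (\<phi> x) = f x"
proof -
  define supp :: "('f \<Rightarrow> 'a) \<Rightarrow> 'f set" where "supp = (\<lambda>c. {b. c b \<noteq> \<zero>\<^bsub>R\<^esub>})"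
  define rep where "rep = (\<lambda>B x c. c \<in> UNIV \<rightarrow> carrier R \<and> finite (supp c) \<and> supp c \<subseteq> B \<and>
    x = (\<Oplus>\<^bsub>F\<^esub>b\<in>supp c. c b \<odot>\<^bsub>F\<^esub> b))"
  have F': "left_module R F" using F unfolding free_module_def by (rule conjunct1)
  have "\<exists>B\<subseteq>carrier F. \<forall>x\<in>carrier F. \<exists>!c. rep B x c"
    using F unfolding free_module_def rep_def supp_def by (rule conjunct2)
  then obtain B where B: "B \<subseteq> carrier F" and *: "\<forall>x\<in>carrier F. \<exists>!c. rep B x c"
    by (elim exE conjE)
  note ex1 = bspec[OF *]
  interpret F: left_module R F by fact
  interpret X: left_module R X by fact
  interpret Y: left_module R Y by fact
  have "\<forall>b\<in>B. \<exists>v\<in>carrier X. g v = f b" using fg B by (fastforce simp: image_subset_iff)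
  then obtain u where u: "\<And>b. b \<in> B \<Longrightarrow> u b \<in> carrier X" and gu: "\<And>b. b \<in> B \<Longrightarrow> g (u b) = f b"
    by metis
  define coef where "coef = (\<lambda>x. THE c. rep B x c)"
  have coef: "rep B x (coef x)" if "x \<in> carrier F" for x
    unfolding coef_def using ex1[OF that] by (rule theI')
  have coef_eq: "coef x = c" if "x \<in> carrier F" "rep B x c" for x c
    unfolding coef_def using ex1[OF that(1)] that(2) by (rule the1_equality[where P = "rep B x"])
  have coefD: "\<And>b. coef x b \<in> carrier R" "finite (supp (coef x))" "supp (coef x) \<subseteq> B"
    if "x \<in> carrier F" for x using coef[OF that] by (auto simp: rep_def)
  have sum_F: "(\<Oplus>\<^bsub>F\<^esub>b\<in>D. coef x b \<odot>\<^bsub>F\<^esub> b) = x"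
    if "x \<in> carrier F" "finite D" "D \<subseteq> B" "supp (coef x) \<subseteq> D" for x D
    using coef[OF that(1)] linear_combination_superset[of R F D "coef x" "\<lambda>b. b"] that B F'
    unfolding rep_def supp_def by (metis subsetD)
  define \<phi> where "\<phi> = (\<lambda>x. \<Oplus>\<^bsub>X\<^esub>b\<in>supp (coef x). coef x b \<odot>\<^bsub>X\<^esub> u b)"
  have \<phi>_eq: "\<phi> x = (\<Oplus>\<^bsub>X\<^esub>b\<in>D. coef x b \<odot>\<^bsub>X\<^esub> u b)"
    if "x \<in> carrier F" "finite D" "D \<subseteq> B" "supp (coef x) \<subseteq> D" for x D
    using linear_combination_superset[of R X D "coef x" u] that coefD(1)[OF that(1)] u X
    unfolding \<phi>_def supp_def by blast
  have cuX: "(\<lambda>b. coef x b \<odot>\<^bsub>X\<^esub> u b) \<in> D \<rightarrow> carrier X"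
    and cuF: "(\<lambda>b. coef x b \<odot>\<^bsub>F\<^esub> b) \<in> D \<rightarrow> carrier F"
    if "x \<in> carrier F" "D \<subseteq> B" for x D
    using that B by (intro Pi_I X.smult_closed F.smult_closed coefD(1) u; blast)+
  have "\<phi> \<in> linear_maps R F X"
  proof (rule linear_mapsI)
    show "\<phi> x \<in> carrier X" if "x \<in> carrier F" for x
      unfolding \<phi>_def using cuX that coefD by (intro X.M.finsum_closed) auto
  next
    fix x y assume x: "x \<in> carrier F" and y: "y \<in> carrier F"
    \<comment> \<open>Coefficients of \<open>x\<close> and \<open>y\<close> may cancel, so the
      support of their sum can be smaller than \<open>D\<close>. Uniqueness of the representation
      still identifies the coefficients of the sum with \<open>c\<close>.\<close>
    define D where "D = supp (coef x) \<union> supp (coef y)"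
    have D: "finite D" "D \<subseteq> B" using coefD x y by (auto simp: D_def)
    define c where "c = (\<lambda>b. coef x b \<oplus>\<^bsub>R\<^esub> coef y b)"
    have supp: "supp c \<subseteq> D" by (auto simp: supp_def D_def c_def)
    have c: "c \<in> UNIV \<rightarrow> carrier R" using coefD(1) x y by (auto simp: c_def)
    have "(\<Oplus>\<^bsub>F\<^esub>b\<in>supp c. c b \<odot>\<^bsub>F\<^esub> b) = (\<Oplus>\<^bsub>F\<^esub>b\<in>D. c b \<odot>\<^bsub>F\<^esub> b)"
      using linear_combination_superset[of R F D c "\<lambda>b. b"] D supp c F' B unfolding supp_def by blast
    also have "\<dots> = (\<Oplus>\<^bsub>F\<^esub>b\<in>D. coef x b \<odot>\<^bsub>F\<^esub> b \<oplus>\<^bsub>F\<^esub> coef y b \<odot>\<^bsub>F\<^esub> b)"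
      using D B cuF[OF x D(2)] cuF[OF y D(2)] coefD(1) x y
      by (intro F.M.finsum_cong') (auto simp: c_def F.smult_l_distr)
    also have "\<dots> = x \<oplus>\<^bsub>F\<^esub> y"
      using cuF[OF x D(2)] cuF[OF y D(2)] sum_F[OF x D] sum_F[OF y D]
      by (simp add: F.M.finsum_addf D_def)
    finally have rep: "rep B (x \<oplus>\<^bsub>F\<^esub> y) c"
      using c supp D finite_subset by (auto simp: rep_def)
    then have "coef (x \<oplus>\<^bsub>F\<^esub> y) = c" using x y by (intro coef_eq) auto
    then have "\<phi> (x \<oplus>\<^bsub>F\<^esub> y) = (\<Oplus>\<^bsub>X\<^esub>b\<in>D. c b \<odot>\<^bsub>X\<^esub> u b)"
      using \<phi>_eq[of "x \<oplus>\<^bsub>F\<^esub> y" D] D supp x y by simp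
    also have "\<dots> = (\<Oplus>\<^bsub>X\<^esub>b\<in>D. coef x b \<odot>\<^bsub>X\<^esub> u b \<oplus>\<^bsub>X\<^esub> coef y b \<odot>\<^bsub>X\<^esub> u b)"
      using D cuX[OF x D(2)] cuX[OF y D(2)] coefD(1) x y u
      by (intro X.M.finsum_cong') (auto simp: c_def X.smult_l_distr subset_iff)
    also have "\<dots> = \<phi> x \<oplus>\<^bsub>X\<^esub> \<phi> y"
      using cuX[OF x D(2)] cuX[OF y D(2)] \<phi>_eq[OF x D] \<phi>_eq[OF y D]
      by (simp add: X.M.finsum_addf D_def)
    finally show "\<phi> (x \<oplus>\<^bsub>F\<^esub> y) = \<phi> x \<oplus>\<^bsub>X\<^esub> \<phi> y" .
  next
    fix a x assume a: "a \<in> carrier R" and x: "x \<in> carrier F"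
    define D where "D = supp (coef x)"
    have D: "finite D" "D \<subseteq> B" using coefD x by (auto simp: D_def)
    define c where "c = (\<lambda>b. a \<otimes>\<^bsub>R\<^esub> coef x b)"
    have supp: "supp c \<subseteq> D" using a by (auto simp: supp_def D_def c_def)
    have c: "c \<in> UNIV \<rightarrow> carrier R" using coefD(1) x a by (auto simp: c_def)
    have "(\<Oplus>\<^bsub>F\<^esub>b\<in>supp c. c b \<odot>\<^bsub>F\<^esub> b) = (\<Oplus>\<^bsub>F\<^esub>b\<in>D. c b \<odot>\<^bsub>F\<^esub> b)"
      using linear_combination_superset[of R F D c "\<lambda>b. b"] D supp c F' B unfolding supp_def by blast
    also have "\<dots> = (\<Oplus>\<^bsub>F\<^esub>b\<in>D. a \<odot>\<^bsub>F\<^esub> (coef x b \<odot>\<^bsub>F\<^esub> b))"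
      using D B cuF[OF x D(2)] coefD(1) x a F.smult_closed
      by (intro F.M.finsum_cong') (auto simp: c_def F.smult_assoc subset_iff)
    also have "\<dots> = a \<odot>\<^bsub>F\<^esub> x"
      using F.smult_finsum[OF D(1) a cuF[OF x D(2)]] sum_F[OF x D] by (simp add: D_def)
    finally have rep: "rep B (a \<odot>\<^bsub>F\<^esub> x) c"
      using c supp D finite_subset by (auto simp: rep_def)
    then have "coef (a \<odot>\<^bsub>F\<^esub> x) = c" using x a F.smult_closed by (intro coef_eq) auto
    then have "\<phi> (a \<odot>\<^bsub>F\<^esub> x) = (\<Oplus>\<^bsub>X\<^esub>b\<in>D. c b \<odot>\<^bsub>X\<^esub> u b)"
      using \<phi>_eq[of "a \<odot>\<^bsub>F\<^esub> x" D] D supp x a F.smult_closed by simp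
    also have "\<dots> = (\<Oplus>\<^bsub>X\<^esub>b\<in>D. a \<odot>\<^bsub>X\<^esub> (coef x b \<odot>\<^bsub>X\<^esub> u b))"
      using D u cuX[OF x D(2)] coefD(1) x a X.smult_closed
      by (intro X.M.finsum_cong') (auto simp: c_def X.smult_assoc subset_iff)
    also have "\<dots> = a \<odot>\<^bsub>X\<^esub> \<phi> x"
      using X.smult_finsum[OF D(1) a cuX[OF x D(2)]] \<phi>_eq[OF x D] by (simp add: D_def)
    finally show "\<phi> (a \<odot>\<^bsub>F\<^esub> x) = a \<odot>\<^bsub>X\<^esub> \<phi> x" .
  qed
  moreover have "g (\<phi> x) = f x" if x: "x \<in> carrier F" for x
  proof -
    define D where "D = supp (coef x)"
    have D: "finite D" "D \<subseteq> B" using coefD x by (auto simp: D_def)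
    have "g (\<phi> x) = (\<Oplus>\<^bsub>Y\<^esub>b\<in>D. g (coef x b \<odot>\<^bsub>X\<^esub> u b))"
      using linear_finsum[OF X.M.abelian_group_axioms Y.M.abelian_group_axioms g D(1) cuX[OF x D(2)]]
      by (simp add: \<phi>_def D_def)
    also have "\<dots> = (\<Oplus>\<^bsub>Y\<^esub>b\<in>D. f (coef x b \<odot>\<^bsub>F\<^esub> b))"
      using D B u gu coefD(1)[OF x] linear_mapsD[OF g] linear_mapsD[OF f] Y.smult_closed
      by (intro Y.M.finsum_cong') (auto simp: subset_iff)
    also have "\<dots> = f x"
      using linear_finsum[OF F.M.abelian_group_axioms Y.M.abelian_group_axioms f D(1) cuF[OF x D(2)]]
        sum_F[OF x D] by (simp add: D_def)
    finally show ?thesis .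
  qed
  ultimately show ?thesis by blast
qed

text \<open>The composite \<open>f \<circ> r\<close> is lifted on the free module and the lift
  pulled back along \<open>i\<close>. Asking for inclusion of images instead of surjectivity of
  \<open>g\<close> allows lifting along \<open>d 0\<close>, whose image is only the kernel of the
  augmentation.\<close>

lemma projective_module_lift:
  assumes P: "projective_module R P" and X: "left_module R X" and Y: "left_module R Y"
    and g: "g \<in> linear_maps R X Y" and f: "f \<in> linear_maps R P Y"
    and fg: "f ` carrier P \<subseteq> g ` carrier X"
  obtains \<phi> where "\<phi> \<in> linear_maps R P X" "\<And>x. x \<in> carrier P \<Longrightarrow> g (\<phi> x) = f x"
proof -
  from P obtain F :: "('a, 'b \<Rightarrow> 'a) module" and i r where F: "free_module R F"
    and i: "i \<in> linear_maps R P F" and r: "r \<in> linear_maps R F P"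
    and ri: "\<And>x. x \<in> carrier P \<Longrightarrow> r (i x) = x"
    unfolding projective_module_def by blast
  have "(\<lambda>x. f (r x)) ` carrier F \<subseteq> g ` carrier X"
    using fg linear_closed[OF r] by auto
  from free_module_lift[OF F X Y g linear_maps_compose[OF r f] this]
  obtain \<phi> where \<phi>: "\<phi> \<in> linear_maps R F X" "\<And>x. x \<in> carrier F \<Longrightarrow> g (\<phi> x) = f (r x)" by blast
  show thesis
  proof
    show "(\<lambda>x. \<phi> (i x)) \<in> linear_maps R P X" using i \<phi>(1) by (rule linear_maps_compose)
    show "g (\<phi> (i x)) = f x" if "x \<in> carrier P" for x
      using \<phi>(2) linear_closed[OF i that] ri[OF that] by simp
  qed
qed

section \<open>Opposite rings, restriction of scalars, rings as modules over themselves\<close>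

lemma op_ring_simps [simp]:
  "carrier (op_ring R) = carrier R" "\<zero>\<^bsub>op_ring R\<^esub> = \<zero>\<^bsub>R\<^esub>" "\<one>\<^bsub>op_ring R\<^esub> = \<one>\<^bsub>R\<^esub>"
  "x \<oplus>\<^bsub>op_ring R\<^esub> y = x \<oplus>\<^bsub>R\<^esub> y" "x \<otimes>\<^bsub>op_ring R\<^esub> y = y \<otimes>\<^bsub>R\<^esub> x"
  by (simp_all add: op_ring_def)

lemma add_op_ring [simp]: "add (op_ring R) = add R"
  by (simp add: op_ring_def)

lemma add_monoid_op_ring: "add_monoid (op_ring R) = add_monoid R"
  by (simp add: op_ring_def)

lemma op_ring_op_ring [simp]: "op_ring (op_ring R) = R"
  by (simp add: op_ring_def)

lemma a_r_coset_op_ring [simp]: "I +>\<^bsub>op_ring R\<^esub> x = I +>\<^bsub>R\<^esub> x"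
  by (simp add: a_r_coset_def add_monoid_op_ring)

lemma set_add_op_ring [simp]: "set_add (op_ring R) = set_add R"
  by (simp add: set_add_def add_monoid_op_ring)

lemma a_kernel_op_ring [simp]: "a_kernel (op_ring R) (op_ring S) h = a_kernel R S h"
  by (simp add: a_kernel_def add_monoid_op_ring)

text \<open>One inclusion is proved for an arbitrary ring; applied to the opposite ring, it gives
  the other, since \<open>op_ring\<close> is an involution.\<close>

lemma ideal_prod_op_ring: "ideal_prod (op_ring R) I J = ideal_prod R J I"
proof -
  have "ideal_prod (op_ring S) I J \<subseteq> ideal_prod S J I" for S :: "'a ring" and I J
  proof
    fix x assume "x \<in> ideal_prod (op_ring S) I J"
    then show "x \<in> ideal_prod S J I"
      by induction (simp_all add: ideal_prod.prod ideal_prod.sum)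
  qed
  from this[of R I J] this[of "op_ring R" J I] show ?thesis by auto
qed

lemma ring_op_ring:
  assumes "ring R"
  shows "ring (op_ring R)"
proof -
  interpret ring R by fact
  show ?thesis
  proof (rule ringI)
    show "abelian_group (op_ring R)"
      by (rule comm_group_abelian_groupI) (simp only: add_monoid_op_ring a_comm_group)
    show "monoid (op_ring R)"
      by (rule monoidI) (auto simp: m_assoc)
  qed (auto simp: l_distr r_distr)
qed

lemma restrict_scalars_simps [simp]:
  "carrier (restrict_scalars h M) = carrier M" "\<zero>\<^bsub>restrict_scalars h M\<^esub> = \<zero>\<^bsub>M\<^esub>"
  "x \<oplus>\<^bsub>restrict_scalars h M\<^esub> y = x \<oplus>\<^bsub>M\<^esub> y" "a \<odot>\<^bsub>restrict_scalars h M\<^esub> x = h a \<odot>\<^bsub>M\<^esub> x"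
  by (simp_all add: restrict_scalars_def)

lemma add_restrict_scalars [simp]: "add (restrict_scalars h M) = add M"
  by (simp add: restrict_scalars_def)

lemma self_module_simps [simp]:
  "carrier (self_module R) = carrier R" "\<zero>\<^bsub>self_module R\<^esub> = \<zero>\<^bsub>R\<^esub>"
  "x \<oplus>\<^bsub>self_module R\<^esub> y = x \<oplus>\<^bsub>R\<^esub> y" "a \<odot>\<^bsub>self_module R\<^esub> x = a \<otimes>\<^bsub>R\<^esub> x"
  by (simp_all add: self_module_def)

lemma abelian_group_cong:
  assumes "abelian_group M" "carrier N = carrier M" "\<zero>\<^bsub>N\<^esub> = \<zero>\<^bsub>M\<^esub>" "add N = add M"
  shows "abelian_group N"
  using abelian_groupE[OF assms(1)] by (intro abelian_groupI) (simp_all add: assms)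

lemma left_module_self:
  assumes "ring R"
  shows "left_module R (self_module R)"
proof -
  interpret ring R by fact
  have "abelian_group (self_module R)"
    by (rule abelian_group_cong[OF abelian_group_axioms]) (simp_all add: self_module_def)
  then show ?thesis
    by (intro left_moduleI) (simp_all add: assms l_distr r_distr m_assoc)
qed

lemma left_module_restrict_scalars:
  assumes S: "ring S" and h: "h \<in> ring_hom S R" and M: "left_module R M"
  shows "left_module S (restrict_scalars h M)"
proof -
  interpret left_module R M by fact
  have "abelian_group (restrict_scalars h M)"
    by (rule abelian_group_cong[OF M.abelian_group_axioms]) simp_all
  then show ?thesis
    using ring_hom_memE[OF h] S
    by (intro left_moduleI)
      (simp_all add: smult_closed smult_l_distr smult_r_distr smult_assoc smult_one)
qed

lemma linear_maps_restrict_scalars: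
  assumes "h \<in> ring_hom S R" "f \<in> linear_maps R M N"
  shows "f \<in> linear_maps S (restrict_scalars h M) (restrict_scalars h N)"
  using linear_mapsD[OF assms(2)] ring_hom_closed[OF assms(1)] by (intro linear_mapsI) simp_all


section \<open>The conormal module of a surjective ring homomorphism\<close>

text \<open>The common pattern of both sides of the bimodule: \<open>conormal_left\<close> is the
  instance at the regular representation, \<open>conormal_right\<close> the instance at the same map
  between the opposite rings.\<close>

definition conormal :: "'a ring \<Rightarrow> 'b ring \<Rightarrow> ('a \<Rightarrow> 'b) \<Rightarrow> ('b, 'a set) module" where
  "conormal S R h =
    (let K = a_kernel S R h; K2 = ideal_prod S K K in
     \<lparr>carrier = (\<lambda>k. K2 +>\<^bsub>S\<^esub> k) ` K, mult = undefined, one = undefined, zero = K2,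
      add = set_add S,
      smult = \<lambda>r X. \<Union>a\<in>{a \<in> carrier S. h a = r}. \<Union>k\<in>X. K2 +>\<^bsub>S\<^esub> (a \<otimes>\<^bsub>S\<^esub> k)\<rparr>)"

locale surjective_ring_hom = S: ring S + R: ring R
  for S :: "'a ring" and R :: "'b ring" +
  fixes h :: "'a \<Rightarrow> 'b"
  assumes hom: "h \<in> ring_hom S R" and surj: "h ` carrier S = carrier R"
begin

abbreviation K :: "'a set" where "K \<equiv> a_kernel S R h"
abbreviation K2 :: "'a set" where "K2 \<equiv> ideal_prod S K K"
abbreviation C :: "('b, 'a set) module" where "C \<equiv> conormal S R h"

lemma surj': "r \<in> carrier R \<Longrightarrow> \<exists>a\<in>carrier S. h a = r"
  unfolding surj[symmetric] by (erule imageE) blast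

sublocale hom: ring_hom_ring S R h
  by (rule ring_hom_ringI2) (fact S.ring_axioms R.ring_axioms hom)+

lemma K_ideal: "ideal K S"
  by (rule hom.kernel_is_ideal)

lemma K2_ideal: "ideal K2 S"
  by (rule S.ideal_prod_is_ideal[OF K_ideal K_ideal])

sublocale K: ideal K S by (rule K_ideal)
sublocale K2: ideal K2 S by (rule K2_ideal)

lemma K_iff: "k \<in> K \<longleftrightarrow> k \<in> carrier S \<and> h k = \<zero>\<^bsub>R\<^esub>"
  by (simp only: a_kernel_def' mem_Collect_eq)

lemma K2_subset: "K2 \<subseteq> K"
  using S.ideal_prod_inter[OF K_ideal K_ideal] by auto

lemma K2_prod: "\<lbrakk>k \<in> K; l \<in> K\<rbrakk> \<Longrightarrow> k \<otimes>\<^bsub>S\<^esub> l \<in> K2"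
  by (rule ideal_prod.prod)

lemma coset_eq_iff:
  assumes "x \<in> carrier S" "y \<in> carrier S"
  shows "K2 +>\<^bsub>S\<^esub> x = K2 +>\<^bsub>S\<^esub> y \<longleftrightarrow> x \<ominus>\<^bsub>S\<^esub> y \<in> K2"
proof
  assume "K2 +>\<^bsub>S\<^esub> x = K2 +>\<^bsub>S\<^esub> y"
  then have "x \<in> K2 +>\<^bsub>S\<^esub> y" using K2.a_rcos_self[OF assms(1)] by simp
  then show "x \<ominus>\<^bsub>S\<^esub> y \<in> K2" by (simp only: K2.a_rcos_module_minus[OF S.ring_axioms assms(2,1)])
next
  assume "x \<ominus>\<^bsub>S\<^esub> y \<in> K2"
  then have "x \<in> K2 +>\<^bsub>S\<^esub> y" by (simp only: K2.a_rcos_module_minus[OF S.ring_axioms assms(2,1)])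
  then show "K2 +>\<^bsub>S\<^esub> x = K2 +>\<^bsub>S\<^esub> y" using K2.a_repr_independence'[OF _ assms(2)] by simp
qed

lemma carrier_conormal: "carrier C = (\<lambda>k. K2 +>\<^bsub>S\<^esub> k) ` K"
  and zero_conormal: "\<zero>\<^bsub>C\<^esub> = K2"
  and add_conormal: "add C = set_add S"
  by (simp_all add: conormal_def Let_def)

lemma conormal_closed: "k \<in> K \<Longrightarrow> K2 +>\<^bsub>S\<^esub> k \<in> carrier C"
  by (simp add: carrier_conormal)

lemma conormal_add:
  "\<lbrakk>k \<in> K; l \<in> K\<rbrakk> \<Longrightarrow> (K2 +>\<^bsub>S\<^esub> k) \<oplus>\<^bsub>C\<^esub> (K2 +>\<^bsub>S\<^esub> l) = K2 +>\<^bsub>S\<^esub> (k \<oplus>\<^bsub>S\<^esub> l)"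
  by (simp add: add_conormal K2.a_rcos_sum K_iff)

text \<open>Independence of the lift \<open>b\<close> of \<open>h a\<close> and of the
  representative \<open>l\<close> of the class of \<open>k\<close>: in
  \<open>b l - a k = (b - a) l + a (l - k)\<close> the first summand is a product of two elements of
  \<open>K\<close>, the second lies in the ideal \<open>K2\<close>.\<close>

lemma conormal_smult:
  assumes a: "a \<in> carrier S" and k: "k \<in> K"
  shows "h a \<odot>\<^bsub>C\<^esub> (K2 +>\<^bsub>S\<^esub> k) = K2 +>\<^bsub>S\<^esub> (a \<otimes>\<^bsub>S\<^esub> k)"
proof -
  have eq: "K2 +>\<^bsub>S\<^esub> (b \<otimes>\<^bsub>S\<^esub> l) = K2 +>\<^bsub>S\<^esub> (a \<otimes>\<^bsub>S\<^esub> k)"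
    if b: "b \<in> carrier S" "h b = h a" and l: "l \<in> K2 +>\<^bsub>S\<^esub> k" for b l
  proof -
    have kS: "k \<in> carrier S" using k by (simp add: K_iff)
    have lS: "l \<in> carrier S" using K2.a_elemrcos_carrier kS l by blast
    have lk: "l \<ominus>\<^bsub>S\<^esub> k \<in> K2" using K2.a_rcos_module_minus[OF S.ring_axioms kS lS] l by simp
    have "b \<ominus>\<^bsub>S\<^esub> a \<in> K"
      using a b by (simp add: K_iff a_minus_def R.r_neg)
    moreover have "l \<in> K"
    proof -
      have "l = (l \<ominus>\<^bsub>S\<^esub> k) \<oplus>\<^bsub>S\<^esub> k" using lS kS by algebra
      then show ?thesis using lk k K2_subset by (metis K.a_closed subsetD)
    qed
    ultimately have "(b \<ominus>\<^bsub>S\<^esub> a) \<otimes>\<^bsub>S\<^esub> l \<oplus>\<^bsub>S\<^esub> a \<otimes>\<^bsub>S\<^esub> (l \<ominus>\<^bsub>S\<^esub> k) \<in> K2"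
      using lk a by (intro K2.a_closed K2_prod K2.I_l_closed)
    also have "(b \<ominus>\<^bsub>S\<^esub> a) \<otimes>\<^bsub>S\<^esub> l \<oplus>\<^bsub>S\<^esub> a \<otimes>\<^bsub>S\<^esub> (l \<ominus>\<^bsub>S\<^esub> k) = b \<otimes>\<^bsub>S\<^esub> l \<ominus>\<^bsub>S\<^esub> a \<otimes>\<^bsub>S\<^esub> k"
      using a b(1) lS kS by algebra
    finally show ?thesis using a b(1) lS kS by (simp add: coset_eq_iff)
  qed
  have "k \<in> K2 +>\<^bsub>S\<^esub> k" using k by (simp add: K_iff K2.a_rcos_self)
  with a have "(\<Union>b\<in>{b \<in> carrier S. h b = h a}. \<Union>l\<in>K2 +>\<^bsub>S\<^esub> k. K2 +>\<^bsub>S\<^esub> (b \<otimes>\<^bsub>S\<^esub> l)) = K2 +>\<^bsub>S\<^esub> (a \<otimes>\<^bsub>S\<^esub> k)"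
    using eq by blast
  then show ?thesis by (simp add: conormal_def Let_def)
qed

text \<open>With scalars of \<open>R\<close> replaced by lifts to \<open>S\<close> and classes by
  representatives, each axiom becomes a law of the ring \<open>S\<close>.\<close>

lemma left_module_conormal: "left_module R C"
proof (rule left_moduleI)
  have K_add: "k \<oplus>\<^bsub>S\<^esub> l \<in> K" if "k \<in> K" "l \<in> K" for k l using that by (rule K.a_closed)
  have zero: "\<zero>\<^bsub>C\<^esub> = K2 +>\<^bsub>S\<^esub> \<zero>\<^bsub>S\<^esub>" by (simp add: zero_conormal K2.a_rcos_const)
  show "abelian_group C"
  proof (rule abelian_groupI)
    fix x assume "x \<in> carrier C"
    then obtain k where k: "k \<in> K" "x = K2 +>\<^bsub>S\<^esub> k" by (auto simp: carrier_conormal)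
    have "(K2 +>\<^bsub>S\<^esub> (\<ominus>\<^bsub>S\<^esub> k)) \<oplus>\<^bsub>C\<^esub> x = K2 +>\<^bsub>S\<^esub> (\<ominus>\<^bsub>S\<^esub> k \<oplus>\<^bsub>S\<^esub> k)"
      using k by (simp add: conormal_add)
    also have "\<dots> = \<zero>\<^bsub>C\<^esub>" using k by (simp add: S.l_neg zero)
    finally show "\<exists>y\<in>carrier C. y \<oplus>\<^bsub>C\<^esub> x = \<zero>\<^bsub>C\<^esub>"
      using k conormal_closed by blast
  qed (auto simp: carrier_conormal conormal_add zero K_add S.a_ac K.a_Hcarr)
  note IK = K.I_l_closed
  show "r \<odot>\<^bsub>C\<^esub> x \<in> carrier C" if "r \<in> carrier R" "x \<in> carrier C" for r x
    using surj'[OF that(1)] that(2) by (auto simp: carrier_conormal conormal_smult IK)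
  show "(r \<oplus>\<^bsub>R\<^esub> s) \<odot>\<^bsub>C\<^esub> x = r \<odot>\<^bsub>C\<^esub> x \<oplus>\<^bsub>C\<^esub> s \<odot>\<^bsub>C\<^esub> x"
    if rs: "r \<in> carrier R" "s \<in> carrier R" and x: "x \<in> carrier C" for r s x
  proof -
    obtain a b k where "a \<in> carrier S" "r = h a" "b \<in> carrier S" "s = h b" "k \<in> K" "x = K2 +>\<^bsub>S\<^esub> k"
      using x surj'[OF rs(1)] surj'[OF rs(2)] unfolding carrier_conormal by blast
    then show ?thesis
      using conormal_smult[of "a \<oplus>\<^bsub>S\<^esub> b" k]
      by (simp add: conormal_smult conormal_add IK S.l_distr K.a_Hcarr)
  qed
  show "r \<odot>\<^bsub>C\<^esub> (x \<oplus>\<^bsub>C\<^esub> y) = r \<odot>\<^bsub>C\<^esub> x \<oplus>\<^bsub>C\<^esub> r \<odot>\<^bsub>C\<^esub> y"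
    if "r \<in> carrier R" "x \<in> carrier C" "y \<in> carrier C" for r x y
    using that surj'[OF that(1)]
    by (auto simp: carrier_conormal conormal_smult conormal_add IK K_add S.r_distr K.a_Hcarr)
  show "(r \<otimes>\<^bsub>R\<^esub> s) \<odot>\<^bsub>C\<^esub> x = r \<odot>\<^bsub>C\<^esub> (s \<odot>\<^bsub>C\<^esub> x)"
    if rs: "r \<in> carrier R" "s \<in> carrier R" and x: "x \<in> carrier C" for r s x
  proof -
    obtain a b k where "a \<in> carrier S" "r = h a" "b \<in> carrier S" "s = h b" "k \<in> K" "x = K2 +>\<^bsub>S\<^esub> k"
      using x surj'[OF rs(1)] surj'[OF rs(2)] unfolding carrier_conormal by blast
    then show ?thesis
      using conormal_smult[of "a \<otimes>\<^bsub>S\<^esub> b" k]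
      by (simp add: conormal_smult IK S.m_assoc K.a_Hcarr)
  qed
  show "\<one>\<^bsub>R\<^esub> \<odot>\<^bsub>C\<^esub> x = x" if "x \<in> carrier C" for x
    using that conormal_smult[of "\<one>\<^bsub>S\<^esub>"] by (auto simp: carrier_conormal K.a_Hcarr)
qed (rule R.ring_axioms)

end

section \<open>Maps out of the conormal module\<close>

lemma diff_preimage:
  assumes "abelian_group M" "x \<in> carrier M" "y \<in> carrier M" "z \<in> carrier M" "x \<ominus>\<^bsub>M\<^esub> y = z"
  shows "x = y \<oplus>\<^bsub>M\<^esub> z"
proof -
  interpret abelian_group M by fact
  show ?thesis using assms(2-5) by (metis a_minus_def a_comm r_neg1 a_inv_closed r_neg2)
qed

text \<open>
  The truncation of a projective resolution \<open>P\<close> of \<open>R\<close> together with comparison data between \<open>P\<close> and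
  \<open>0 \<rightarrow> K \<rightarrow> S \<rightarrow> R \<rightarrow> 0\<close>: a lift \<open>s : P 0 \<rightarrow> S\<close> of the augmentation, an element \<open>p\<close> over \<open>1\<close>, which
  gives the map \<open>a \<mapsto> a p\<close> in the other direction, and a homotopy \<open>H\<close> between their composite and the
  identity of \<open>P 0\<close>.
\<close>

locale conormal_comparison = surjective_ring_hom S R h
  for S :: "'a ring" and R :: "'b ring" and h +
  fixes P :: "nat \<Rightarrow> ('a, 'p) module" and d :: "nat \<Rightarrow> 'p \<Rightarrow> 'p"
    and s :: "'p \<Rightarrow> 'a" and p :: 'p and H :: "'p \<Rightarrow> 'p"
  assumes P_module: "left_module S (P n)"
    and d_linear: "d n \<in> linear_maps S (P (Suc n)) (P n)"
    and exact: "{x \<in> carrier (P (Suc 0)). d 0 x = \<zero>\<^bsub>P 0\<^esub>} = d (Suc 0) ` carrier (P (Suc (Suc 0)))"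
    and s_linear: "s \<in> linear_maps S (P 0) (self_module S)"
    and p_closed: "p \<in> carrier (P 0)"
    and hs_p: "h (s p) = \<one>\<^bsub>R\<^esub>"
    and hs_d: "y \<in> carrier (P (Suc 0)) \<Longrightarrow> h (s (d 0 y)) = \<zero>\<^bsub>R\<^esub>"
    and K_lift: "k \<in> a_kernel S R h \<Longrightarrow> \<exists>y\<in>carrier (P (Suc 0)). d 0 y = k \<odot>\<^bsub>P 0\<^esub> p"
    and H_linear: "H \<in> linear_maps S (P 0) (P (Suc 0))"
    and d_H: "x \<in> carrier (P 0) \<Longrightarrow> d 0 (H x) = x \<ominus>\<^bsub>P 0\<^esub> s x \<odot>\<^bsub>P 0\<^esub> p"
begin

abbreviation P0 where "P0 \<equiv> P 0"
abbreviation P1 where "P1 \<equiv> P (Suc 0)"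
abbreviation P2 where "P2 \<equiv> P (Suc (Suc 0))"

sublocale P0: left_module S P0 by (rule P_module)
sublocale P1: left_module S P1 by (rule P_module)
sublocale P2: left_module S P2 by (rule P_module)
sublocale C: left_module R C by (rule left_module_conormal)

lemmas [simp] = linear_closed[OF d_linear] linear_closed[OF s_linear, simplified]
  linear_closed[OF H_linear] p_closed

lemmas d_simps = linear_add[OF d_linear] linear_smult[OF d_linear]
lemmas s_simps = linear_add[OF s_linear, simplified] linear_smult[OF s_linear, simplified]

lemma d_minus: "\<lbrakk>x \<in> carrier P1; y \<in> carrier P1\<rbrakk> \<Longrightarrow> d 0 (x \<ominus>\<^bsub>P1\<^esub> y) = d 0 x \<ominus>\<^bsub>P0\<^esub> d 0 y"
  by (rule linear_minus[OF P1.M.abelian_group_axioms P0.M.abelian_group_axioms d_linear])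

lemma sd_K: "y \<in> carrier P1 \<Longrightarrow> s (d 0 y) \<in> K"
  by (simp add: K_iff hs_d)

lemma d_eq_imp:
  assumes "x \<in> carrier P1" "y \<in> carrier P1" "d 0 x = d 0 y"
  obtains z where "z \<in> carrier P2" "x = y \<oplus>\<^bsub>P1\<^esub> d (Suc 0) z"
proof -
  have "d 0 (x \<ominus>\<^bsub>P1\<^esub> y) = \<zero>\<^bsub>P0\<^esub>"
    using linear_closed[OF d_linear assms(2)] unfolding d_minus[OF assms(1,2)] assms(3)
    by (simp only: a_minus_def P0.M.r_neg)
  then have "x \<ominus>\<^bsub>P1\<^esub> y \<in> {x \<in> carrier P1. d 0 x = \<zero>\<^bsub>P0\<^esub>}"
    using assms by simp
  then obtain z where "z \<in> carrier P2" "x \<ominus>\<^bsub>P1\<^esub> y = d (Suc 0) z"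
    unfolding exact by blast
  with that show thesis
    using diff_preimage[OF P1.M.abelian_group_axioms assms(1,2)] linear_closed[OF d_linear] by blast
qed

lemma dd_zero:
  assumes "z \<in> carrier P2" shows "d 0 (d (Suc 0) z) = \<zero>\<^bsub>P0\<^esub>"
proof -
  have "d (Suc 0) z \<in> {x \<in> carrier P1. d 0 x = \<zero>\<^bsub>P0\<^esub>}"
    unfolding exact using assms by (rule imageI)
  then show ?thesis by blast
qed

definition c :: "'p \<Rightarrow> 'a set" where "c y = K2 +>\<^bsub>S\<^esub> s (d 0 y)"

lemma c_closed: "y \<in> carrier P1 \<Longrightarrow> c y \<in> carrier C"
  by (simp add: c_def conormal_closed sd_K)

lemma c_add: "\<lbrakk>x \<in> carrier P1; y \<in> carrier P1\<rbrakk> \<Longrightarrow> c (x \<oplus>\<^bsub>P1\<^esub> y) = c x \<oplus>\<^bsub>C\<^esub> c y"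
  by (simp add: c_def conormal_add sd_K d_simps s_simps)

lemma c_smult: "\<lbrakk>a \<in> carrier S; y \<in> carrier P1\<rbrakk> \<Longrightarrow> c (a \<odot>\<^bsub>P1\<^esub> y) = h a \<odot>\<^bsub>C\<^esub> c y"
  by (simp add: c_def conormal_smult sd_K d_simps s_simps)

lemma c_d: "z \<in> carrier P2 \<Longrightarrow> c (d (Suc 0) z) = \<zero>\<^bsub>C\<^esub>"
proof -
  have "s \<zero>\<^bsub>P0\<^esub> = \<zero>\<^bsub>S\<^esub>"
    using linear_zero[OF P0.M.abelian_group_axioms _ s_linear]
      left_moduleD(2)[OF left_module_self[OF S.ring_axioms]] by simp
  then show "z \<in> carrier P2 \<Longrightarrow> c (d (Suc 0) z) = \<zero>\<^bsub>C\<^esub>"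
    by (simp add: c_def dd_zero zero_conormal K2.a_rcos_const)
qed

text \<open>Since \<open>s p \<equiv> 1\<close> modulo \<open>K\<close>, multiplication by \<open>s p\<close> on \<open>K\<close> is the identity modulo \<open>K\<^sup>2\<close>.\<close>

lemma c_lift:
  assumes "k \<in> K" "y \<in> carrier P1" "d 0 y = k \<odot>\<^bsub>P0\<^esub> p"
  shows "c y = K2 +>\<^bsub>S\<^esub> k"
proof -
  have k: "k \<in> carrier S" using assms by (simp add: K_iff)
  have "s p \<ominus>\<^bsub>S\<^esub> \<one>\<^bsub>S\<^esub> \<in> K" by (simp add: K_iff hs_p a_minus_def R.r_neg)
  then have "k \<otimes>\<^bsub>S\<^esub> (s p \<ominus>\<^bsub>S\<^esub> \<one>\<^bsub>S\<^esub>) \<in> K2" using assms(1) by (intro K2_prod)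
  also have "k \<otimes>\<^bsub>S\<^esub> (s p \<ominus>\<^bsub>S\<^esub> \<one>\<^bsub>S\<^esub>) = k \<otimes>\<^bsub>S\<^esub> s p \<ominus>\<^bsub>S\<^esub> k"
    using k by (simp add: a_minus_def S.r_distr S.r_minus)
  finally show ?thesis
    using k by (simp add: c_def assms(3) s_simps coset_eq_iff)
qed

text \<open>A bare choice: neither additive nor determined modulo the image of \<open>P2\<close>, as
  already the representative \<open>k\<close> of \<open>X\<close> is free up to \<open>K2\<close>.
  Only its composites with suitable maps out of \<open>P1\<close> behave well.\<close>

definition lift :: "'a set \<Rightarrow> 'p" where
  "lift X = (SOME y. y \<in> carrier P1 \<and> (\<exists>k\<in>X. d 0 y = k \<odot>\<^bsub>P0\<^esub> p))"

end

text \<open>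
  A map \<open>\<psi>\<close> out of \<open>P 1\<close> which kills the image of \<open>P 2\<close> and all multiples by elements of \<open>K\<close> descends
  along \<open>y \<mapsto> k\<close>, for \<open>d y = k p\<close>, to a map out of \<open>K / K\<^sup>2\<close>.
\<close>

locale conormal_descent = conormal_comparison S R h P d s p H + G: group G
  for S :: "'a ring" and R :: "'b ring" and h and P :: "nat \<Rightarrow> ('a, 'p) module"
    and d s p H and G (structure) +
  fixes \<psi> :: "'p \<Rightarrow> 'c"
  assumes \<psi>_closed: "x \<in> carrier P1 \<Longrightarrow> \<psi> x \<in> carrier G"
    and \<psi>_add: "\<lbrakk>x \<in> carrier P1; y \<in> carrier P1\<rbrakk> \<Longrightarrow> \<psi> (x \<oplus>\<^bsub>P1\<^esub> y) = \<psi> x \<otimes>\<^bsub>G\<^esub> \<psi> y"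
    and \<psi>_d: "z \<in> carrier P2 \<Longrightarrow> \<psi> (d (Suc 0) z) = \<one>\<^bsub>G\<^esub>"
    and \<psi>_K: "\<lbrakk>k \<in> K; y \<in> carrier P1\<rbrakk> \<Longrightarrow> \<psi> (k \<odot>\<^bsub>P1\<^esub> y) = \<one>\<^bsub>G\<^esub>"
begin

text \<open>By exactness at \<open>P1\<close>, elements with equal boundary differ by an element
  coming from \<open>P2\<close>.\<close>

lemma \<psi>_cong:
  assumes "x \<in> carrier P1" "y \<in> carrier P1" "d 0 x = d 0 y"
  shows "\<psi> x = \<psi> y"
proof -
  obtain z where "z \<in> carrier P2" "x = y \<oplus>\<^bsub>P1\<^esub> d (Suc 0) z" using d_eq_imp[OF assms] .
  then show ?thesis
    using assms(2) by (simp add: \<psi>_add \<psi>_d \<psi>_closed)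
qed

text \<open>If \<open>x\<close> lifts \<open>l\<close>, then \<open>k x\<close> lifts
  \<open>k l\<close>; and lifts of two summands add up to a lift of the sum. The induction keeps
  \<open>y\<close> arbitrary because the lifts of the parts are chosen afresh and compared with
  \<open>y\<close> only through their boundaries.\<close>

lemma \<psi>_K2:
  assumes "k \<in> K2" "y \<in> carrier P1" "d 0 y = k \<odot>\<^bsub>P0\<^esub> p"
  shows "\<psi> y = \<one>\<^bsub>G\<^esub>"
  using assms
proof (induction arbitrary: y rule: ideal_prod.induct)
  case (prod k l)
  obtain x where x: "x \<in> carrier P1" "d 0 x = l \<odot>\<^bsub>P0\<^esub> p" using K_lift prod by blast
  have "d 0 y = d 0 (k \<odot>\<^bsub>P1\<^esub> x)"
    using prod x by (simp add: d_simps P0.smult_assoc K.a_Hcarr)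
  then have "\<psi> y = \<psi> (k \<odot>\<^bsub>P1\<^esub> x)"
    using prod x by (intro \<psi>_cong) (simp_all add: P1.smult_closed K.a_Hcarr)
  then show ?case using prod x by (simp add: \<psi>_K)
next
  case (sum k l)
  have K: "k \<in> K" "l \<in> K" using sum K2_subset by auto
  then obtain x z where x: "x \<in> carrier P1" "d 0 x = k \<odot>\<^bsub>P0\<^esub> p"
    and z: "z \<in> carrier P1" "d 0 z = l \<odot>\<^bsub>P0\<^esub> p" using K_lift by metis
  have "d 0 y = d 0 (x \<oplus>\<^bsub>P1\<^esub> z)"
    using sum K x z by (simp add: d_simps P0.smult_l_distr K.a_Hcarr)
  then have "\<psi> y = \<psi> (x \<oplus>\<^bsub>P1\<^esub> z)"
    using sum x z by (intro \<psi>_cong) simp_all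
  then show ?case using sum x z by (simp add: \<psi>_add)
qed

text \<open>The choice in \<open>lift\<close> may belong to another representative \<open>l\<close>
  of the class. Then \<open>l - k\<close> lies in \<open>K2\<close>, and a lift \<open>z\<close> of
  it accounts for the difference and is killed by \<open>\<psi>\<close>.\<close>

lemma \<psi>_lift:
  assumes k: "k \<in> K" and y: "y \<in> carrier P1" "d 0 y = k \<odot>\<^bsub>P0\<^esub> p"
  shows "\<psi> (lift (K2 +>\<^bsub>S\<^esub> k)) = \<psi> y"
proof -
  have kS: "k \<in> carrier S" using k by (simp add: K_iff)
  have "\<exists>x. x \<in> carrier P1 \<and> (\<exists>l\<in>K2 +>\<^bsub>S\<^esub> k. d 0 x = l \<odot>\<^bsub>P0\<^esub> p)"
    using y K2.a_rcos_self[OF kS] by blast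
  from someI_ex[OF this] obtain l where x: "lift (K2 +>\<^bsub>S\<^esub> k) \<in> carrier P1"
    and l: "l \<in> K2 +>\<^bsub>S\<^esub> k" and dx: "d 0 (lift (K2 +>\<^bsub>S\<^esub> k)) = l \<odot>\<^bsub>P0\<^esub> p"
    unfolding lift_def by blast
  have lS: "l \<in> carrier S" using K2.a_elemrcos_carrier[OF kS l] .
  have lk: "l \<ominus>\<^bsub>S\<^esub> k \<in> K2" using K2.a_rcos_module_minus[OF S.ring_axioms kS lS] l by simp
  obtain z where z: "z \<in> carrier P1" "d 0 z = (l \<ominus>\<^bsub>S\<^esub> k) \<odot>\<^bsub>P0\<^esub> p"
    using lk K2_subset K_lift by blast
  have "l = (l \<ominus>\<^bsub>S\<^esub> k) \<oplus>\<^bsub>S\<^esub> k" using lS kS by algebra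
  then have "l \<odot>\<^bsub>P0\<^esub> p = (l \<ominus>\<^bsub>S\<^esub> k) \<odot>\<^bsub>P0\<^esub> p \<oplus>\<^bsub>P0\<^esub> k \<odot>\<^bsub>P0\<^esub> p"
    using lS kS P0.smult_l_distr[of "l \<ominus>\<^bsub>S\<^esub> k" k p] by simp
  then have "d 0 (lift (K2 +>\<^bsub>S\<^esub> k)) = d 0 (z \<oplus>\<^bsub>P1\<^esub> y)"
    using y z by (simp add: dx d_simps)
  then have "\<psi> (lift (K2 +>\<^bsub>S\<^esub> k)) = \<psi> (z \<oplus>\<^bsub>P1\<^esub> y)"
    using x y z by (intro \<psi>_cong) simp_all
  also have "\<dots> = \<psi> y"
    using y z \<psi>_K2[OF lk z] by (simp add: \<psi>_add \<psi>_closed)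
  finally show ?thesis .
qed

lemma descent_cases:
  assumes "X \<in> carrier C"
  obtains k y where "k \<in> K" "X = K2 +>\<^bsub>S\<^esub> k" "y \<in> carrier P1" "d 0 y = k \<odot>\<^bsub>P0\<^esub> p"
    "\<psi> (lift X) = \<psi> y"
proof -
  obtain k where k: "k \<in> K" "X = K2 +>\<^bsub>S\<^esub> k" using assms by (auto simp: carrier_conormal)
  obtain y where "y \<in> carrier P1" "d 0 y = k \<odot>\<^bsub>P0\<^esub> p" using K_lift[OF k(1)] by blast
  then show thesis using that k \<psi>_lift by blast
qed

lemma descent_closed: "X \<in> carrier C \<Longrightarrow> \<psi> (lift X) \<in> carrier G"
  using descent_cases \<psi>_closed by metis

lemma descent_add:
  assumes "X \<in> carrier C" "Y \<in> carrier C"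
  shows "\<psi> (lift (X \<oplus>\<^bsub>C\<^esub> Y)) = \<psi> (lift X) \<otimes>\<^bsub>G\<^esub> \<psi> (lift Y)"
proof -
  obtain k x where k: "k \<in> K" "X = K2 +>\<^bsub>S\<^esub> k" "x \<in> carrier P1" "d 0 x = k \<odot>\<^bsub>P0\<^esub> p"
    "\<psi> (lift X) = \<psi> x" using descent_cases[OF assms(1)] .
  obtain l y where l: "l \<in> K" "Y = K2 +>\<^bsub>S\<^esub> l" "y \<in> carrier P1" "d 0 y = l \<odot>\<^bsub>P0\<^esub> p"
    "\<psi> (lift Y) = \<psi> y" using descent_cases[OF assms(2)] .
  have "\<psi> (lift (K2 +>\<^bsub>S\<^esub> (k \<oplus>\<^bsub>S\<^esub> l))) = \<psi> (x \<oplus>\<^bsub>P1\<^esub> y)"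
    using k l by (intro \<psi>_lift) (simp_all add: d_simps P0.smult_l_distr K.a_Hcarr K.a_closed)
  then show ?thesis using k l by (simp add: conormal_add \<psi>_add)
qed

text \<open>\<open>a y\<close> is a lift of \<open>a k\<close>. The scalar stays inside
  \<open>\<psi>\<close> since \<open>\<psi>\<close> is merely additive here: for a cocycle it comes
  out in front, for \<open>x \<mapsto> x \<otimes> m\<close> it moves over to
  \<open>m\<close>.\<close>

lemma descent_smult:
  assumes "a \<in> carrier S" "k \<in> K" "y \<in> carrier P1" "d 0 y = k \<odot>\<^bsub>P0\<^esub> p"
  shows "\<psi> (lift (h a \<odot>\<^bsub>C\<^esub> (K2 +>\<^bsub>S\<^esub> k))) = \<psi> (a \<odot>\<^bsub>P1\<^esub> y)"
  using assms \<psi>_lift[of "a \<otimes>\<^bsub>S\<^esub> k" "a \<odot>\<^bsub>P1\<^esub> y"]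
  by (simp add: conormal_smult K.I_l_closed P1.smult_closed d_simps P0.smult_assoc K.a_Hcarr)

text \<open>The homotopy writes \<open>d x\<close> as \<open>s (d x) p\<close> plus the boundary of
  \<open>H (d x)\<close>. Hence \<open>x\<close> has the same boundary as
  \<open>y + H (d x)\<close>, where \<open>y\<close> lifts \<open>s (d x)\<close>, a representative
  of \<open>c x\<close>.\<close>

lemma descent_c:
  assumes x: "x \<in> carrier P1"
  shows "\<psi> x = \<psi> (lift (c x)) \<otimes>\<^bsub>G\<^esub> \<psi> (H (d 0 x))"
proof -
  let ?k = "s (d 0 x)"
  have k: "?k \<in> K" using x by (rule sd_K)
  then obtain y where y: "y \<in> carrier P1" "d 0 y = ?k \<odot>\<^bsub>P0\<^esub> p" using K_lift by blast
  have "d 0 x = ?k \<odot>\<^bsub>P0\<^esub> p \<oplus>\<^bsub>P0\<^esub> d 0 (H (d 0 x))"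
    using x d_H[of "d 0 x"]
    by (intro diff_preimage[OF P0.M.abelian_group_axioms]) (simp_all add: P0.smult_closed)
  then have "d 0 x = d 0 (y \<oplus>\<^bsub>P1\<^esub> H (d 0 x))" using x y by (simp add: d_simps)
  then have "\<psi> x = \<psi> (y \<oplus>\<^bsub>P1\<^esub> H (d 0 x))" using x y by (intro \<psi>_cong) simp_all
  then show ?thesis using x y \<psi>_lift[OF k y] by (simp add: \<psi>_add c_def)
qed

end

section \<open>The Ext group\<close>

text \<open>As \<open>f\<close> sends \<open>N\<close> into \<open>B\<close>, it sends a coset of
  \<open>N\<close> into a single coset of \<open>B\<close>, so \<open>the_elem\<close> is applied to
  a singleton.\<close>

lemma quot_map_coset:
  assumes "group L" "subgroup N L" "group G" "subgroup B G"
    and "f \<in> hom L G" "f ` N \<subseteq> B" "x \<in> carrier L"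
  shows "quot_map G B f (N #>\<^bsub>L\<^esub> x) = B #>\<^bsub>G\<^esub> f x"
proof -
  interpret L: group L by fact
  interpret N: subgroup N L by fact
  interpret G: group G by fact
  interpret B: subgroup B G by fact
  have fc: "f y \<in> carrier G" if "y \<in> carrier L" for y using assms(5) that by (auto simp: hom_def)
  have "B #>\<^bsub>G\<^esub> f y = B #>\<^bsub>G\<^esub> f x" if y: "y \<in> N #>\<^bsub>L\<^esub> x" for y
  proof -
    obtain n where n: "n \<in> N" "y = n \<otimes>\<^bsub>L\<^esub> x" using y by (auto simp: r_coset_def)
    then have "f y = f n \<otimes>\<^bsub>G\<^esub> f x" using assms(5,7) by (simp add: hom_def)
    then have "f y \<in> B #>\<^bsub>G\<^esub> f x" using n assms(6) by (auto simp: r_coset_def)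
    then show ?thesis
      using G.repr_independence[of "f y" B "f x"] fc assms(4,7) by simp
  qed
  moreover have "x \<in> N #>\<^bsub>L\<^esub> x" using assms by (simp add: L.rcos_self)
  ultimately have "(\<lambda>y. B #>\<^bsub>G\<^esub> f y) ` (N #>\<^bsub>L\<^esub> x) = {B #>\<^bsub>G\<^esub> f x}" by blast
  then show ?thesis by (simp add: quot_map_def)
qed

text \<open>Evaluates on a representative the map that \<open>FactGroup_iso_set\<close> provides,
  which is \<open>the_elem\<close> of the image of a coset.\<close>

lemma the_elem_image_coset:
  assumes "group L" "subgroup N L" "group G" "f \<in> hom L G" "N \<subseteq> kernel L G f" "x \<in> carrier L"
  shows "the_elem (f ` (N #>\<^bsub>L\<^esub> x)) = f x"
proof -
  interpret L: group L by fact
  interpret N: subgroup N L by fact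
  interpret G: group G by fact
  have "f y = f x" if y: "y \<in> N #>\<^bsub>L\<^esub> x" for y
  proof -
    obtain n where n: "n \<in> N" "y = n \<otimes>\<^bsub>L\<^esub> x" using y by (auto simp: r_coset_def)
    moreover have "f n = \<one>\<^bsub>G\<^esub>" using n assms(5) by (auto simp: kernel_def)
    ultimately show ?thesis using assms(4,6) by (auto simp: hom_def Pi_iff)
  qed
  moreover have "x \<in> N #>\<^bsub>L\<^esub> x" using assms by (simp add: L.rcos_self)
  ultimately have "f ` (N #>\<^bsub>L\<^esub> x) = {f x}" by blast
  then show ?thesis by simp
qed

section \<open>Groups of linear maps\<close>

lemma hom_group_simps:
  "carrier (hom_group R M N) = linear_maps R M N \<inter> extensional (carrier M)"
  "f \<otimes>\<^bsub>hom_group R M N\<^esub> g = (\<lambda>x\<in>carrier M. f x \<oplus>\<^bsub>N\<^esub> g x)"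
  "\<one>\<^bsub>hom_group R M N\<^esub> = (\<lambda>x\<in>carrier M. \<zero>\<^bsub>N\<^esub>)"
  by (simp_all add: hom_group_def)

lemma restrict_linear_maps:
  assumes "left_module R M" "f \<in> linear_maps R M N"
  shows "restrict f (carrier M) \<in> carrier (hom_group R M N)"
proof -
  interpret left_module R M by fact
  show ?thesis
    using linear_mapsD[OF assms(2)]
    by (auto simp: hom_group_simps smult_closed intro!: linear_mapsI)
qed

lemma comm_group_hom_group:
  assumes M: "left_module R M" and N: "left_module R N"
  shows "comm_group (hom_group R M N)"
proof -
  interpret M: left_module R M by fact
  interpret N: left_module R N by fact
  have zero: "(\<lambda>x. \<zero>\<^bsub>N\<^esub>) \<in> linear_maps R M N"
    by (rule linear_mapsI) (simp_all add: N.smult_zero_right)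
  have add: "(\<lambda>x. f x \<oplus>\<^bsub>N\<^esub> g x) \<in> linear_maps R M N"
    if "f \<in> linear_maps R M N" "g \<in> linear_maps R M N" for f g
    using linear_mapsD[OF that(1)] linear_mapsD[OF that(2)]
    by (intro linear_mapsI) (simp_all add: N.smult_r_distr N.M.a_ac)
  note closed = restrict_linear_maps[OF M]
  show ?thesis
  proof (rule comm_groupI)
    show "f \<otimes>\<^bsub>hom_group R M N\<^esub> g \<in> carrier (hom_group R M N)"
      if "f \<in> carrier (hom_group R M N)" "g \<in> carrier (hom_group R M N)" for f g
      using that closed[OF add] by (simp add: hom_group_simps)
    show "\<one>\<^bsub>hom_group R M N\<^esub> \<in> carrier (hom_group R M N)"
      using closed[OF zero] by (simp add: hom_group_simps)
    show "\<exists>g\<in>carrier (hom_group R M N). g \<otimes>\<^bsub>hom_group R M N\<^esub> f = \<one>\<^bsub>hom_group R M N\<^esub>"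
      if "f \<in> carrier (hom_group R M N)" for f
    proof
      have f: "f \<in> linear_maps R M N" using that by (simp add: hom_group_simps)
      \<comment> \<open>The inverse is written as zero minus \<open>f\<close>, so that its linearity
        is an instance of \<open>linear_maps_minus\<close>.\<close>
      show "restrict (\<lambda>x. \<zero>\<^bsub>N\<^esub> \<ominus>\<^bsub>N\<^esub> f x) (carrier M) \<in> carrier (hom_group R M N)"
        by (rule closed[OF linear_maps_minus[OF N zero f]])
      show "restrict (\<lambda>x. \<zero>\<^bsub>N\<^esub> \<ominus>\<^bsub>N\<^esub> f x) (carrier M) \<otimes>\<^bsub>hom_group R M N\<^esub> f = \<one>\<^bsub>hom_group R M N\<^esub>"
        using linear_closed[OF f]
        by (auto simp: hom_group_simps a_minus_def N.M.l_neg intro!: restrict_ext)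
    qed
    show "\<one>\<^bsub>hom_group R M N\<^esub> \<otimes>\<^bsub>hom_group R M N\<^esub> f = f"
      if "f \<in> carrier (hom_group R M N)" for f
      using that
      by (intro extensionalityI[where A = "carrier M"]) (auto simp: hom_group_simps linear_closed)
  qed (auto simp: hom_group_simps linear_closed N.M.a_ac intro!: restrict_ext)
qed

lemma compose_right_hom:
  assumes L: "left_module R L" and f: "f \<in> linear_maps R L M"
  shows "(\<lambda>\<phi>. compose (carrier L) \<phi> f) \<in> hom (hom_group R M N) (hom_group R L N)"
proof (rule homI)
  fix \<phi> assume "\<phi> \<in> carrier (hom_group R M N)"
  then show "compose (carrier L) \<phi> f \<in> carrier (hom_group R L N)"
    using restrict_linear_maps[OF L linear_maps_compose[OF f, of \<phi> N]]
    by (simp add: hom_group_simps compose_def)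
qed (use linear_closed[OF f] in \<open>auto simp: hom_group_simps compose_def intro!: restrict_ext\<close>)

lemma compose_left_hom:
  assumes L: "left_module R L" and f: "f \<in> linear_maps R M N"
  shows "(\<lambda>\<phi>. compose (carrier L) f \<phi>) \<in> hom (hom_group R L M) (hom_group R L N)"
proof (rule homI)
  fix \<phi> assume "\<phi> \<in> carrier (hom_group R L M)"
  then show "compose (carrier L) f \<phi> \<in> carrier (hom_group R L N)"
    using restrict_linear_maps[OF L linear_maps_compose[OF _ f, of \<phi> L]]
    by (simp add: hom_group_simps compose_def)
next
  fix \<phi> \<psi> assume "\<phi> \<in> carrier (hom_group R L M)" "\<psi> \<in> carrier (hom_group R L M)"
  then show "compose (carrier L) f (\<phi> \<otimes>\<^bsub>hom_group R L M\<^esub> \<psi>) =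
      compose (carrier L) f \<phi> \<otimes>\<^bsub>hom_group R L N\<^esub> compose (carrier L) f \<psi>"
    by (auto simp: hom_group_simps compose_def linear_closed linear_add[OF f] intro!: restrict_ext)
qed

context conormal_comparison
begin

text \<open>Induced by \<open>\<phi> \<mapsto> \<phi> \<circ> lift\<close>, in the form in which the
  first isomorphism theorem delivers it. No module \<open>M\<close> occurs in it, so the same
  constant is every component of the natural transformation.\<close>

definition ext_iso :: "('p \<Rightarrow> 'm) set \<Rightarrow> 'a set \<Rightarrow> 'm" where
  "ext_iso X = the_elem ((\<lambda>\<phi>. \<lambda>X\<in>carrier C. \<phi> (lift X)) ` X)"

lemma lift_closed:
  assumes "X \<in> carrier C" shows "lift X \<in> carrier P1"
proof -
  obtain k where k: "k \<in> K" "X = K2 +>\<^bsub>S\<^esub> k" using assms by (auto simp: carrier_conormal)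
  then have "\<exists>x. x \<in> carrier P1 \<and> (\<exists>l\<in>X. d 0 x = l \<odot>\<^bsub>P0\<^esub> p)"
    using K_lift[OF k(1)] K2.a_rcos_self[of k] by (auto simp: K_iff)
  from someI_ex[OF this] show ?thesis by (simp add: lift_def)
qed

context
  fixes M :: "('b, 'm) module"
  assumes M: "left_module R M"
begin

private abbreviation "MS \<equiv> restrict_scalars h M"
private abbreviation "Hom0 \<equiv> hom_group S P0 MS"
private abbreviation "Hom1 \<equiv> hom_group S P1 MS"
private abbreviation "Hom2 \<equiv> hom_group S P2 MS"
private abbreviation "HomC \<equiv> hom_group R C M"
private abbreviation "Z \<equiv> ext_cocycles S P d MS (Suc 0)"
private abbreviation "B \<equiv> ext_coboundaries S P d MS (Suc 0)"

interpretation M: left_module R M by (rule M)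
interpretation MS: left_module S MS
  by (rule left_module_restrict_scalars[OF S.ring_axioms hom M])
interpretation Hom0: comm_group Hom0 by (rule comm_group_hom_group[OF P_module MS.left_module_axioms])
interpretation Hom1: comm_group Hom1 by (rule comm_group_hom_group[OF P_module MS.left_module_axioms])
interpretation Hom2: comm_group Hom2 by (rule comm_group_hom_group[OF P_module MS.left_module_axioms])
interpretation HomC: comm_group HomC by (rule comm_group_hom_group[OF left_module_conormal M])

interpretation d1: group_hom Hom1 Hom2 "\<lambda>\<phi>. compose (carrier P2) \<phi> (d (Suc 0))"
  by unfold_locales (rule compose_right_hom[OF P_module d_linear])
interpretation d0: group_hom Hom0 Hom1 "\<lambda>\<phi>. compose (carrier P1) \<phi> (d 0)"
  by unfold_locales (rule compose_right_hom[OF P_module d_linear])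

lemma cocycles_subgroup: "subgroup Z Hom1"
  using d1.subgroup_kernel by (simp add: ext_cocycles_def)

lemma coboundaries_subgroup: "subgroup B Hom1"
  using d0.img_is_subgroup by (simp add: ext_coboundaries_def)

lemma cocycleD:
  assumes "\<phi> \<in> Z"
  shows "\<phi> \<in> linear_maps S P1 MS" "\<phi> \<in> extensional (carrier P1)"
    "z \<in> carrier P2 \<Longrightarrow> \<phi> (d (Suc 0) z) = \<zero>\<^bsub>M\<^esub>"
proof -
  have *: "compose (carrier P2) \<phi> (d (Suc 0)) = (\<lambda>x\<in>carrier P2. \<zero>\<^bsub>M\<^esub>)"
    using assms by (simp add: ext_cocycles_def kernel_def hom_group_simps)
  show "z \<in> carrier P2 \<Longrightarrow> \<phi> (d (Suc 0) z) = \<zero>\<^bsub>M\<^esub>"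
    using fun_cong[OF *, of z] by (simp add: compose_def)
qed (use assms in \<open>simp_all add: ext_cocycles_def kernel_def hom_group_simps\<close>)

text \<open>\<open>K\<close> acts on \<open>M\<close> through \<open>h\<close>, hence by zero, so
  the linear map \<open>\<phi>\<close> kills all \<open>k y\<close>. Vanishing on the image of
  \<open>P2\<close> is the cocycle condition.\<close>

lemma cocycle_descent:
  assumes "\<phi> \<in> Z"
  shows "conormal_descent S R h P d s p H (add_monoid M) \<phi>"
proof (intro conormal_descent.intro conormal_descent_axioms.intro)
  note D = cocycleD[OF assms]
  show "group (add_monoid M)" by (rule M.M.a_group)
  fix k y assume "k \<in> K" "y \<in> carrier P1"
  then show "\<phi> (k \<odot>\<^bsub>P1\<^esub> y) = \<one>\<^bsub>add_monoid M\<^esub>"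
    using linear_mapsD[OF D(1)] by (simp add: M.smult_zero_left K.a_Hcarr)
qed (use cocycleD[OF assms] linear_mapsD[OF cocycleD(1)[OF assms]] conormal_comparison_axioms
      in simp_all)

text \<open>Although \<open>lift\<close> respects no structure, its composite with a cocycle does.
  For scalars, \<open>r\<close> is replaced by some \<open>a\<close> with \<open>h a = r\<close>,
  and linearity of \<open>\<phi>\<close> over \<open>S\<close> moves \<open>a\<close> out of
  \<open>\<phi> (a y)\<close>, where it acts as \<open>r\<close>.\<close>

lemma restrict_descent_hom:
  "(\<lambda>\<phi>. \<lambda>X\<in>carrier C. \<phi> (lift X)) \<in> hom (Hom1\<lparr>carrier := Z\<rparr>) HomC"
proof (rule homI)
  fix \<phi> assume "\<phi> \<in> carrier (Hom1\<lparr>carrier := Z\<rparr>)"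
  then have \<phi>: "\<phi> \<in> Z" by simp
  interpret D: conormal_descent S R h P d s p H "add_monoid M" \<phi> by (rule cocycle_descent[OF \<phi>])
  have "(\<lambda>X. \<phi> (lift X)) \<in> linear_maps R C M"
  proof (rule linear_mapsI)
    show "\<phi> (lift X) \<in> carrier M" if "X \<in> carrier C" for X
      using D.descent_closed[OF that] by simp
    show "\<phi> (lift (X \<oplus>\<^bsub>C\<^esub> Y)) = \<phi> (lift X) \<oplus>\<^bsub>M\<^esub> \<phi> (lift Y)"
      if "X \<in> carrier C" "Y \<in> carrier C" for X Y
      using D.descent_add[OF that] by simp
    show "\<phi> (lift (r \<odot>\<^bsub>C\<^esub> X)) = r \<odot>\<^bsub>M\<^esub> \<phi> (lift X)" if r: "r \<in> carrier R" and X: "X \<in> carrier C" for r X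
    proof -
      obtain a where a: "a \<in> carrier S" "h a = r" using surj'[OF r] by blast
      obtain k y where "k \<in> K" "X = K2 +>\<^bsub>S\<^esub> k" "y \<in> carrier P1" "d 0 y = k \<odot>\<^bsub>P0\<^esub> p"
        "\<phi> (lift X) = \<phi> y" using D.descent_cases[OF X] .
      then show ?thesis
        using D.descent_smult[of a k y] a linear_smult[OF cocycleD(1)[OF \<phi>], of a y] by simp
    qed
  qed
  then show "(\<lambda>X\<in>carrier C. \<phi> (lift X)) \<in> carrier HomC"
    by (rule restrict_linear_maps[OF left_module_conormal])
qed (auto simp: hom_group_simps lift_closed intro!: restrict_ext)

text \<open>Surjectivity of the descent. The value of the cocycle \<open>f \<circ> c\<close> at
  \<open>lift X\<close> may be computed at any lift \<open>y\<close> of a representative of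
  \<open>X\<close>, and there \<open>c y = X\<close> by \<open>c_lift\<close>.\<close>

lemma c_linear_compose:
  assumes "f \<in> carrier HomC"
  shows "(\<lambda>x\<in>carrier P1. f (c x)) \<in> Z"
    and "(\<lambda>X\<in>carrier C. (\<lambda>x\<in>carrier P1. f (c x)) (lift X)) = f"
proof -
  have f: "f \<in> linear_maps R C M" and ext: "f \<in> extensional (carrier C)"
    using assms by (simp_all add: hom_group_simps)
  have "(\<lambda>x. f (c x)) \<in> linear_maps S P1 MS"
    using linear_mapsD[OF f]
    by (intro linear_mapsI) (simp_all add: c_closed c_add c_smult)
  from restrict_linear_maps[OF P_module this]
  have 1: "(\<lambda>x\<in>carrier P1. f (c x)) \<in> carrier Hom1" .
  have "f \<zero>\<^bsub>C\<^esub> = \<zero>\<^bsub>M\<^esub>"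
    by (rule linear_zero[OF C.M.abelian_group_axioms M.M.abelian_group_axioms f])
  then have "compose (carrier P2) (\<lambda>x\<in>carrier P1. f (c x)) (d (Suc 0)) = (\<lambda>x\<in>carrier P2. \<zero>\<^bsub>M\<^esub>)"
    by (auto simp: compose_def c_d intro!: restrict_ext)
  with 1 show Z: "(\<lambda>x\<in>carrier P1. f (c x)) \<in> Z"
    by (simp add: ext_cocycles_def kernel_def hom_group_simps)
  interpret D: conormal_descent S R h P d s p H "add_monoid M" "\<lambda>x\<in>carrier P1. f (c x)"
    by (rule cocycle_descent[OF Z])
  show "(\<lambda>X\<in>carrier C. (\<lambda>x\<in>carrier P1. f (c x)) (lift X)) = f"
  proof (rule extensionalityI[OF _ ext])
    fix X assume X: "X \<in> carrier C"
    then show "(\<lambda>X\<in>carrier C. (\<lambda>x\<in>carrier P1. f (c x)) (lift X)) X = f X"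
      using D.descent_cases[OF X] c_lift by (metis (lifting) restrict_apply')
  qed simp
qed

text \<open>If \<open>\<phi> \<circ> lift\<close> vanishes, the homotopy identity leaves
  \<open>\<phi> x = \<phi> (H (d x))\<close>, which exhibits \<open>\<phi>\<close> as the coboundary
  of \<open>\<phi> \<circ> H\<close>. Conversely, a coboundary \<open>\<psi> \<circ> d\<close> has
  at a lift of \<open>k\<close> the value \<open>\<psi> (k p)\<close>, which is
  \<open>h k = 0\<close> acting on \<open>\<psi> p\<close>.\<close>

lemma kernel_restrict_descent:
  "kernel (Hom1\<lparr>carrier := Z\<rparr>) HomC (\<lambda>\<phi>. \<lambda>X\<in>carrier C. \<phi> (lift X)) = B" (is "?K = B")
proof
  show "?K \<subseteq> B"
  proof
    fix \<phi> assume "\<phi> \<in> ?K"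
    then have \<phi>: "\<phi> \<in> Z" and *: "(\<lambda>X\<in>carrier C. \<phi> (lift X)) = (\<lambda>X\<in>carrier C. \<zero>\<^bsub>M\<^esub>)"
      by (simp_all add: kernel_def hom_group_simps)
    interpret D: conormal_descent S R h P d s p H "add_monoid M" \<phi> by (rule cocycle_descent[OF \<phi>])
    have zero: "\<phi> (lift X) = \<zero>\<^bsub>M\<^esub>" if "X \<in> carrier C" for X
      using fun_cong[OF *, of X] that by simp
    have "(\<lambda>x\<in>carrier P0. \<phi> (H x)) \<in> carrier Hom0"
      by (intro restrict_linear_maps P_module linear_maps_compose[OF H_linear cocycleD(1)[OF \<phi>]])
    moreover have "\<phi> = compose (carrier P1) (\<lambda>x\<in>carrier P0. \<phi> (H x)) (d 0)"
    proof (rule extensionalityI[OF cocycleD(2)[OF \<phi>]])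
      fix x assume x: "x \<in> carrier P1"
      then show "\<phi> x = compose (carrier P1) (\<lambda>x\<in>carrier P0. \<phi> (H x)) (d 0) x"
        using D.descent_c[OF x] zero[OF c_closed[OF x]] D.\<psi>_closed[of "H (d 0 x)"]
        by (simp add: compose_def)
    qed simp
    ultimately show "\<phi> \<in> B" by (auto simp: ext_coboundaries_def)
  qed
next
  show "B \<subseteq> ?K"
  proof
    fix \<phi> assume "\<phi> \<in> B"
    then obtain \<psi> where \<psi>: "\<psi> \<in> linear_maps S P0 MS" and \<phi>: "\<phi> = compose (carrier P1) \<psi> (d 0)"
      and \<psi>': "\<psi> \<in> carrier Hom0"
      by (auto simp: ext_coboundaries_def hom_group_simps)
    have "\<phi> (d (Suc 0) z) = \<zero>\<^bsub>M\<^esub>" if "z \<in> carrier P2" for z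
      using that linear_zero[OF P0.M.abelian_group_axioms MS.M.abelian_group_axioms \<psi>]
      by (simp add: \<phi> compose_def dd_zero)
    then have Z: "\<phi> \<in> Z"
      using d0.hom_closed[OF \<psi>']
      by (auto simp: \<phi> ext_cocycles_def kernel_def hom_group_simps compose_def intro!: restrict_ext)
    interpret D: conormal_descent S R h P d s p H "add_monoid M" \<phi> by (rule cocycle_descent[OF Z])
    have "\<phi> (lift X) = \<zero>\<^bsub>M\<^esub>" if X: "X \<in> carrier C" for X
    proof -
      obtain k y where "k \<in> K" "X = K2 +>\<^bsub>S\<^esub> k" "y \<in> carrier P1" "d 0 y = k \<odot>\<^bsub>P0\<^esub> p"
        "\<phi> (lift X) = \<phi> y" using D.descent_cases[OF X] .
      then show ?thesis
        using linear_mapsD[OF \<psi>] by (simp add: \<phi> compose_def M.smult_zero_left K.a_Hcarr)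
    qed
    then show "\<phi> \<in> ?K"
      using Z by (auto simp: kernel_def hom_group_simps intro!: restrict_ext)
  qed
qed

interpretation descent: group_hom "Hom1\<lparr>carrier := Z\<rparr>" HomC "\<lambda>\<phi>. \<lambda>X\<in>carrier C. \<phi> (lift X)"
  by (intro group_hom.intro group_hom_axioms.intro restrict_descent_hom HomC.is_group
      Hom1.subgroup_imp_group cocycles_subgroup)

lemma ext_iso_iso: "ext_iso \<in> iso (ext S P d MS (Suc 0)) HomC"
proof -
  have carr: "carrier (Hom1\<lparr>carrier := Z\<rparr>) = Z" by simp
  have "(\<lambda>\<phi>. \<lambda>X\<in>carrier C. \<phi> (lift X)) ` carrier (Hom1\<lparr>carrier := Z\<rparr>) = carrier HomC"
  proof
    show "(\<lambda>\<phi>. \<lambda>X\<in>carrier C. \<phi> (lift X)) ` carrier (Hom1\<lparr>carrier := Z\<rparr>) \<subseteq> carrier HomC"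
      using descent.hom_closed by blast
    show "carrier HomC \<subseteq> (\<lambda>\<phi>. \<lambda>X\<in>carrier C. \<phi> (lift X)) ` carrier (Hom1\<lparr>carrier := Z\<rparr>)"
    proof
      fix f assume f: "f \<in> carrier HomC"
      have "(\<lambda>X\<in>carrier C. (\<lambda>x\<in>carrier P1. f (c x)) (lift X)) \<in>
          (\<lambda>\<phi>. \<lambda>X\<in>carrier C. \<phi> (lift X)) ` carrier (Hom1\<lparr>carrier := Z\<rparr>)"
        unfolding carr by (rule imageI[OF c_linear_compose(1)[OF f]])
      then show "f \<in> (\<lambda>\<phi>. \<lambda>X\<in>carrier C. \<phi> (lift X)) ` carrier (Hom1\<lparr>carrier := Z\<rparr>)"
        unfolding c_linear_compose(2)[OF f] .
    qed
  qed
  from descent.FactGroup_iso_set[OF this] show ?thesis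
    by (simp add: kernel_restrict_descent ext_def ext_iso_def[abs_def])
qed

lemma ext_iso_coset:
  assumes \<phi>: "\<phi> \<in> Z"
  shows "ext_iso (B #>\<^bsub>Hom1\<^esub> \<phi>) = (\<lambda>X\<in>carrier C. \<phi> (lift X))"
proof -
  have B: "subgroup B (Hom1\<lparr>carrier := Z\<rparr>)"
    using descent.subgroup_kernel by (simp add: kernel_restrict_descent)
  have "ext_iso (B #>\<^bsub>Hom1\<lparr>carrier := Z\<rparr>\<^esub> \<phi>) = (\<lambda>X\<in>carrier C. \<phi> (lift X))"
    unfolding ext_iso_def using \<phi>
    by (intro the_elem_image_coset[OF descent.is_group B HomC.is_group restrict_descent_hom])
      (simp_all add: kernel_restrict_descent)
  then show ?thesis by simp
qed

lemma ext_carrier_cases: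
  assumes "X \<in> carrier (ext S P d MS (Suc 0))"
  obtains \<phi> where "\<phi> \<in> Z" "X = B #>\<^bsub>Hom1\<^esub> \<phi>"
  using assms by (auto simp: ext_def carrier_FactGroup)

end

text \<open>Both sides send the class of \<open>\<phi>\<close> to
  \<open>X \<mapsto> f (\<phi> (lift X))\<close>; \<open>lift\<close> depends on the comparison data
  alone, so \<open>M\<close> and \<open>N\<close> share the same choice.\<close>

lemma ext_iso_natural:
  assumes M: "left_module R M" and N: "left_module R N" and f: "f \<in> linear_maps R M N"
    and X: "X \<in> carrier (ext S P d (restrict_scalars h M) (Suc 0))"
  shows "ext_iso (ext_map S P d (restrict_scalars h N) f (Suc 0) X) = compose (carrier C) f (ext_iso X)"
proof -
  let ?MS = "restrict_scalars h M" and ?NS = "restrict_scalars h N"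
  obtain \<phi> where \<phi>: "\<phi> \<in> ext_cocycles S P d ?MS (Suc 0)"
    and X': "X = ext_coboundaries S P d ?MS (Suc 0) #>\<^bsub>hom_group S P1 ?MS\<^esub> \<phi>"
    using ext_carrier_cases[OF M X] .
  have fS: "f \<in> linear_maps S ?MS ?NS" by (rule linear_maps_restrict_scalars[OF hom f])
  have MS: "left_module S ?MS" and NS: "left_module S ?NS"
    by (rule left_module_restrict_scalars[OF S.ring_axioms hom M]
        left_module_restrict_scalars[OF S.ring_axioms hom N])+
  have G: "group (hom_group S P1 ?MS)" "group (hom_group S P1 ?NS)"
    using comm_group_hom_group[OF P_module MS] comm_group_hom_group[OF P_module NS]
    by (simp_all add: comm_group.axioms(2))
  have hom_f: "(\<lambda>\<phi>. compose (carrier P1) f \<phi>) \<in> hom (hom_group S P1 ?MS) (hom_group S P1 ?NS)"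
    by (rule compose_left_hom[OF P_module fS])
  have "(\<lambda>\<phi>. compose (carrier P1) f \<phi>) ` ext_coboundaries S P d ?MS (Suc 0) \<subseteq> ext_coboundaries S P d ?NS (Suc 0)"
  proof
    fix \<chi> assume "\<chi> \<in> (\<lambda>\<phi>. compose (carrier P1) f \<phi>) ` ext_coboundaries S P d ?MS (Suc 0)"
    then obtain \<psi> where \<psi>: "\<psi> \<in> carrier (hom_group S P0 ?MS)"
      and \<chi>: "\<chi> = compose (carrier P1) f (compose (carrier P1) \<psi> (d 0))"
      by (auto simp: ext_coboundaries_def)
    have "compose (carrier P0) f \<psi> \<in> carrier (hom_group S P0 ?NS)"
      using hom_in_carrier[OF compose_left_hom[OF P_module fS] \<psi>] .
    moreover have "\<chi> = compose (carrier P1) (compose (carrier P0) f \<psi>) (d 0)"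
      by (auto simp: \<chi> compose_def intro!: restrict_ext)
    ultimately show "\<chi> \<in> ext_coboundaries S P d ?NS (Suc 0)" by (auto simp: ext_coboundaries_def)
  qed
  then have map: "ext_map S P d ?NS f (Suc 0) X =
      ext_coboundaries S P d ?NS (Suc 0) #>\<^bsub>hom_group S P1 ?NS\<^esub> compose (carrier P1) f \<phi>"
    unfolding X' ext_map_def
    using \<phi> coboundaries_subgroup[OF M] coboundaries_subgroup[OF N] hom_f
    by (intro quot_map_coset G) (simp_all add: ext_cocycles_def kernel_def)
  have fZ: "compose (carrier P1) f \<phi> \<in> ext_cocycles S P d ?NS (Suc 0)"
    using hom_in_carrier[OF hom_f, of \<phi>] \<phi> cocycleD[OF M \<phi>]
      linear_zero[OF left_moduleD(2)[OF M] left_moduleD(2)[OF N] f]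
    by (auto simp: ext_cocycles_def kernel_def hom_group_simps compose_def intro!: restrict_ext)
  show ?thesis
    unfolding map unfolding X' ext_iso_coset[OF M \<phi>] ext_iso_coset[OF N fZ]
    by (auto simp: compose_def lift_closed intro!: restrict_ext)
qed

lemma ext_naturally_isomorphic:
  "naturally_isomorphic R
    (\<lambda>M :: ('b, 'm) module. ext S P d (restrict_scalars h M) 1)
    (\<lambda>M N f. ext_map S P d (restrict_scalars h N) f 1)
    (\<lambda>M. hom_group R C M) (\<lambda>M N f \<phi>. compose (carrier C) f \<phi>)"
  unfolding naturally_isomorphic_def One_nat_def
proof (intro exI conjI allI impI ballI)
  show "ext_iso \<in> iso (ext S P d (restrict_scalars h M) (Suc 0)) (hom_group R C M)"
    if "left_module R M" for M :: "('b, 'm) module"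
    using that by (rule ext_iso_iso)
  show "ext_iso (ext_map S P d (restrict_scalars h N) f (Suc 0) X) = compose (carrier C) f (ext_iso X)"
    if "left_module R M" "left_module R N" "f \<in> linear_maps R M N"
      "X \<in> carrier (ext S P d (restrict_scalars h M) (Suc 0))"
    for M N :: "('b, 'm) module" and f X
    using that by (rule ext_iso_natural)
qed

end

section \<open>Tensor products\<close>

definition pure :: "'a ring \<Rightarrow> ('a, 'q) module \<Rightarrow> ('a, 'm) module \<Rightarrow> 'q \<Rightarrow> 'm \<Rightarrow> ('q \<times> 'm \<Rightarrow>\<^sub>0 int) set"
  where "pure R Q M x m = tensor_null R Q M #>\<^bsub>free_Abelian_group (carrier Q \<times> carrier M)\<^esub> frag_of (x, m)"

locale tensor_product = Q: left_module "op_ring R" Q + M: left_module R M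
  for R :: "'a ring" and Q :: "('a, 'q) module" and M :: "('a, 'm) module"
begin

abbreviation free where "free \<equiv> free_Abelian_group (carrier Q \<times> carrier M)"
abbreviation null where "null \<equiv> tensor_null R Q M"
abbreviation T where "T \<equiv> tensor R Q M"

sublocale free: comm_group free by (rule abelian_free_Abelian_group)

lemma free_diff_closed: "\<lbrakk>c \<in> carrier free; d \<in> carrier free\<rbrakk> \<Longrightarrow> c - d \<in> carrier free"
  using keys_diff[of c d] by auto

lemma relators_closed: "tensor_relators R Q M \<subseteq> carrier free"
proof -
  note diff = free_diff_closed
  have of: "frag_of (x, m) \<in> carrier free" if "x \<in> carrier Q" "m \<in> carrier M" for x m
    using that by simp
  show ?thesis
    using Q.smult_closed M.smult_closed unfolding tensor_relators_def
    by (auto simp del: carrier_free_Abelian_group_iff intro!: diff of)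
qed

lemma null_subgroup: "subgroup null free"
  unfolding tensor_null_def by (rule free.generate_is_subgroup[OF relators_closed])

sublocale null: normal null free
  using null_subgroup free.normal_iff_subgroup by blast

sublocale T: comm_group T
  unfolding tensor_def by (rule free.abelian_FactGroup[OF null_subgroup])

lemma coset_hom: "(\<lambda>c. null #>\<^bsub>free\<^esub> c) \<in> hom free T"
  unfolding tensor_def by (rule null.r_coset_hom_Mod)

lemma tensor_cases:
  assumes "z \<in> carrier T"
  obtains c where "Poly_Mapping.keys c \<subseteq> carrier Q \<times> carrier M" "z = null #>\<^bsub>free\<^esub> c"
  using assms by (auto simp: tensor_def carrier_FactGroup)

lemma pure_closed: "\<lbrakk>x \<in> carrier Q; m \<in> carrier M\<rbrakk> \<Longrightarrow> pure R Q M x m \<in> carrier T"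
  using hom_in_carrier[OF coset_hom, of "frag_of (x, m)"] by (simp add: pure_def)

lemma coset_add:
  assumes "c \<in> carrier free" "d \<in> carrier free"
  shows "null #>\<^bsub>free\<^esub> (c + d) = (null #>\<^bsub>free\<^esub> c) \<otimes>\<^bsub>T\<^esub> (null #>\<^bsub>free\<^esub> d)"
  using hom_mult[OF coset_hom assms] by simp

lemma coset_diff:
  assumes "Poly_Mapping.keys c \<subseteq> carrier Q \<times> carrier M" "Poly_Mapping.keys d \<subseteq> carrier Q \<times> carrier M"
  shows "null #>\<^bsub>free\<^esub> (c - d) = (null #>\<^bsub>free\<^esub> c) \<otimes>\<^bsub>T\<^esub> inv\<^bsub>T\<^esub> (null #>\<^bsub>free\<^esub> d)"
proof -
  interpret group_hom free T "\<lambda>c. null #>\<^bsub>free\<^esub> c"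
    by unfold_locales (rule coset_hom)
  show ?thesis
    using assms coset_add[of c "- d"] hom_inv[of d] by simp
qed

lemma coset_eqI:
  assumes "c \<in> carrier free" "d \<in> carrier free" "c - d \<in> tensor_relators R Q M"
  shows "null #>\<^bsub>free\<^esub> c = null #>\<^bsub>free\<^esub> d"
proof -
  have "c - d \<in> null" unfolding tensor_null_def using assms(3) by (rule generate.incl)
  then have "c \<in> null #>\<^bsub>free\<^esub> d" by (force simp: r_coset_def)
  then show ?thesis using free.repr_independence[OF _ assms(2) null_subgroup] by simp
qed

lemma pure_add_left:
  assumes "x \<in> carrier Q" "y \<in> carrier Q" "m \<in> carrier M"
  shows "pure R Q M (x \<oplus>\<^bsub>Q\<^esub> y) m = pure R Q M x m \<otimes>\<^bsub>T\<^esub> pure R Q M y m"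
proof -
  have "null #>\<^bsub>free\<^esub> frag_of (x \<oplus>\<^bsub>Q\<^esub> y, m) = null #>\<^bsub>free\<^esub> (frag_of (x, m) + frag_of (y, m))"
    using assms keys_add[of "frag_of (x, m)" "frag_of (y, m)"]
    by (intro coset_eqI) (force simp: tensor_relators_def diff_diff_eq)+
  then show ?thesis using assms by (simp add: pure_def coset_add)
qed

lemma pure_add_right:
  assumes "x \<in> carrier Q" "m \<in> carrier M" "n \<in> carrier M"
  shows "pure R Q M x (m \<oplus>\<^bsub>M\<^esub> n) = pure R Q M x m \<otimes>\<^bsub>T\<^esub> pure R Q M x n"
proof -
  have "null #>\<^bsub>free\<^esub> frag_of (x, m \<oplus>\<^bsub>M\<^esub> n) = null #>\<^bsub>free\<^esub> (frag_of (x, m) + frag_of (x, n))"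
    using assms keys_add[of "frag_of (x, m)" "frag_of (x, n)"]
    by (intro coset_eqI) (force simp: tensor_relators_def diff_diff_eq)+
  then show ?thesis using assms by (simp add: pure_def coset_add)
qed

lemma pure_smult:
  assumes "a \<in> carrier R" "x \<in> carrier Q" "m \<in> carrier M"
  shows "pure R Q M (a \<odot>\<^bsub>Q\<^esub> x) m = pure R Q M x (a \<odot>\<^bsub>M\<^esub> m)"
  unfolding pure_def
proof (rule coset_eqI)
  show "frag_of (a \<odot>\<^bsub>Q\<^esub> x, m) - frag_of (x, a \<odot>\<^bsub>M\<^esub> m) \<in> tensor_relators R Q M"
    unfolding tensor_relators_def using assms by blast
qed (use assms Q.smult_closed M.smult_closed in simp_all)

lemma pure_zero_left:
  assumes "m \<in> carrier M" shows "pure R Q M \<zero>\<^bsub>Q\<^esub> m = \<one>\<^bsub>T\<^esub>"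
proof -
  have "pure R Q M \<zero>\<^bsub>Q\<^esub> m \<otimes>\<^bsub>T\<^esub> pure R Q M \<zero>\<^bsub>Q\<^esub> m = pure R Q M \<zero>\<^bsub>Q\<^esub> m"
    using pure_add_left[of "\<zero>\<^bsub>Q\<^esub>" "\<zero>\<^bsub>Q\<^esub>" m] assms by simp
  then show ?thesis using pure_closed[of "\<zero>\<^bsub>Q\<^esub>" m] assms by (metis T.l_cancel_one' Q.M.zero_closed)
qed

lemma pure_zero_right:
  assumes "x \<in> carrier Q" shows "pure R Q M x \<zero>\<^bsub>M\<^esub> = \<one>\<^bsub>T\<^esub>"
proof -
  have "pure R Q M x \<zero>\<^bsub>M\<^esub> \<otimes>\<^bsub>T\<^esub> pure R Q M x \<zero>\<^bsub>M\<^esub> = pure R Q M x \<zero>\<^bsub>M\<^esub>"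
    using pure_add_right[of x "\<zero>\<^bsub>M\<^esub>" "\<zero>\<^bsub>M\<^esub>"] assms by simp
  then show ?thesis using pure_closed[of x "\<zero>\<^bsub>M\<^esub>"] assms by (metis T.l_cancel_one' M.M.zero_closed)
qed

text \<open>The closure step is a difference, matching induction over formal sums. The neutral
  element needs no case of its own, being the pure tensor of two zeros.\<close>

lemma tensor_induct [consumes 1, case_names pure mult_inv]:
  assumes "z \<in> carrier T"
    and "\<And>x m. \<lbrakk>x \<in> carrier Q; m \<in> carrier M\<rbrakk> \<Longrightarrow> P (pure R Q M x m)"
    and "\<And>z w. \<lbrakk>z \<in> carrier T; w \<in> carrier T; P z; P w\<rbrakk> \<Longrightarrow> P (z \<otimes>\<^bsub>T\<^esub> inv\<^bsub>T\<^esub> w)"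
  shows "P z"
proof -
  obtain c where c: "Poly_Mapping.keys c \<subseteq> carrier Q \<times> carrier M" and z: "z = null #>\<^bsub>free\<^esub> c"
    using tensor_cases[OF assms(1)] .
  have "P (null #>\<^bsub>free\<^esub> c)"
  proof (rule free_Abelian_group_induct[OF c, where P = "\<lambda>c. P (null #>\<^bsub>free\<^esub> c)"])
    have "P \<one>\<^bsub>T\<^esub>"
      using assms(2)[of "\<zero>\<^bsub>Q\<^esub>" "\<zero>\<^bsub>M\<^esub>"] pure_zero_left[of "\<zero>\<^bsub>M\<^esub>"] by simp
    moreover have "null #>\<^bsub>free\<^esub> 0 = \<one>\<^bsub>T\<^esub>"
      using free.coset_mult_one[OF subgroup.subset[OF null_subgroup]] by (simp add: tensor_def)
    ultimately show "P (null #>\<^bsub>free\<^esub> 0)" by simp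
  next
    fix c d
    assume "Poly_Mapping.keys c \<subseteq> carrier Q \<times> carrier M" "Poly_Mapping.keys d \<subseteq> carrier Q \<times> carrier M"
      "P (null #>\<^bsub>free\<^esub> c)" "P (null #>\<^bsub>free\<^esub> d)"
    then show "P (null #>\<^bsub>free\<^esub> (c - d))"
      using assms(3) hom_in_carrier[OF coset_hom] by (simp add: coset_diff)
  next
    fix a assume "a \<in> carrier Q \<times> carrier M"
    then show "P (null #>\<^bsub>free\<^esub> frag_of a)" using assms(2) by (auto simp: pure_def)
  qed
  then show ?thesis by (simp add: z)
qed

lemma tensor_hom_eqI:
  assumes "group G" "f \<in> hom T G" "g \<in> hom T G" "z \<in> carrier T"
    and "\<And>x m. \<lbrakk>x \<in> carrier Q; m \<in> carrier M\<rbrakk> \<Longrightarrow> f (pure R Q M x m) = g (pure R Q M x m)"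
  shows "f z = g z"
  using assms(4)
proof (induction rule: tensor_induct)
  case (mult_inv z w)
  interpret f: group_hom T G f using assms by (simp add: group_hom_def group_hom_axioms_def T.is_group)
  interpret g: group_hom T G g using assms by (simp add: group_hom_def group_hom_axioms_def T.is_group)
  from mult_inv show ?case by simp
qed (rule assms(5))

lemma tensor_subgroup_eq:
  assumes "subgroup H T" "\<And>x m. \<lbrakk>x \<in> carrier Q; m \<in> carrier M\<rbrakk> \<Longrightarrow> pure R Q M x m \<in> H"
  shows "H = carrier T"
proof
  show "H \<subseteq> carrier T" using assms(1) by (rule subgroup.subset)
  show "carrier T \<subseteq> H"
  proof
    fix z assume "z \<in> carrier T"
    then show "z \<in> H"
      by (induction rule: tensor_induct)
        (auto intro: assms(2) subgroup.m_closed[OF assms(1)] subgroup.m_inv_closed[OF assms(1)])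
  qed
qed

text \<open>The map is extended from pairs to formal sums; biadditivity and balancedness put the
  three families of relators in its kernel, so it factors through the quotient.\<close>

lemma tensor_universal:
  assumes "comm_group G"
    and closed: "\<And>x m. \<lbrakk>x \<in> carrier Q; m \<in> carrier M\<rbrakk> \<Longrightarrow> \<phi> x m \<in> carrier G"
    and add_l: "\<And>x y m. \<lbrakk>x \<in> carrier Q; y \<in> carrier Q; m \<in> carrier M\<rbrakk>
      \<Longrightarrow> \<phi> (x \<oplus>\<^bsub>Q\<^esub> y) m = \<phi> x m \<otimes>\<^bsub>G\<^esub> \<phi> y m"
    and add_r: "\<And>x m n. \<lbrakk>x \<in> carrier Q; m \<in> carrier M; n \<in> carrier M\<rbrakk>
      \<Longrightarrow> \<phi> x (m \<oplus>\<^bsub>M\<^esub> n) = \<phi> x m \<otimes>\<^bsub>G\<^esub> \<phi> x n"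
    and balanced: "\<And>a x m. \<lbrakk>a \<in> carrier R; x \<in> carrier Q; m \<in> carrier M\<rbrakk>
      \<Longrightarrow> \<phi> (a \<odot>\<^bsub>Q\<^esub> x) m = \<phi> x (a \<odot>\<^bsub>M\<^esub> m)"
  obtains f where "f \<in> hom T G" "\<And>x m. \<lbrakk>x \<in> carrier Q; m \<in> carrier M\<rbrakk> \<Longrightarrow> f (pure R Q M x m) = \<phi> x m"
proof -
  interpret G: comm_group G by fact
  have "(\<lambda>(x, m). \<phi> x m) ` (carrier Q \<times> carrier M) \<subseteq> carrier G" using closed by auto
  then obtain h where h: "h \<in> hom free G"
    and h': "\<And>u. u \<in> carrier Q \<times> carrier M \<Longrightarrow> h (frag_of u) = (\<lambda>(x, m). \<phi> x m) u"
    by (rule G.free_Abelian_group_universal) blast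
  have h_of: "h (frag_of (x, m)) = \<phi> x m" if "x \<in> carrier Q" "m \<in> carrier M" for x m
    using h'[of "(x, m)"] that by simp
  interpret h: group_hom free G h by unfold_locales (rule h)
  have h_diff: "h (c - d) = h c \<otimes>\<^bsub>G\<^esub> inv\<^bsub>G\<^esub> h d" if "c \<in> carrier free" "d \<in> carrier free" for c d
    using that h.hom_mult[of c "- d"] h.hom_inv[of d] by simp
  have zero: "h (frag_of u - frag_of v - frag_of w) = \<one>\<^bsub>G\<^esub>"
    if "u \<in> carrier Q \<times> carrier M" "v \<in> carrier Q \<times> carrier M" "w \<in> carrier Q \<times> carrier M"
      "h (frag_of u) = h (frag_of v) \<otimes>\<^bsub>G\<^esub> h (frag_of w)" for u v w
  proof -
    have vw: "h (frag_of v) \<in> carrier G" "h (frag_of w) \<in> carrier G" using that by simp_all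
    \<comment> \<open>The image of \<open>u\<close> is written with the factor of \<open>w\<close>
      in front, so that the two inverses cancel from the inside out.\<close>
    have "h (frag_of u - frag_of v - frag_of w) =
        h (frag_of w) \<otimes>\<^bsub>G\<^esub> h (frag_of v) \<otimes>\<^bsub>G\<^esub> inv\<^bsub>G\<^esub> h (frag_of v) \<otimes>\<^bsub>G\<^esub> inv\<^bsub>G\<^esub> h (frag_of w)"
      using that G.m_comm[OF vw] by (simp add: h_diff free_diff_closed del: carrier_free_Abelian_group_iff)
    also have "\<dots> = \<one>\<^bsub>G\<^esub>" using vw by (simp add: G.m_assoc)
    finally show ?thesis .
  qed
  have zero': "h (frag_of u - frag_of v) = \<one>\<^bsub>G\<^esub>"
    if "u \<in> carrier Q \<times> carrier M" "v \<in> carrier Q \<times> carrier M" "h (frag_of u) = h (frag_of v)" for u v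
    using that by (simp add: h_diff)
  have "h r = \<one>\<^bsub>G\<^esub>" if r: "r \<in> tensor_relators R Q M" for r
    using r unfolding tensor_relators_def
  proof (elim UnE)
    assume "r \<in> {frag_of (x \<oplus>\<^bsub>Q\<^esub> y, m) - frag_of (x, m) - frag_of (y, m) | x y m.
       x \<in> carrier Q \<and> y \<in> carrier Q \<and> m \<in> carrier M}"
    then show ?thesis using add_l by (auto simp: h_of intro!: zero)
  next
    assume "r \<in> {frag_of (x, m \<oplus>\<^bsub>M\<^esub> n) - frag_of (x, m) - frag_of (x, n) | x m n.
       x \<in> carrier Q \<and> m \<in> carrier M \<and> n \<in> carrier M}"
    then show ?thesis using add_r by (auto simp: h_of intro!: zero)
  next
    assume "r \<in> {frag_of (a \<odot>\<^bsub>Q\<^esub> x, m) - frag_of (x, a \<odot>\<^bsub>M\<^esub> m) | a x m.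
       a \<in> carrier R \<and> x \<in> carrier Q \<and> m \<in> carrier M}"
    then show ?thesis
      using balanced Q.smult_closed M.smult_closed by (auto simp: h_of intro!: zero')
  qed
  then have "tensor_relators R Q M \<subseteq> kernel free G h"
    using relators_closed by (auto simp: kernel_def simp del: carrier_free_Abelian_group_iff)
  then have "null \<subseteq> kernel free G h"
    unfolding tensor_null_def by (rule free.generate_subgroup_incl[OF _ h.subgroup_kernel])
  then obtain f where "f \<in> hom (free Mod null) G" "\<And>c. c \<in> carrier free \<Longrightarrow> f (null #>\<^bsub>free\<^esub> c) = h c"
    using h.FactGroup_universal_kernel[OF null.normal_axioms] by blast
  then show thesis using that[of f] h_of by (simp add: tensor_def pure_def)
qed

end

text \<open>The two base rings may differ, as they do for \<open>c \<otimes> id\<close>, which leads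
  from a tensor product over \<open>op_ring S\<close> to one over \<open>op_ring R\<close>. The
  universal property only asserts that some homomorphism \<open>h\<close> has the right values on
  pure tensors; the work is to see that \<open>tensor_map\<close>, given on representatives,
  coincides with it.\<close>

lemma
  assumes T': "tensor_product R' Q' M'" and T: "tensor_product R Q M"
    and f_closed: "\<And>x. x \<in> carrier Q' \<Longrightarrow> f x \<in> carrier Q"
    and f_add: "\<And>x y. \<lbrakk>x \<in> carrier Q'; y \<in> carrier Q'\<rbrakk> \<Longrightarrow> f (x \<oplus>\<^bsub>Q'\<^esub> y) = f x \<oplus>\<^bsub>Q\<^esub> f y"
    and g_closed: "\<And>m. m \<in> carrier M' \<Longrightarrow> g m \<in> carrier M"
    and g_add: "\<And>m n. \<lbrakk>m \<in> carrier M'; n \<in> carrier M'\<rbrakk> \<Longrightarrow> g (m \<oplus>\<^bsub>M'\<^esub> n) = g m \<oplus>\<^bsub>M\<^esub> g n"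
    and balanced: "\<And>a x m. \<lbrakk>a \<in> carrier R'; x \<in> carrier Q'; m \<in> carrier M'\<rbrakk>
      \<Longrightarrow> pure R Q M (f (a \<odot>\<^bsub>Q'\<^esub> x)) (g m) = pure R Q M (f x) (g (a \<odot>\<^bsub>M'\<^esub> m))"
  shows tensor_map_hom_balanced: "tensor_map R Q M f g \<in> hom (tensor R' Q' M') (tensor R Q M)"
    and tensor_map_pure_balanced: "\<lbrakk>x \<in> carrier Q'; m \<in> carrier M'\<rbrakk>
      \<Longrightarrow> tensor_map R Q M f g (pure R' Q' M' x m) = pure R Q M (f x) (g m)"
proof -
  interpret T': tensor_product R' Q' M' by fact
  interpret T: tensor_product R Q M by fact
  obtain h where h: "h \<in> hom T'.T T.T" and h_pure: "\<And>x m. \<lbrakk>x \<in> carrier Q'; m \<in> carrier M'\<rbrakk>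
      \<Longrightarrow> h (pure R' Q' M' x m) = pure R Q M (f x) (g m)"
  proof (rule T'.tensor_universal[of T.T "\<lambda>x m. pure R Q M (f x) (g m)"])
    show "comm_group T.T" by (rule T.T.comm_group_axioms)
  qed (simp_all add: T.pure_closed f_closed g_closed f_add g_add T.pure_add_left T.pure_add_right balanced)
  interpret h: group_hom T'.T T.T h by unfold_locales (rule h)
  define F where "F = frag_extend (\<lambda>(x, m). frag_of (f x, g m))"
  have F_keys: "Poly_Mapping.keys (F c) \<subseteq> carrier Q \<times> carrier M"
    if "Poly_Mapping.keys c \<subseteq> carrier Q' \<times> carrier M'" for c
    using that f_closed g_closed unfolding F_def
    by (intro order_trans[OF keys_frag_extend]) auto
  \<comment> \<open>Both sides are additive in the formal sum \<open>c\<close>, so it suffices to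
    compare them on a single pair.\<close>
  have h_coset: "h (T'.null #>\<^bsub>T'.free\<^esub> c) = T.null #>\<^bsub>T.free\<^esub> F c"
    if c: "Poly_Mapping.keys c \<subseteq> carrier Q' \<times> carrier M'" for c
  proof (rule free_Abelian_group_induct[OF c, where
        P = "\<lambda>c. h (T'.null #>\<^bsub>T'.free\<^esub> c) = T.null #>\<^bsub>T.free\<^esub> F c"])
    have "T'.null #>\<^bsub>T'.free\<^esub> 0 = \<one>\<^bsub>T'.T\<^esub>" "T.null #>\<^bsub>T.free\<^esub> 0 = \<one>\<^bsub>T.T\<^esub>"
      using T'.free.coset_mult_one[OF subgroup.subset[OF T'.null_subgroup]]
        T.free.coset_mult_one[OF subgroup.subset[OF T.null_subgroup]]
      by (simp_all add: tensor_def)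
    then show "h (T'.null #>\<^bsub>T'.free\<^esub> 0) = T.null #>\<^bsub>T.free\<^esub> F 0"
      by (simp add: F_def)
  next
    fix c d
    assume cd: "Poly_Mapping.keys c \<subseteq> carrier Q' \<times> carrier M'" "Poly_Mapping.keys d \<subseteq> carrier Q' \<times> carrier M'"
      and IH: "h (T'.null #>\<^bsub>T'.free\<^esub> c) = T.null #>\<^bsub>T.free\<^esub> F c"
        "h (T'.null #>\<^bsub>T'.free\<^esub> d) = T.null #>\<^bsub>T.free\<^esub> F d"
    have "T'.null #>\<^bsub>T'.free\<^esub> c \<in> carrier T'.T" "T'.null #>\<^bsub>T'.free\<^esub> d \<in> carrier T'.T"
      using cd hom_in_carrier[OF T'.coset_hom] by simp_all
    then show "h (T'.null #>\<^bsub>T'.free\<^esub> (c - d)) = T.null #>\<^bsub>T.free\<^esub> F (c - d)"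
      using cd IH F_keys T.coset_diff[of "F c" "F d"] T'.coset_diff[of c d]
      by (simp add: F_def frag_extend_diff)
  next
    fix u assume "u \<in> carrier Q' \<times> carrier M'"
    then show "h (T'.null #>\<^bsub>T'.free\<^esub> frag_of u) = T.null #>\<^bsub>T.free\<^esub> F (frag_of u)"
      using h_pure by (auto simp: F_def pure_def)
  qed
  have map_eq: "tensor_map R Q M f g z = h z" if z: "z \<in> carrier T'.T" for z
  proof -
    obtain c where c: "Poly_Mapping.keys c \<subseteq> carrier Q' \<times> carrier M'" and z: "z = T'.null #>\<^bsub>T'.free\<^esub> c"
      using T'.tensor_cases[OF z] .
    have "T.null #>\<^bsub>T.free\<^esub> F b = h z" if b: "b \<in> z" for b
    proof -
      have "T'.null #>\<^bsub>T'.free\<^esub> c = T'.null #>\<^bsub>T'.free\<^esub> b"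
        using b c unfolding z by (intro T'.free.repr_independence T'.null_subgroup) simp_all
      moreover have "Poly_Mapping.keys b \<subseteq> carrier Q' \<times> carrier M'"
        using subgroup.elemrcos_carrier[OF T'.null_subgroup T'.free.is_group, of c b] b c
        unfolding z by simp
      ultimately show ?thesis unfolding z by (simp add: h_coset)
    qed
    moreover have "c \<in> z" unfolding z using c T'.null_subgroup by (intro T'.free.rcos_self) simp_all
    ultimately have "(\<lambda>b. T.null #>\<^bsub>T.free\<^esub> F b) ` z = {h z}" by blast
    then show ?thesis by (simp add: tensor_map_def quot_map_def F_def)
  qed
  show "tensor_map R Q M f g \<in> hom T'.T T.T"
    by (rule homI) (simp_all add: map_eq)
  show "tensor_map R Q M f g (pure R' Q' M' x m) = pure R Q M (f x) (g m)"
    if "x \<in> carrier Q'" "m \<in> carrier M'"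
    using that by (simp add: map_eq T'.pure_closed h_pure)
qed

text \<open>Over one ring, balancedness follows from linearity of both maps and the passage of
  scalars across a pure tensor.\<close>

lemma
  assumes T': "tensor_product R Q' M'" and T: "tensor_product R Q M"
    and f: "f \<in> linear_maps (op_ring R) Q' Q" and g: "g \<in> linear_maps R M' M"
  shows tensor_map_hom: "tensor_map R Q M f g \<in> hom (tensor R Q' M') (tensor R Q M)"
    and tensor_map_pure: "\<lbrakk>x \<in> carrier Q'; m \<in> carrier M'\<rbrakk>
      \<Longrightarrow> tensor_map R Q M f g (pure R Q' M' x m) = pure R Q M (f x) (g m)"
proof -
  interpret T: tensor_product R Q M by fact
  note * = linear_mapsD[OF f] linear_mapsD[OF g]
  show "tensor_map R Q M f g \<in> hom (tensor R Q' M') (tensor R Q M)"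
    using * by (intro tensor_map_hom_balanced[OF T' T]) (simp_all add: T.pure_smult)
  show "tensor_map R Q M f g (pure R Q' M' x m) = pure R Q M (f x) (g m)"
    if "x \<in> carrier Q'" "m \<in> carrier M'"
    using * that by (intro tensor_map_pure_balanced[OF T' T]) (simp_all add: T.pure_smult)
qed

section \<open>The Tor group\<close>

lemma ring_hom_op_ring: "h \<in> ring_hom S R \<Longrightarrow> h \<in> ring_hom (op_ring S) (op_ring R)"
  by (auto simp: ring_hom_def)

context conormal_comparison
begin

text \<open>Directed from Tor to the tensor product, because \<open>c \<otimes> id\<close> is given
  by a formula while its inverse goes through choices. Unlike \<open>ext_iso\<close> it takes
  \<open>M\<close> as an argument: \<open>tensor_map\<close> produces cosets of a subgroup that
  depends on the target module.\<close>

definition tor_iso :: "('b, 'm) module \<Rightarrow> ('p \<times> 'm \<Rightarrow>\<^sub>0 int) set set \<Rightarrow> ('a set \<times> 'm \<Rightarrow>\<^sub>0 int) set" where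
  "tor_iso M X = the_elem (tensor_map (op_ring R) C M c id ` X)"

context
  fixes M :: "('b, 'm) module"
  assumes M: "left_module (op_ring R) M"
begin

private abbreviation "MA \<equiv> restrict_scalars h M"
text \<open>The comparison data consist of left modules over \<open>S\<close> and \<open>R\<close>.
  For Tor these have to be right modules, so the tensor products are formed over the opposites of
  \<open>S\<close> and \<open>R\<close>.\<close>

private abbreviation "A \<equiv> op_ring S"
private abbreviation "\<gamma> \<equiv> tensor_map (op_ring R) C M c id"
private abbreviation "\<delta>0 \<equiv> tensor_map A P0 MA (d 0) id"
private abbreviation "\<delta>1 \<equiv> tensor_map A P1 MA (d (Suc 0)) id"
private abbreviation "ZT \<equiv> tor_cycles A P d MA (Suc 0)"
private abbreviation "BT \<equiv> tor_boundaries A P d MA (Suc 0)"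

interpretation M: left_module "op_ring R" M by (rule M)

lemma MS_module: "left_module A MA"
  by (rule left_module_restrict_scalars[OF ring_op_ring[OF S.ring_axioms] ring_hom_op_ring[OF hom] M])

lemma tensor_product_P: "tensor_product A (P n) MA"
  using P_module MS_module by (simp add: tensor_product_def)

lemma tensor_product_C: "tensor_product (op_ring R) C M"
  using left_module_conormal M by (simp add: tensor_product_def)

interpretation T0: tensor_product A P0 MA by (rule tensor_product_P)
interpretation T1: tensor_product A P1 MA by (rule tensor_product_P)
interpretation T2: tensor_product A P2 MA by (rule tensor_product_P)
interpretation TC: tensor_product "op_ring R" C M by (rule tensor_product_C)

lemma id_linear: "id \<in> linear_maps A MA MA"
  by (rule linear_mapsI) simp_all

lemma d_linear_op: "d n \<in> linear_maps (op_ring A) (P (Suc n)) (P n)"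
  using d_linear by simp

lemma H_linear_op: "H \<in> linear_maps (op_ring A) P0 P1"
  using H_linear by simp

lemma \<delta>_pure:
  "\<lbrakk>x \<in> carrier P1; m \<in> carrier M\<rbrakk> \<Longrightarrow> \<delta>0 (pure A P1 MA x m) = pure A P0 MA (d 0 x) m"
  "\<lbrakk>z \<in> carrier P2; m \<in> carrier M\<rbrakk> \<Longrightarrow> \<delta>1 (pure A P2 MA z m) = pure A P1 MA (d (Suc 0) z) m"
  using tensor_map_pure[OF tensor_product_P tensor_product_P d_linear_op id_linear] by simp_all

lemma H_pure: "\<lbrakk>x \<in> carrier P0; m \<in> carrier M\<rbrakk> \<Longrightarrow>
    tensor_map A P1 MA H id (pure A P0 MA x m) = pure A P1 MA (H x) m"
  using tensor_map_pure[OF tensor_product_P tensor_product_P H_linear_op id_linear] by simp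

interpretation \<delta>0: group_hom T1.T T0.T \<delta>0
  by unfold_locales (rule tensor_map_hom[OF tensor_product_P tensor_product_P d_linear_op id_linear])
interpretation \<delta>1: group_hom T2.T T1.T \<delta>1
  by unfold_locales (rule tensor_map_hom[OF tensor_product_P tensor_product_P d_linear_op id_linear])
interpretation TH: group_hom T0.T T1.T "tensor_map A P1 MA H id"
  by unfold_locales (rule tensor_map_hom[OF tensor_product_P tensor_product_P H_linear_op id_linear])

text \<open>Balancedness over \<open>A\<close> holds because \<open>c\<close> is semilinear along
  \<open>h\<close> and \<open>A\<close> acts on \<open>M\<close> through \<open>h\<close> as
  well.\<close>

lemma \<gamma>_hom: "\<gamma> \<in> hom T1.T TC.T"
  using C.smult_closed hom.hom_closed
  by (intro tensor_map_hom_balanced[OF tensor_product_P tensor_product_C])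
    (simp_all add: c_closed c_add c_smult TC.pure_smult)

lemma \<gamma>_pure: "\<lbrakk>x \<in> carrier P1; m \<in> carrier M\<rbrakk> \<Longrightarrow> \<gamma> (pure A P1 MA x m) = pure (op_ring R) C M (c x) m"
  using C.smult_closed
  by (subst tensor_map_pure_balanced[OF tensor_product_P tensor_product_C])
    (simp_all add: c_closed c_add c_smult TC.pure_smult)

interpretation \<gamma>: group_hom T1.T TC.T \<gamma>
  by unfold_locales (rule \<gamma>_hom)

lemma Z_eq: "ZT = kernel T1.T T0.T \<delta>0"
  by (simp add: tor_cycles_def)

lemma B_eq: "BT = \<delta>1 ` carrier T2.T"
  by (simp add: tor_boundaries_def)

lemma cycles_subgroup: "subgroup ZT T1.T"
  unfolding Z_eq by (rule \<delta>0.subgroup_kernel)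

lemma boundaries_subgroup: "subgroup BT T1.T"
  unfolding B_eq by (rule \<delta>1.img_is_subgroup)

lemma \<delta>\<delta>: "w \<in> carrier T2.T \<Longrightarrow> \<delta>0 (\<delta>1 w) = \<one>\<^bsub>T0.T\<^esub>"
proof (rule T2.tensor_hom_eqI[where f = "\<lambda>w. \<delta>0 (\<delta>1 w)" and g = "\<lambda>w. \<one>\<^bsub>T0.T\<^esub>"])
  show "(\<lambda>w. \<delta>0 (\<delta>1 w)) \<in> hom T2.T T0.T" "(\<lambda>w. \<one>\<^bsub>T0.T\<^esub>) \<in> hom T2.T T0.T"
    by (rule homI; simp)+
qed (simp_all add: \<delta>_pure dd_zero T0.pure_zero_left T0.T.is_group)

lemma \<gamma>\<delta>: "w \<in> carrier T2.T \<Longrightarrow> \<gamma> (\<delta>1 w) = \<one>\<^bsub>TC.T\<^esub>"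
proof (rule T2.tensor_hom_eqI[where f = "\<lambda>w. \<gamma> (\<delta>1 w)" and g = "\<lambda>w. \<one>\<^bsub>TC.T\<^esub>"])
  show "(\<lambda>w. \<gamma> (\<delta>1 w)) \<in> hom T2.T TC.T" "(\<lambda>w. \<one>\<^bsub>TC.T\<^esub>) \<in> hom T2.T TC.T"
    by (rule homI; simp)+
qed (simp_all add: \<delta>_pure \<gamma>_pure c_d TC.pure_zero_left TC.T.is_group)

lemma boundaries_subset: "BT \<subseteq> ZT"
  using \<delta>\<delta> by (auto simp: Z_eq B_eq kernel_def)

text \<open>The boundary of \<open>y \<otimes> m\<close> is \<open>k p \<otimes> m\<close>; moving
  \<open>k\<close> across the tensor sign turns it into \<open>p \<otimes> 0\<close>, since
  \<open>k\<close> acts on \<open>M\<close> by \<open>h k = 0\<close>.\<close>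

lemma pure_lift_cycle:
  assumes "k \<in> K" "y \<in> carrier P1" "d 0 y = k \<odot>\<^bsub>P0\<^esub> p" "m \<in> carrier M"
  shows "pure A P1 MA y m \<in> ZT"
proof -
  have k: "k \<in> carrier S" "h k = \<zero>\<^bsub>R\<^esub>" using assms(1) by (simp_all only: K_iff)
  have "\<zero>\<^bsub>R\<^esub> \<odot>\<^bsub>M\<^esub> m = \<zero>\<^bsub>M\<^esub>" using M.smult_zero_left[OF assms(4)] by simp
  then have "pure A P0 MA (k \<odot>\<^bsub>P0\<^esub> p) m = \<one>\<^bsub>T0.T\<^esub>"
    using T0.pure_smult[of k p m] T0.pure_zero_right[of p] k assms(4) by simp
  then show ?thesis
    using assms by (simp add: Z_eq kernel_def \<delta>_pure T1.pure_closed)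
qed

text \<open>It suffices to reach the pure tensors: by \<open>c_lift\<close>, the class of
  \<open>k\<close> tensored with \<open>m\<close> is the image of the cycle
  \<open>y \<otimes> m\<close>, where \<open>y\<close> lifts \<open>k\<close>.\<close>

lemma \<gamma>_surj: "\<gamma> ` ZT = carrier TC.T"
proof (rule TC.tensor_subgroup_eq)
  show "subgroup (\<gamma> ` ZT) TC.T"
    by (rule \<gamma>.subgroup_img_is_subgroup[OF cycles_subgroup])
  fix X m assume X: "X \<in> carrier C" and m: "m \<in> carrier M"
  obtain k where k: "k \<in> K" "X = K2 +>\<^bsub>S\<^esub> k" using X by (auto simp: carrier_conormal)
  obtain y where y: "y \<in> carrier P1" "d 0 y = k \<odot>\<^bsub>P0\<^esub> p" using K_lift[OF k(1)] by blast
  have "pure (op_ring R) C M X m = \<gamma> (pure A P1 MA y m)"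
    using \<gamma>_pure[OF y(1) m] c_lift[OF k(1) y] k(2) by simp
  then show "pure (op_ring R) C M X m \<in> \<gamma> ` ZT"
    using pure_lift_cycle[OF k(1) y m] by simp
qed

private abbreviation "L \<equiv> T1.T Mod BT"

interpretation L: comm_group L by (rule T1.T.abelian_FactGroup[OF boundaries_subgroup])

lemma coset_hom_L: "(\<lambda>w. BT #>\<^bsub>T1.T\<^esub> w) \<in> hom T1.T L"
  by (rule normal.r_coset_hom_Mod) (simp add: T1.T.normal_iff_subgroup boundaries_subgroup)

interpretation BL: group_hom T1.T L "\<lambda>w. BT #>\<^bsub>T1.T\<^esub> w"
  by unfold_locales (rule coset_hom_L)

text \<open>Values are taken in the quotient of all of \<open>P1 \<otimes> M\<close> by boundaries,
  because \<open>x \<otimes> m\<close> need not be a cycle for general \<open>x\<close>. Multiples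
  by \<open>k\<close> in \<open>K\<close> vanish since \<open>k\<close> moves over to
  \<open>m\<close> and acts there by zero.\<close>

lemma tensor_descent:
  assumes m: "m \<in> carrier M"
  shows "conormal_descent S R h P d s p H L (\<lambda>x. BT #>\<^bsub>T1.T\<^esub> pure A P1 MA x m)"
proof (intro conormal_descent.intro conormal_descent_axioms.intro)
  show "group L" by (rule L.is_group)
  show "BT #>\<^bsub>T1.T\<^esub> pure A P1 MA (x \<oplus>\<^bsub>P1\<^esub> y) m =
      (BT #>\<^bsub>T1.T\<^esub> pure A P1 MA x m) \<otimes>\<^bsub>L\<^esub> (BT #>\<^bsub>T1.T\<^esub> pure A P1 MA y m)"
    if "x \<in> carrier P1" "y \<in> carrier P1" for x y
    using that m BL.hom_mult by (simp only: T1.pure_add_left restrict_scalars_simps T1.pure_closed)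
  show "BT #>\<^bsub>T1.T\<^esub> pure A P1 MA x m \<in> carrier L" if "x \<in> carrier P1" for x
    using that m by (intro BL.hom_closed T1.pure_closed) simp_all
  show "BT #>\<^bsub>T1.T\<^esub> pure A P1 MA (d (Suc 0) z) m = \<one>\<^bsub>L\<^esub>" if z: "z \<in> carrier P2" for z
  proof -
    have "pure A P1 MA (d (Suc 0) z) m \<in> BT"
      unfolding B_eq using \<delta>_pure(2)[OF z m] z m T2.pure_closed[of z m]
      by (auto simp flip: \<delta>_pure(2))
    then show ?thesis
      using T1.T.coset_join2[OF _ boundaries_subgroup] subgroup.mem_carrier[OF boundaries_subgroup] by simp
  qed
  show "BT #>\<^bsub>T1.T\<^esub> pure A P1 MA (k \<odot>\<^bsub>P1\<^esub> y) m = \<one>\<^bsub>L\<^esub>" if k: "k \<in> K" and y: "y \<in> carrier P1" for k y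
  proof -
    have k: "k \<in> carrier S" "h k = \<zero>\<^bsub>R\<^esub>" using k by (simp_all only: K_iff)
    have "\<zero>\<^bsub>R\<^esub> \<odot>\<^bsub>M\<^esub> m = \<zero>\<^bsub>M\<^esub>" using M.smult_zero_left[OF m] by simp
    then have "pure A P1 MA (k \<odot>\<^bsub>P1\<^esub> y) m = \<one>\<^bsub>T1.T\<^esub>"
      using T1.pure_smult[of k y m] T1.pure_zero_right[of y] k y m by simp
    then show ?thesis using BL.hom_one by simp
  qed
qed (rule conormal_comparison_axioms)

text \<open>A left inverse of \<open>\<gamma>\<close> on cycles modulo boundaries, sending
  \<open>X \<otimes> m\<close> to the class of \<open>lift X \<otimes> m\<close>. It is well defined
  by descent for each \<open>m\<close> separately, together with biadditivity and
  balancedness.\<close>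

lemma \<gamma>_inverse:
  obtains \<Psi> where "\<Psi> \<in> hom TC.T L" "\<And>w. w \<in> ZT \<Longrightarrow> \<Psi> (\<gamma> w) = BT #>\<^bsub>T1.T\<^esub> w"
proof -
  let ?\<psi> = "\<lambda>m x. BT #>\<^bsub>T1.T\<^esub> pure A P1 MA x m"
  note D = tensor_descent
  obtain \<Psi> where \<Psi>: "\<Psi> \<in> hom TC.T L"
    and \<Psi>_pure: "\<And>X m. \<lbrakk>X \<in> carrier C; m \<in> carrier M\<rbrakk> \<Longrightarrow>
      \<Psi> (pure (op_ring R) C M X m) = ?\<psi> m (lift X)"
  proof (rule TC.tensor_universal[of L "\<lambda>X m. ?\<psi> m (lift X)"])
    show "comm_group L" by (rule L.comm_group_axioms)
    show "?\<psi> m (lift X) \<in> carrier L" if "X \<in> carrier C" "m \<in> carrier M" for X m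
      using conormal_descent.descent_closed[OF D[OF that(2)] that(1)] .
    show "?\<psi> m (lift (X \<oplus>\<^bsub>C\<^esub> Y)) = ?\<psi> m (lift X) \<otimes>\<^bsub>L\<^esub> ?\<psi> m (lift Y)"
      if "X \<in> carrier C" "Y \<in> carrier C" "m \<in> carrier M" for X Y m
      using conormal_descent.descent_add[OF D[OF that(3)] that(1,2)] .
    show "?\<psi> (m \<oplus>\<^bsub>M\<^esub> n) (lift X) = ?\<psi> m (lift X) \<otimes>\<^bsub>L\<^esub> ?\<psi> n (lift X)"
      if "X \<in> carrier C" "m \<in> carrier M" "n \<in> carrier M" for X m n
      using lift_closed[OF that(1)] that(2,3) T1.pure_add_right[of "lift X" m n]
        BL.hom_mult[of "pure A P1 MA (lift X) m" "pure A P1 MA (lift X) n"]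
      by (simp only: restrict_scalars_simps T1.pure_closed)
    show "?\<psi> m (lift (r \<odot>\<^bsub>C\<^esub> X)) = ?\<psi> (r \<odot>\<^bsub>M\<^esub> m) (lift X)"
      if r: "r \<in> carrier (op_ring R)" and X: "X \<in> carrier C" and m: "m \<in> carrier M" for r X m
    proof -
      have r': "r \<in> carrier R" using r by simp
      obtain a where a: "a \<in> carrier S" "h a = r" using surj'[OF r'] by blast
      have rm: "r \<odot>\<^bsub>M\<^esub> m \<in> carrier M" using M.smult_closed[OF r m] .
      obtain k where k: "k \<in> K" "X = K2 +>\<^bsub>S\<^esub> k" using X by (auto simp: carrier_conormal)
      obtain y where y: "y \<in> carrier P1" "d 0 y = k \<odot>\<^bsub>P0\<^esub> p" using K_lift[OF k(1)] by blast
      \<comment> \<open>Since \<open>r = h a\<close>, the class \<open>r X\<close> has the lift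
        \<open>a y\<close>; the scalar then crosses to \<open>m\<close>, on which \<open>a\<close>
        acts as \<open>r\<close>.\<close>
      have "?\<psi> m (lift (r \<odot>\<^bsub>C\<^esub> X)) = ?\<psi> m (a \<odot>\<^bsub>P1\<^esub> y)"
        using conormal_descent.descent_smult[OF D[OF m] a(1) k(1) y] by (simp only: a(2) k(2))
      also have "\<dots> = ?\<psi> (r \<odot>\<^bsub>M\<^esub> m) y"
        using T1.pure_smult[of a y m] a y m by simp
      also have "\<dots> = ?\<psi> (r \<odot>\<^bsub>M\<^esub> m) (lift X)"
        using conormal_descent.\<psi>_lift[OF D[OF rm] k(1) y] by (simp only: k(2))
      finally show ?thesis .
    qed
  qed (rule that)
  interpret \<Psi>: group_hom TC.T L \<Psi> by unfold_locales (rule \<Psi>)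
  show thesis
  proof
    show "\<Psi> \<in> hom TC.T L" by fact
    fix w assume w: "w \<in> ZT"
    then have wT: "w \<in> carrier T1.T" and \<delta>w: "\<delta>0 w = \<one>\<^bsub>T0.T\<^esub>" by (simp_all add: Z_eq kernel_def)
    \<comment> \<open>The identity is stated on all of \<open>P1 \<otimes> M\<close>, where both
      sides are homomorphisms and pure tensors can be tested by \<open>descent_c\<close>. On a cycle
      the homotopy term drops out.\<close>
    have "BT #>\<^bsub>T1.T\<^esub> w = \<Psi> (\<gamma> w) \<otimes>\<^bsub>L\<^esub> (BT #>\<^bsub>T1.T\<^esub> tensor_map A P1 MA H id (\<delta>0 w))"
      using wT
    proof (rule T1.tensor_hom_eqI[OF L.is_group coset_hom_L, rotated])
      show "(\<lambda>w. \<Psi> (\<gamma> w) \<otimes>\<^bsub>L\<^esub> (BT #>\<^bsub>T1.T\<^esub> tensor_map A P1 MA H id (\<delta>0 w))) \<in> hom T1.T L"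
      proof (rule homI)
        fix v w assume vw: "v \<in> carrier T1.T" "w \<in> carrier T1.T"
        have "\<Psi> (\<gamma> (v \<otimes>\<^bsub>T1.T\<^esub> w)) = \<Psi> (\<gamma> v) \<otimes>\<^bsub>L\<^esub> \<Psi> (\<gamma> w)"
          using vw by (simp only: \<gamma>.hom_mult \<Psi>.hom_mult \<gamma>.hom_closed)
        moreover have "BT #>\<^bsub>T1.T\<^esub> tensor_map A P1 MA H id (\<delta>0 (v \<otimes>\<^bsub>T1.T\<^esub> w)) =
            (BT #>\<^bsub>T1.T\<^esub> tensor_map A P1 MA H id (\<delta>0 v)) \<otimes>\<^bsub>L\<^esub> (BT #>\<^bsub>T1.T\<^esub> tensor_map A P1 MA H id (\<delta>0 w))"
          using vw by (simp only: \<delta>0.hom_mult TH.hom_mult BL.hom_mult \<delta>0.hom_closed TH.hom_closed)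
        moreover have "\<Psi> (\<gamma> v) \<in> carrier L" "\<Psi> (\<gamma> w) \<in> carrier L"
          "BT #>\<^bsub>T1.T\<^esub> tensor_map A P1 MA H id (\<delta>0 v) \<in> carrier L"
          "BT #>\<^bsub>T1.T\<^esub> tensor_map A P1 MA H id (\<delta>0 w) \<in> carrier L"
          using vw by (simp_all only: \<gamma>.hom_closed \<Psi>.hom_closed \<delta>0.hom_closed TH.hom_closed BL.hom_closed)
        ultimately show "\<Psi> (\<gamma> (v \<otimes>\<^bsub>T1.T\<^esub> w)) \<otimes>\<^bsub>L\<^esub> (BT #>\<^bsub>T1.T\<^esub> tensor_map A P1 MA H id (\<delta>0 (v \<otimes>\<^bsub>T1.T\<^esub> w))) =
          \<Psi> (\<gamma> v) \<otimes>\<^bsub>L\<^esub> (BT #>\<^bsub>T1.T\<^esub> tensor_map A P1 MA H id (\<delta>0 v)) \<otimes>\<^bsub>L\<^esub>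
            (\<Psi> (\<gamma> w) \<otimes>\<^bsub>L\<^esub> (BT #>\<^bsub>T1.T\<^esub> tensor_map A P1 MA H id (\<delta>0 w)))"
          by (simp only: L.m_ac L.m_closed)
      next
        fix v assume "v \<in> carrier T1.T"
        then show "\<Psi> (\<gamma> v) \<otimes>\<^bsub>L\<^esub> (BT #>\<^bsub>T1.T\<^esub> tensor_map A P1 MA H id (\<delta>0 v)) \<in> carrier L"
          by (simp only: L.m_closed \<gamma>.hom_closed \<Psi>.hom_closed \<delta>0.hom_closed TH.hom_closed BL.hom_closed)
      qed
      fix x m assume x: "x \<in> carrier P1" and "m \<in> carrier MA"
      then have m: "m \<in> carrier M" by simp
      have "?\<psi> m x = ?\<psi> m (lift (c x)) \<otimes>\<^bsub>L\<^esub> ?\<psi> m (H (d 0 x))"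
        by (rule conormal_descent.descent_c[OF D[OF m] x])
      then show "BT #>\<^bsub>T1.T\<^esub> pure A P1 MA x m = \<Psi> (\<gamma> (pure A P1 MA x m)) \<otimes>\<^bsub>L\<^esub>
          (BT #>\<^bsub>T1.T\<^esub> tensor_map A P1 MA H id (\<delta>0 (pure A P1 MA x m)))"
        using \<gamma>_pure[OF x m] \<Psi>_pure[OF c_closed[OF x] m] \<delta>_pure(1)[OF x m]
          H_pure[OF linear_closed[OF d_linear x] m] by (simp only:)
    qed
    then show "\<Psi> (\<gamma> w) = BT #>\<^bsub>T1.T\<^esub> w"
      using \<Psi>.hom_closed[OF \<gamma>.hom_closed[OF wT]] \<delta>w by (simp only: TH.hom_one BL.hom_one L.r_one)
  qed
qed

text \<open>A left inverse sends \<open>\<gamma> w\<close> back to the class of the cycle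
  \<open>w\<close>, so a trivial \<open>\<gamma> w\<close> forces \<open>w\<close> to be a
  boundary.\<close>

lemma kernel_\<gamma>: "kernel (T1.T\<lparr>carrier := ZT\<rparr>) TC.T \<gamma> = BT"
proof
  show "BT \<subseteq> kernel (T1.T\<lparr>carrier := ZT\<rparr>) TC.T \<gamma>"
    using boundaries_subset \<gamma>\<delta> by (auto simp: kernel_def B_eq)
  show "kernel (T1.T\<lparr>carrier := ZT\<rparr>) TC.T \<gamma> \<subseteq> BT"
  proof
    fix w assume "w \<in> kernel (T1.T\<lparr>carrier := ZT\<rparr>) TC.T \<gamma>"
    then have w: "w \<in> ZT" and \<gamma>w: "\<gamma> w = \<one>\<^bsub>TC.T\<^esub>" by (simp_all add: kernel_def)
    obtain \<Psi> where \<Psi>: "\<Psi> \<in> hom TC.T L" and "\<And>w. w \<in> ZT \<Longrightarrow> \<Psi> (\<gamma> w) = BT #>\<^bsub>T1.T\<^esub> w"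
      by (rule \<gamma>_inverse) blast
    then have "BT #>\<^bsub>T1.T\<^esub> w = \<Psi> \<one>\<^bsub>TC.T\<^esub>" using w \<gamma>w by metis
    also have "\<dots> = BT" using hom_one[OF \<Psi> TC.T.is_group L.is_group] by simp
    finally show "w \<in> BT"
      using T1.T.coset_join1[OF _ _ boundaries_subgroup] subgroup.mem_carrier[OF cycles_subgroup w]
      by blast
  qed
qed

lemma \<gamma>_hom_Z: "\<gamma> \<in> hom (T1.T\<lparr>carrier := ZT\<rparr>) TC.T"
  using subgroup.mem_carrier[OF cycles_subgroup] by (intro homI) simp_all

interpretation \<gamma>ZT: group_hom "T1.T\<lparr>carrier := ZT\<rparr>" TC.T \<gamma>
  by (intro group_hom.intro group_hom_axioms.intro \<gamma>_hom_Z TC.T.is_group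
      T1.T.subgroup_imp_group cycles_subgroup)

lemma tor_iso_iso: "tor_iso M \<in> iso (tor A P d MA (Suc 0)) TC.T"
proof -
  have "carrier (T1.T\<lparr>carrier := ZT\<rparr>) = ZT" by simp
  then have "\<gamma> ` carrier (T1.T\<lparr>carrier := ZT\<rparr>) = carrier TC.T" using \<gamma>_surj by simp
  from \<gamma>ZT.FactGroup_iso_set[OF this] show ?thesis
    unfolding kernel_\<gamma> tor_def tor_iso_def[abs_def] .
qed

lemma tor_iso_coset:
  assumes w: "w \<in> ZT"
  shows "tor_iso M (BT #>\<^bsub>T1.T\<^esub> w) = \<gamma> w"
proof -
  have "subgroup BT (T1.T\<lparr>carrier := ZT\<rparr>)"
    using \<gamma>ZT.subgroup_kernel unfolding kernel_\<gamma> .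
  then have "the_elem (\<gamma> ` (BT #>\<^bsub>T1.T\<lparr>carrier := ZT\<rparr>\<^esub> w)) = \<gamma> w"
    using w by (intro the_elem_image_coset[OF \<gamma>ZT.is_group _ TC.T.is_group \<gamma>_hom_Z])
      (simp_all add: kernel_\<gamma>)
  then show ?thesis by (simp add: tor_iso_def)
qed

lemma tor_carrier_cases:
  assumes "X \<in> carrier (tor A P d MA (Suc 0))"
  obtains w where "w \<in> ZT" "X = BT #>\<^bsub>T1.T\<^esub> w"
  using assms by (auto simp: tor_def carrier_FactGroup)

end

text \<open>On representatives, naturality is the equality of two homomorphisms out of
  \<open>P1 \<otimes> M\<close>, both of which take \<open>x \<otimes> m\<close> to
  \<open>c x \<otimes> f m\<close>.\<close>

lemma tor_iso_natural:
  assumes M: "left_module (op_ring R) M" and N: "left_module (op_ring R) N"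
    and f: "f \<in> linear_maps (op_ring R) M N"
    and X: "X \<in> carrier (tor (op_ring S) P d (restrict_scalars h M) (Suc 0))"
  shows "tor_iso N (tor_map (op_ring S) P d (restrict_scalars h N) f (Suc 0) X) =
    tensor_map (op_ring R) C N id f (tor_iso M X)"
proof -
  let ?A = "op_ring S" and ?MA = "restrict_scalars h M" and ?NS = "restrict_scalars h N"
  let ?F = "\<lambda>n. tensor_map ?A (P n) ?NS id f"
  have fS: "f \<in> linear_maps ?A ?MA ?NS"
    by (rule linear_maps_restrict_scalars[OF ring_hom_op_ring[OF hom] f])
  have idP: "id \<in> linear_maps (op_ring ?A) (P n) (P n)" for n by (rule linear_mapsI) simp_all
  have idC: "id \<in> linear_maps (op_ring (op_ring R)) C C" by (rule linear_mapsI) simp_all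
  interpret TM: tensor_product ?A "P n" ?MA for n by (rule tensor_product_P[OF M])
  interpret TN: tensor_product ?A "P n" ?NS for n by (rule tensor_product_P[OF N])
  interpret CM: tensor_product "op_ring R" C M by (rule tensor_product_C[OF M])
  interpret CN: tensor_product "op_ring R" C N by (rule tensor_product_C[OF N])
  note F_hom = tensor_map_hom[OF TM.tensor_product_axioms TN.tensor_product_axioms idP fS]
  have F_pure: "?F n (pure ?A (P n) ?MA x m) = pure ?A (P n) ?NS x (f m)"
    if "x \<in> carrier (P n)" "m \<in> carrier M" for n x m
    using tensor_map_pure[OF TM.tensor_product_axioms TN.tensor_product_axioms idP fS] that by simp
  note fM = linear_closed[OF f]
  have d_id: "d n \<in> linear_maps (op_ring ?A) (P (Suc n)) (P n)" for n using d_linear by simp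
  \<comment> \<open>\<open>id \<otimes> f\<close> is a chain map. The case \<open>n = 0\<close>
    shows that cycles go to cycles, the case \<open>n = 1\<close> that boundaries go to
    boundaries.\<close>
  have F_d: "?F n (tensor_map ?A (P n) ?MA (d n) id z) = tensor_map ?A (P n) ?NS (d n) id (?F (Suc n) z)"
    if z: "z \<in> carrier (tensor ?A (P (Suc n)) ?MA)" for n z
  proof (rule TM.tensor_hom_eqI[OF TN.T.is_group[of n] _ _ z])
    note dM = tensor_map_hom[OF TM.tensor_product_axioms TM.tensor_product_axioms d_id id_linear[OF M]]
    note dN = tensor_map_hom[OF TN.tensor_product_axioms TN.tensor_product_axioms d_id id_linear[OF N]]
    show "(\<lambda>z. ?F n (tensor_map ?A (P n) ?MA (d n) id z)) \<in> hom (tensor ?A (P (Suc n)) ?MA) (tensor ?A (P n) ?NS)"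
      using hom_compose[OF dM F_hom] by (simp add: comp_def)
    show "(\<lambda>z. tensor_map ?A (P n) ?NS (d n) id (?F (Suc n) z)) \<in> hom (tensor ?A (P (Suc n)) ?MA) (tensor ?A (P n) ?NS)"
      using hom_compose[OF F_hom dN] by (simp add: comp_def)
    fix x m assume x: "x \<in> carrier (P (Suc n))" and "m \<in> carrier ?MA"
    then have m: "m \<in> carrier M" by simp
    show "?F n (tensor_map ?A (P n) ?MA (d n) id (pure ?A (P (Suc n)) ?MA x m)) =
        tensor_map ?A (P n) ?NS (d n) id (?F (Suc n) (pure ?A (P (Suc n)) ?MA x m))"
      using tensor_map_pure[OF TM.tensor_product_axioms TM.tensor_product_axioms d_id id_linear[OF M], of x n m]
        tensor_map_pure[OF TN.tensor_product_axioms TN.tensor_product_axioms d_id id_linear[OF N], of x n "f m"]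
        x m fM by (simp add: F_pure)
  qed
  obtain w where w: "w \<in> tor_cycles ?A P d ?MA (Suc 0)"
    and X': "X = tor_boundaries ?A P d ?MA (Suc 0) #>\<^bsub>tensor ?A P1 ?MA\<^esub> w"
    using tor_carrier_cases[OF M X] .
  have wT: "w \<in> carrier (tensor ?A P1 ?MA)"
    using w by (simp add: tor_cycles_def kernel_def)
  have "?F (Suc 0) ` tor_boundaries ?A P d ?MA (Suc 0) \<subseteq> tor_boundaries ?A P d ?NS (Suc 0)"
    using F_d[of _ "Suc 0"] hom_in_carrier[OF F_hom] by (auto simp: tor_boundaries_def)
  then have map: "tor_map ?A P d ?NS f (Suc 0) X =
      tor_boundaries ?A P d ?NS (Suc 0) #>\<^bsub>tensor ?A P1 ?NS\<^esub> ?F (Suc 0) w"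
    unfolding X' tor_map_def
    by (intro quot_map_coset TM.T.is_group TN.T.is_group boundaries_subgroup[OF M]
        boundaries_subgroup[OF N] F_hom wT)
  have "?F 0 \<one>\<^bsub>tensor ?A P0 ?MA\<^esub> = \<one>\<^bsub>tensor ?A P0 ?NS\<^esub>"
    by (rule hom_one[OF F_hom TM.T.is_group TN.T.is_group])
  then have Fw: "?F (Suc 0) w \<in> tor_cycles ?A P d ?NS (Suc 0)"
    using w F_d[OF wT] hom_in_carrier[OF F_hom wT] by (simp add: tor_cycles_def kernel_def)
  have "tensor_map (op_ring R) C N c id (?F (Suc 0) w) =
      tensor_map (op_ring R) C N id f (tensor_map (op_ring R) C M c id w)"
  proof (rule TM.tensor_hom_eqI[OF CN.T.is_group _ _ wT])
    show "(\<lambda>w. tensor_map (op_ring R) C N c id (?F (Suc 0) w)) \<in> hom (tensor ?A P1 ?MA) CN.T"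
      using hom_compose[OF F_hom \<gamma>_hom[OF N]] by (simp add: comp_def)
    note fC = tensor_map_hom[OF CM.tensor_product_axioms CN.tensor_product_axioms idC f]
    show "(\<lambda>w. tensor_map (op_ring R) C N id f (tensor_map (op_ring R) C M c id w)) \<in> hom (tensor ?A P1 ?MA) CN.T"
      using hom_compose[OF \<gamma>_hom[OF M] fC] by (simp add: comp_def)
    fix x m assume x: "x \<in> carrier P1" and "m \<in> carrier ?MA"
    then have m: "m \<in> carrier M" by simp
    show "tensor_map (op_ring R) C N c id (?F (Suc 0) (pure ?A P1 ?MA x m)) =
        tensor_map (op_ring R) C N id f (tensor_map (op_ring R) C M c id (pure ?A P1 ?MA x m))"
      using tensor_map_pure[OF CM.tensor_product_axioms CN.tensor_product_axioms idC f, of "c x" m]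
        x m fM c_closed[OF x] by (simp add: F_pure \<gamma>_pure[OF M] \<gamma>_pure[OF N])
  qed
  then show ?thesis
    unfolding map unfolding X' tor_iso_coset[OF M w] tor_iso_coset[OF N Fw] .
qed

lemma tor_naturally_isomorphic:
  "naturally_isomorphic (op_ring R)
    (\<lambda>M :: ('b, 'm) module. tor (op_ring S) P d (restrict_scalars h M) 1)
    (\<lambda>M N f. tor_map (op_ring S) P d (restrict_scalars h N) f 1)
    (\<lambda>M. tensor (op_ring R) C M) (\<lambda>M N f. tensor_map (op_ring R) C N id f)"
  unfolding naturally_isomorphic_def One_nat_def
proof (intro exI conjI allI impI ballI)
  show "tor_iso M \<in> iso (tor (op_ring S) P d (restrict_scalars h M) (Suc 0)) (tensor (op_ring R) C M)"
    if "left_module (op_ring R) M" for M :: "('b, 'm) module"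
    using that by (rule tor_iso_iso)
  show "tor_iso N (tor_map (op_ring S) P d (restrict_scalars h N) f (Suc 0) X) =
      tensor_map (op_ring R) C N id f (tor_iso M X)"
    if "left_module (op_ring R) M" "left_module (op_ring R) N" "f \<in> linear_maps (op_ring R) M N"
      "X \<in> carrier (tor (op_ring S) P d (restrict_scalars h M) (Suc 0))"
    for M N :: "('b, 'm) module" and f X
    using that by (rule tor_iso_natural)
qed

end

section \<open>Comparison with a projective resolution\<close>

lemma projective_resolutionD:
  assumes "projective_resolution R N P d \<epsilon>"
  shows "left_module R N" "projective_module R (P n)" "left_module R (P n)"
    "d n \<in> linear_maps R (P (Suc n)) (P n)" "\<epsilon> \<in> linear_maps R (P 0) N"
    "\<epsilon> ` carrier (P 0) = carrier N"
    "{x \<in> carrier (P 0). \<epsilon> x = \<zero>\<^bsub>N\<^esub>} = d 0 ` carrier (P (Suc 0))"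
    "{x \<in> carrier (P (Suc n)). d n x = \<zero>\<^bsub>P n\<^esub>} = d (Suc n) ` carrier (P (Suc (Suc n)))"
  using assms by (simp_all add: projective_resolution_def projective_module_def)

text \<open>\<open>s\<close> is the lift of \<open>\<epsilon>\<close> along \<open>h\<close>. From
  \<open>\<epsilon> (s x p) = h (s x) \<epsilon> p = \<epsilon> x\<close> it follows that
  \<open>x - s x p\<close> lies in the kernel of \<open>\<epsilon>\<close>, the image of
  \<open>d 0\<close>; lifting this map along \<open>d 0\<close> gives \<open>H\<close>.\<close>

lemma (in surjective_ring_hom) conormal_comparison_exists:
  assumes res: "projective_resolution S (restrict_scalars h (self_module R)) P d \<epsilon>"
  obtains s p H where "conormal_comparison S R h P d s p H"
proof -
  let ?N = "restrict_scalars h (self_module R)"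
  note D = projective_resolutionD[OF res]
  interpret P0: left_module S "P 0" by (rule D(3))
  interpret N: left_module S ?N by (rule D(1))
  have \<epsilon>: "\<epsilon> x \<in> carrier R" if "x \<in> carrier (P 0)" for x using linear_closed[OF D(5) that] by simp
  have "h \<in> linear_maps S (self_module S) ?N" by (rule linear_mapsI) simp_all
  moreover have "\<epsilon> ` carrier (P 0) \<subseteq> h ` carrier (self_module S)" using D(6) surj by simp
  ultimately obtain s where s: "s \<in> linear_maps S (P 0) (self_module S)"
    and hs: "\<And>x. x \<in> carrier (P 0) \<Longrightarrow> h (s x) = \<epsilon> x"
    using projective_module_lift[OF D(2) left_module_self[OF S.ring_axioms] D(1) _ D(5)] by blast
  have "\<one>\<^bsub>R\<^esub> \<in> \<epsilon> ` carrier (P 0)" using D(6) by simp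
  then obtain p where p: "p \<in> carrier (P 0)" "\<epsilon> p = \<one>\<^bsub>R\<^esub>" by auto
  have \<epsilon>_smult: "\<epsilon> (a \<odot>\<^bsub>P 0\<^esub> p) = h a" if "a \<in> carrier S" for a
    using linear_smult[OF D(5) that p(1)] p that by simp
  have sS: "s x \<in> carrier S" if "x \<in> carrier (P 0)" for x using linear_closed[OF s that] by simp
  have sp: "(\<lambda>x. s x \<odot>\<^bsub>P 0\<^esub> p) \<in> linear_maps S (P 0) (P 0)"
    using linear_mapsD[OF s] p(1)
    by (intro linear_mapsI) (simp_all add: P0.smult_closed P0.smult_l_distr P0.smult_assoc)
  have "(\<lambda>x. x) \<in> linear_maps S (P 0) (P 0)" by (rule linear_mapsI) simp_all
  then have g: "(\<lambda>x. x \<ominus>\<^bsub>P 0\<^esub> s x \<odot>\<^bsub>P 0\<^esub> p) \<in> linear_maps S (P 0) (P 0)"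
    by (rule linear_maps_minus[OF D(3) _ sp])
  have "\<epsilon> (x \<ominus>\<^bsub>P 0\<^esub> s x \<odot>\<^bsub>P 0\<^esub> p) = \<zero>\<^bsub>?N\<^esub>" if x: "x \<in> carrier (P 0)" for x
  proof -
    have "\<epsilon> (x \<ominus>\<^bsub>P 0\<^esub> s x \<odot>\<^bsub>P 0\<^esub> p) = \<epsilon> x \<ominus>\<^bsub>?N\<^esub> \<epsilon> (s x \<odot>\<^bsub>P 0\<^esub> p)"
      by (rule linear_minus[OF P0.M.abelian_group_axioms N.M.abelian_group_axioms D(5) x
            linear_closed[OF sp x]])
    also have "\<dots> = \<epsilon> x \<ominus>\<^bsub>?N\<^esub> \<epsilon> x" by (simp only: \<epsilon>_smult[OF sS[OF x]] hs[OF x])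
    also have "\<dots> = \<zero>\<^bsub>?N\<^esub>"
      unfolding a_minus_def by (rule N.M.r_neg[OF linear_closed[OF D(5) x]])
    finally show ?thesis .
  qed
  then have "(\<lambda>x. x \<ominus>\<^bsub>P 0\<^esub> s x \<odot>\<^bsub>P 0\<^esub> p) ` carrier (P 0) \<subseteq> d 0 ` carrier (P (Suc 0))"
    using linear_closed[OF g] unfolding D(7)[symmetric] by blast
  then obtain H where H: "H \<in> linear_maps S (P 0) (P (Suc 0))"
    and dH: "\<And>x. x \<in> carrier (P 0) \<Longrightarrow> d 0 (H x) = x \<ominus>\<^bsub>P 0\<^esub> s x \<odot>\<^bsub>P 0\<^esub> p"
    using projective_module_lift[OF D(2) D(3) D(3) D(4) g] by blast
  have \<epsilon>d: "\<epsilon> (d 0 y) = \<zero>\<^bsub>R\<^esub>" if "y \<in> carrier (P (Suc 0))" for y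
    using D(7) that by auto
  have lift: "\<exists>y\<in>carrier (P (Suc 0)). d 0 y = k \<odot>\<^bsub>P 0\<^esub> p" if "k \<in> K" for k
  proof -
    have k: "k \<in> carrier S" "h k = \<zero>\<^bsub>R\<^esub>" using that by (simp_all only: K_iff)
    then have "k \<odot>\<^bsub>P 0\<^esub> p \<in> {x \<in> carrier (P 0). \<epsilon> x = \<zero>\<^bsub>?N\<^esub>}"
      using \<epsilon>_smult[OF k(1)] P0.smult_closed p by simp
    then show ?thesis unfolding D(7) by (auto simp: image_iff)
  qed
  have "conormal_comparison S R h P d s p H"
    by (intro conormal_comparison.intro conormal_comparison_axioms.intro surjective_ring_hom_axioms
        D(3) D(4) D(8) s p(1) lift H dH)
      (simp_all add: hs p \<epsilon>d linear_closed[OF D(4)])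
  then show thesis by (rule that)
qed

text \<open>
  If \<open>R\<close> is a module over \<open>S\<close> through \<open>h\<close>, then evaluating the module axioms at \<open>1\<close> shows that \<open>h\<close> is
  a ring homomorphism.
\<close>

lemma surjective_ring_hom_of_module:
  assumes mod: "left_module S (restrict_scalars h (self_module R))"
    and surj: "h ` carrier S = carrier R" and one: "h \<one>\<^bsub>S\<^esub> = \<one>\<^bsub>R\<^esub>"
    and assoc: "\<And>x y z. \<lbrakk>x \<in> carrier R; y \<in> carrier R; z \<in> carrier R\<rbrakk>
      \<Longrightarrow> (x \<otimes>\<^bsub>R\<^esub> y) \<otimes>\<^bsub>R\<^esub> z = x \<otimes>\<^bsub>R\<^esub> (y \<otimes>\<^bsub>R\<^esub> z)"
    and l_one: "\<And>x. x \<in> carrier R \<Longrightarrow> \<one>\<^bsub>R\<^esub> \<otimes>\<^bsub>R\<^esub> x = x"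
    and r_one: "\<And>x. x \<in> carrier R \<Longrightarrow> x \<otimes>\<^bsub>R\<^esub> \<one>\<^bsub>R\<^esub> = x"
  shows "surjective_ring_hom S R h"
proof -
  interpret N: left_module S "restrict_scalars h (self_module R)" by (rule mod)
  have ab: "abelian_group R"
    by (rule abelian_group_cong[OF N.M.abelian_group_axioms]) (simp_all add: self_module_def)
  have closed: "h a \<in> carrier R" if "a \<in> carrier S" for a using surj that by blast
  have oneR: "\<one>\<^bsub>R\<^esub> \<in> carrier R" using closed[OF N.R.one_closed] one by simp
  have pre: "\<exists>a\<in>carrier S. r = h a" if "r \<in> carrier R" for r using that unfolding surj[symmetric] by auto
  have add: "h (a \<oplus>\<^bsub>S\<^esub> b) = h a \<oplus>\<^bsub>R\<^esub> h b" if "a \<in> carrier S" "b \<in> carrier S" for a b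
    using N.smult_l_distr[OF that, of "\<one>\<^bsub>R\<^esub>"] that oneR closed by (simp add: r_one)
  have mult: "h (a \<otimes>\<^bsub>S\<^esub> b) = h a \<otimes>\<^bsub>R\<^esub> h b" if "a \<in> carrier S" "b \<in> carrier S" for a b
    using N.smult_assoc[OF that, of "\<one>\<^bsub>R\<^esub>"] that oneR closed by (simp add: r_one)
  have "monoid R"
  proof (rule monoidI)
    fix x y assume "x \<in> carrier R" "y \<in> carrier R"
    then show "x \<otimes>\<^bsub>R\<^esub> y \<in> carrier R"
      using pre[of x] N.smult_closed[of _ y] by auto
  qed (simp_all add: oneR assoc l_one r_one)
  then have "ring R"
  proof (rule ringI[OF ab])
    fix x y z assume xyz: "x \<in> carrier R" "y \<in> carrier R" "z \<in> carrier R"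
    obtain a b c where abc: "a \<in> carrier S" "x = h a" "b \<in> carrier S" "y = h b" "c \<in> carrier S" "z = h c"
      using pre xyz by metis
    show "(x \<oplus>\<^bsub>R\<^esub> y) \<otimes>\<^bsub>R\<^esub> z = x \<otimes>\<^bsub>R\<^esub> z \<oplus>\<^bsub>R\<^esub> y \<otimes>\<^bsub>R\<^esub> z"
      using N.smult_l_distr[of a b z] abc xyz by (simp add: add)
    show "z \<otimes>\<^bsub>R\<^esub> (x \<oplus>\<^bsub>R\<^esub> y) = z \<otimes>\<^bsub>R\<^esub> x \<oplus>\<^bsub>R\<^esub> z \<otimes>\<^bsub>R\<^esub> y"
      using N.smult_r_distr[of c x y] abc xyz by simp
  qed
  moreover have "h \<in> ring_hom S R" by (rule ring_hom_memI) (simp_all add: closed add mult one)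
  ultimately show ?thesis
    using surj N.R.ring_axioms by (simp add: surjective_ring_hom_def surjective_ring_hom_axioms_def)
qed


section \<open>The regular representation\<close>

context ternary_gamma_ring
begin

abbreviation quad_group where "quad_group \<equiv> free_Abelian_group (quads T \<Gamma>)"
abbreviation FQ where "FQ \<equiv> quad_ring T \<Gamma> tp"
abbreviation N where "N \<equiv> quad_null T \<Gamma> tp"
abbreviation F where "F \<equiv> tensor_ring T \<Gamma> tp"
abbreviation J where "J \<equiv> J_ideal T \<Gamma> tp"
abbreviation act where "act \<equiv> quad_action T tp"

section \<open>Formal sums of quadruples acting on \<open>T\<close>\<close>

definition quad_apply :: "('t, 'g) quad \<Rightarrow> 't \<Rightarrow> 't" where
  "quad_apply q x = (case q of (a, \<alpha>, b, \<beta>) \<Rightarrow> tp a \<alpha> b \<beta> x)"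

lemma quad_apply_closed: "\<lbrakk>q \<in> quads T \<Gamma>; x \<in> carrier T\<rbrakk> \<Longrightarrow> quad_apply q x \<in> carrier T"
  by (auto simp: quad_apply_def quads_def tp_closed)

lemma quad_multiple_closed:
  "\<lbrakk>q \<in> quads T \<Gamma>; x \<in> carrier T\<rbrakk> \<Longrightarrow> add_pow T (n :: int) (quad_apply q x) \<in> carrier T"
  using group.int_pow_closed[OF T.a_group, of "quad_apply q x" n] quad_apply_closed[of q x]
  by (simp add: add_pow_def)

lemma quad_mult_closed: "\<lbrakk>q \<in> quads T \<Gamma>; r \<in> quads T \<Gamma>\<rbrakk> \<Longrightarrow> quad_mult tp q r \<in> quads T \<Gamma>"
  by (auto simp: quads_def tp_closed)

text \<open>The inner product is moved from the first position to the last by way of the middle one,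
  so both associativity laws enter.\<close>

lemma quad_apply_mult:
  "\<lbrakk>q \<in> quads T \<Gamma>; r \<in> quads T \<Gamma>; x \<in> carrier T\<rbrakk>
    \<Longrightarrow> quad_apply (quad_mult tp q r) x = quad_apply q (quad_apply r x)"
  by (auto simp: quads_def quad_apply_def tp_assoc_12 tp_assoc_23)

lemma act_superset:
  assumes "finite D" "Poly_Mapping.keys c \<subseteq> D" "D \<subseteq> quads T \<Gamma>" "x \<in> carrier T"
  shows "act c x = (\<Oplus>\<^bsub>T\<^esub>q\<in>D. add_pow T (Poly_Mapping.lookup c q) (quad_apply q x))"
proof -
  have cl: "add_pow T n (quad_apply q x) \<in> carrier T" if "q \<in> D" for q and n :: int
    using subsetD[OF assms(3) that] assms(4) by (rule quad_multiple_closed)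
  have "(\<Oplus>\<^bsub>T\<^esub>q\<in>Poly_Mapping.keys c. add_pow T (Poly_Mapping.lookup c q) (quad_apply q x)) =
      (\<Oplus>\<^bsub>T\<^esub>q\<in>D. add_pow T (Poly_Mapping.lookup c q) (quad_apply q x))"
    using assms cl by (intro T.add.finprod_mono_neutral_cong_left) (auto simp: in_keys_iff add_pow_def)
  then show ?thesis using assms(4) by (simp add: quad_action_def quad_apply_def)
qed

lemma act_closed: "\<lbrakk>Poly_Mapping.keys c \<subseteq> quads T \<Gamma>; x \<in> carrier T\<rbrakk> \<Longrightarrow> act c x \<in> carrier T"
  by (subst act_superset[of "Poly_Mapping.keys c"])
    (auto intro!: T.finsum_closed quad_multiple_closed)

lemma act_add:
  assumes c: "Poly_Mapping.keys c \<subseteq> quads T \<Gamma>" and d: "Poly_Mapping.keys d \<subseteq> quads T \<Gamma>"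
    and x: "x \<in> carrier T"
  shows "act (c + d) x = act c x \<oplus>\<^bsub>T\<^esub> act d x"
proof -
  let ?D = "Poly_Mapping.keys c \<union> Poly_Mapping.keys d"
  have D: "finite ?D" "?D \<subseteq> quads T \<Gamma>" using c d by auto
  have cl: "(\<lambda>q. add_pow T (Poly_Mapping.lookup b q) (quad_apply q x)) \<in> ?D \<rightarrow> carrier T"
    for b :: "('t, 'g) quad \<Rightarrow>\<^sub>0 int"
    by (rule Pi_I) (rule quad_multiple_closed[OF subsetD[OF D(2)] x])
  have "act (c + d) x = (\<Oplus>\<^bsub>T\<^esub>q\<in>?D. add_pow T (Poly_Mapping.lookup (c + d) q) (quad_apply q x))"
    using D x keys_add[of c d] by (intro act_superset)
  also have "\<dots> = (\<Oplus>\<^bsub>T\<^esub>q\<in>?D. add_pow T (Poly_Mapping.lookup c q) (quad_apply q x) \<oplus>\<^bsub>T\<^esub>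
      add_pow T (Poly_Mapping.lookup d q) (quad_apply q x))"
    using D(2) x cl[of c] cl[of d]
    by (intro T.finsum_cong') (auto simp: lookup_add quad_apply_closed subset_iff T.add.int_pow_mult)
  also have "\<dots> = act c x \<oplus>\<^bsub>T\<^esub> act d x"
    using cl[of c] cl[of d] D x by (simp add: T.finsum_addf act_superset[of ?D])
  finally show ?thesis .
qed

lemma act_frag_of: "\<lbrakk>q \<in> quads T \<Gamma>; x \<in> carrier T\<rbrakk> \<Longrightarrow> act (frag_of q) x = quad_apply q x"
  by (subst act_superset[of "{q}"]) (auto simp: quad_apply_closed T.add.int_pow_1)

lemma act_hom: "x \<in> carrier T \<Longrightarrow> (\<lambda>c. act c x) \<in> hom quad_group (add_monoid T)"
  by (rule homI) (simp_all add: act_closed act_add)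

lemma act_group_hom: "x \<in> carrier T \<Longrightarrow> group_hom quad_group (add_monoid T) (\<lambda>c. act c x)"
  using act_hom T.a_group by (simp add: group_hom_def group_hom_axioms_def group_free_Abelian_group)

lemma act_zero: "x \<in> carrier T \<Longrightarrow> act 0 x = \<zero>\<^bsub>T\<^esub>"
  by (simp add: quad_action_def)

lemma act_diff:
  assumes "Poly_Mapping.keys c \<subseteq> quads T \<Gamma>" "Poly_Mapping.keys d \<subseteq> quads T \<Gamma>" "x \<in> carrier T"
  shows "act (c - d) x = act c x \<ominus>\<^bsub>T\<^esub> act d x"
proof -
  interpret act: group_hom quad_group "add_monoid T" "\<lambda>c. act c x" by (rule act_group_hom[OF assms(3)])
  have "act (- d) x = \<ominus>\<^bsub>T\<^esub> act d x" using act.hom_inv[of d] assms(2) by (simp add: a_inv_def)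
  then show ?thesis using act_add[of c "- d" x] assms by (simp add: a_minus_def)
qed

lemma act_add_right:
  assumes c: "Poly_Mapping.keys c \<subseteq> quads T \<Gamma>" and x: "x \<in> carrier T" "y \<in> carrier T"
  shows "act c (x \<oplus>\<^bsub>T\<^esub> y) = act c x \<oplus>\<^bsub>T\<^esub> act c y"
proof (rule free_Abelian_group_induct[OF c, where P = "\<lambda>c. act c (x \<oplus>\<^bsub>T\<^esub> y) = act c x \<oplus>\<^bsub>T\<^esub> act c y"])
  show "act 0 (x \<oplus>\<^bsub>T\<^esub> y) = act 0 x \<oplus>\<^bsub>T\<^esub> act 0 y" using x by (simp add: act_zero)
next
  fix c d assume "Poly_Mapping.keys c \<subseteq> quads T \<Gamma>" "Poly_Mapping.keys d \<subseteq> quads T \<Gamma>"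
    and "act c (x \<oplus>\<^bsub>T\<^esub> y) = act c x \<oplus>\<^bsub>T\<^esub> act c y" "act d (x \<oplus>\<^bsub>T\<^esub> y) = act d x \<oplus>\<^bsub>T\<^esub> act d y"
  then show "act (c - d) (x \<oplus>\<^bsub>T\<^esub> y) = act (c - d) x \<oplus>\<^bsub>T\<^esub> act (c - d) y"
    using x by (simp add: act_diff act_closed a_minus_def T.minus_add T.a_ac)
next
  fix q assume "q \<in> quads T \<Gamma>"
  then show "act (frag_of q) (x \<oplus>\<^bsub>T\<^esub> y) = act (frag_of q) x \<oplus>\<^bsub>T\<^esub> act (frag_of q) y"
    using x by (auto simp: act_frag_of quad_apply_def quads_def tp_add_5)
qed

lemma act_zero_right:
  assumes c: "Poly_Mapping.keys c \<subseteq> quads T \<Gamma>"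
  shows "act c \<zero>\<^bsub>T\<^esub> = \<zero>\<^bsub>T\<^esub>"
  using act_add_right[OF c, of "\<zero>\<^bsub>T\<^esub>" "\<zero>\<^bsub>T\<^esub>"] act_closed[OF c, of "\<zero>\<^bsub>T\<^esub>"] T.add.l_cancel_one[of "act c \<zero>\<^bsub>T\<^esub>" "act c \<zero>\<^bsub>T\<^esub>"]
  by simp

lemma FQ_simps [simp]:
  "c \<in> carrier FQ \<longleftrightarrow> Poly_Mapping.keys c \<subseteq> quads T \<Gamma>" "c \<oplus>\<^bsub>FQ\<^esub> d = c + d" "\<zero>\<^bsub>FQ\<^esub> = 0"
  by (simp_all add: quad_ring_def)

lemma FQ_mult: "c \<otimes>\<^bsub>FQ\<^esub> d = frag_extend (\<lambda>p. frag_extend (\<lambda>q. frag_of (quad_mult tp p q)) d) c"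
  by (simp add: quad_ring_def)

lemma FQ_mult_diff_left: "(c - c') \<otimes>\<^bsub>FQ\<^esub> d = c \<otimes>\<^bsub>FQ\<^esub> d - c' \<otimes>\<^bsub>FQ\<^esub> d"
  by (simp add: FQ_mult frag_extend_diff)

text \<open>On this side the difference sits inside the function that \<open>frag_extend\<close>
  extends, so additivity of \<open>frag_extend\<close> in that function is needed besides additivity
  in its argument.\<close>

lemma FQ_mult_diff_right: "c \<otimes>\<^bsub>FQ\<^esub> (d - d') = c \<otimes>\<^bsub>FQ\<^esub> d - c \<otimes>\<^bsub>FQ\<^esub> d'"
proof -
  have cmul: "frag_cmul k (a - b) = frag_cmul k a - frag_cmul k b" for k and a b :: "('t, 'g) quad \<Rightarrow>\<^sub>0 int"
    by (rule poly_mapping_eqI) (simp add: lookup_minus right_diff_distrib)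
  have "frag_extend (\<lambda>p. f p - g p) c = frag_extend f c - frag_extend g c"
    for f g :: "('t, 'g) quad \<Rightarrow> ('t, 'g) quad \<Rightarrow>\<^sub>0 int"
    by (simp add: frag_extend_def cmul sum_subtractf)
  then show ?thesis by (simp add: FQ_mult frag_extend_diff)
qed

lemma FQ_mult_frag_of: "frag_of p \<otimes>\<^bsub>FQ\<^esub> frag_of q = frag_of (quad_mult tp p q)"
  by (simp add: FQ_mult)

lemma FQ_mult_zero: "0 \<otimes>\<^bsub>FQ\<^esub> d = 0" "c \<otimes>\<^bsub>FQ\<^esub> 0 = 0"
  by (simp_all add: FQ_mult frag_extend_eq_0)

lemma FQ_diff_closed: "\<lbrakk>c \<in> carrier FQ; d \<in> carrier FQ\<rbrakk> \<Longrightarrow> c - d \<in> carrier FQ"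
  using keys_diff[of c d] by auto

lemma FQ_mult_closed:
  assumes "c \<in> carrier FQ" "d \<in> carrier FQ"
  shows "c \<otimes>\<^bsub>FQ\<^esub> d \<in> carrier FQ"
proof -
  have "Poly_Mapping.keys (frag_extend (\<lambda>q. frag_of (quad_mult tp p q)) d) \<subseteq> quads T \<Gamma>"
    if "p \<in> quads T \<Gamma>" for p
  proof (intro order_trans[OF keys_frag_extend] UN_least)
    fix q assume "q \<in> Poly_Mapping.keys d"
    then have "quad_mult tp p q \<in> quads T \<Gamma>" using assms(2) that by (intro quad_mult_closed) auto
    then show "Poly_Mapping.keys (frag_of (quad_mult tp p q)) \<subseteq> quads T \<Gamma>" by simp
  qed
  then show ?thesis
    using assms(1) unfolding FQ_simps FQ_mult
    by (intro order_trans[OF keys_frag_extend]) blast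
qed

text \<open>Induction on both formal sums reduces the claim to single quadruples. The inner
  induction rests on the additivity of the action of \<open>p\<close> in its argument, that is, on
  the fifth variable of the ternary product.\<close>

lemma act_mult:
  assumes c: "Poly_Mapping.keys c \<subseteq> quads T \<Gamma>" and d: "Poly_Mapping.keys d \<subseteq> quads T \<Gamma>"
    and x: "x \<in> carrier T"
  shows "act (c \<otimes>\<^bsub>FQ\<^esub> d) x = act c (act d x)"
proof (rule free_Abelian_group_induct[OF c, where P = "\<lambda>c. act (c \<otimes>\<^bsub>FQ\<^esub> d) x = act c (act d x)"])
  show "act (0 \<otimes>\<^bsub>FQ\<^esub> d) x = act 0 (act d x)"
    using x d by (simp add: FQ_mult_zero act_zero act_closed)
next
  fix b c assume "Poly_Mapping.keys b \<subseteq> quads T \<Gamma>" "Poly_Mapping.keys c \<subseteq> quads T \<Gamma>"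
    and "act (b \<otimes>\<^bsub>FQ\<^esub> d) x = act b (act d x)" "act (c \<otimes>\<^bsub>FQ\<^esub> d) x = act c (act d x)"
  then show "act ((b - c) \<otimes>\<^bsub>FQ\<^esub> d) x = act (b - c) (act d x)"
    using x d FQ_mult_closed[of b d] FQ_mult_closed[of c d]
    by (simp add: FQ_mult_diff_left act_diff act_closed)
next
  fix p assume p: "p \<in> quads T \<Gamma>"
  show "act (frag_of p \<otimes>\<^bsub>FQ\<^esub> d) x = act (frag_of p) (act d x)"
  proof (rule free_Abelian_group_induct[OF d, where
        P = "\<lambda>d. act (frag_of p \<otimes>\<^bsub>FQ\<^esub> d) x = act (frag_of p) (act d x)"])
    show "act (frag_of p \<otimes>\<^bsub>FQ\<^esub> 0) x = act (frag_of p) (act 0 x)"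
      using p x by (simp add: FQ_mult_zero act_zero act_zero_right)
  next
    fix b c assume bc: "Poly_Mapping.keys b \<subseteq> quads T \<Gamma>" "Poly_Mapping.keys c \<subseteq> quads T \<Gamma>"
      and IH: "act (frag_of p \<otimes>\<^bsub>FQ\<^esub> b) x = act (frag_of p) (act b x)"
        "act (frag_of p \<otimes>\<^bsub>FQ\<^esub> c) x = act (frag_of p) (act c x)"
    have cl: "act b x \<in> carrier T" "act c x \<in> carrier T" using bc x by (simp_all add: act_closed)
    have p': "Poly_Mapping.keys (frag_of p) \<subseteq> quads T \<Gamma>" using p by simp
    have "act (frag_of p) (act b x \<ominus>\<^bsub>T\<^esub> act c x) \<oplus>\<^bsub>T\<^esub> act (frag_of p) (act c x) =
        act (frag_of p) ((act b x \<ominus>\<^bsub>T\<^esub> act c x) \<oplus>\<^bsub>T\<^esub> act c x)"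
      using cl by (simp add: act_add_right[OF p'])
    also have "(act b x \<ominus>\<^bsub>T\<^esub> act c x) \<oplus>\<^bsub>T\<^esub> act c x = act b x"
      using cl by (simp add: a_minus_def T.a_assoc T.l_neg)
    finally have "act (frag_of p) (act b x \<ominus>\<^bsub>T\<^esub> act c x) =
        act (frag_of p) (act b x) \<ominus>\<^bsub>T\<^esub> act (frag_of p) (act c x)"
      using cl act_closed[OF p'] by (metis T.minus_closed T.add.inv_solve_right' a_minus_def)
    then show "act (frag_of p \<otimes>\<^bsub>FQ\<^esub> (b - c)) x = act (frag_of p) (act (b - c) x)"
      using bc x p' IH FQ_mult_closed[of "frag_of p" b] FQ_mult_closed[of "frag_of p" c]
      by (simp add: FQ_mult_diff_right act_diff)
  next
    fix q assume "q \<in> quads T \<Gamma>"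
    then show "act (frag_of p \<otimes>\<^bsub>FQ\<^esub> frag_of q) x = act (frag_of p) (act (frag_of q) x)"
      using p x by (simp add: FQ_mult_frag_of act_frag_of quad_mult_closed quad_apply_mult quad_apply_closed)
  qed
qed

section \<open>The subgroup generated by the additivity relators\<close>

lemma add_monoid_FQ: "add_monoid FQ = quad_group"
  by (simp add: quad_ring_def free_Abelian_group_def)

lemma N_eq: "N = generate quad_group (quad_relators T \<Gamma>)"
  by (simp only: quad_null_def add_monoid_FQ)

lemma quad_relator_1: "\<lbrakk>a \<in> carrier T; a' \<in> carrier T; \<alpha> \<in> carrier \<Gamma>; b \<in> carrier T; \<beta> \<in> carrier \<Gamma>\<rbrakk> \<Longrightarrow>
    frag_of (a \<oplus>\<^bsub>T\<^esub> a', \<alpha>, b, \<beta>) - frag_of (a, \<alpha>, b, \<beta>) - frag_of (a', \<alpha>, b, \<beta>) \<in> quad_relators T \<Gamma>"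
  and quad_relator_2: "\<lbrakk>a \<in> carrier T; \<alpha> \<in> carrier \<Gamma>; \<alpha>' \<in> carrier \<Gamma>; b \<in> carrier T; \<beta> \<in> carrier \<Gamma>\<rbrakk> \<Longrightarrow>
    frag_of (a, \<alpha> \<oplus>\<^bsub>\<Gamma>\<^esub> \<alpha>', b, \<beta>) - frag_of (a, \<alpha>, b, \<beta>) - frag_of (a, \<alpha>', b, \<beta>) \<in> quad_relators T \<Gamma>"
  and quad_relator_3: "\<lbrakk>a \<in> carrier T; \<alpha> \<in> carrier \<Gamma>; b \<in> carrier T; b' \<in> carrier T; \<beta> \<in> carrier \<Gamma>\<rbrakk> \<Longrightarrow>
    frag_of (a, \<alpha>, b \<oplus>\<^bsub>T\<^esub> b', \<beta>) - frag_of (a, \<alpha>, b, \<beta>) - frag_of (a, \<alpha>, b', \<beta>) \<in> quad_relators T \<Gamma>"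
  and quad_relator_4: "\<lbrakk>a \<in> carrier T; \<alpha> \<in> carrier \<Gamma>; b \<in> carrier T; \<beta> \<in> carrier \<Gamma>; \<beta>' \<in> carrier \<Gamma>\<rbrakk> \<Longrightarrow>
    frag_of (a, \<alpha>, b, \<beta> \<oplus>\<^bsub>\<Gamma>\<^esub> \<beta>') - frag_of (a, \<alpha>, b, \<beta>) - frag_of (a, \<alpha>, b, \<beta>') \<in> quad_relators T \<Gamma>"
  unfolding quad_relators_def
  by (rule UnI1, rule UnI1, rule UnI1, intro CollectI exI conjI, rule refl, assumption+)
    (rule UnI1, rule UnI1, rule UnI2, intro CollectI exI conjI, rule refl, assumption+,
     rule UnI1, rule UnI2, intro CollectI exI conjI, rule refl, assumption+,
     rule UnI2, intro CollectI exI conjI, rule refl, assumption+)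

lemma quad_relator_cases:
  assumes "r \<in> quad_relators T \<Gamma>"
    and "\<And>a a' \<alpha> b \<beta>. \<lbrakk>a \<in> carrier T; a' \<in> carrier T; \<alpha> \<in> carrier \<Gamma>; b \<in> carrier T; \<beta> \<in> carrier \<Gamma>\<rbrakk> \<Longrightarrow>
      P (frag_of (a \<oplus>\<^bsub>T\<^esub> a', \<alpha>, b, \<beta>) - frag_of (a, \<alpha>, b, \<beta>) - frag_of (a', \<alpha>, b, \<beta>))"
    and "\<And>a \<alpha> \<alpha>' b \<beta>. \<lbrakk>a \<in> carrier T; \<alpha> \<in> carrier \<Gamma>; \<alpha>' \<in> carrier \<Gamma>; b \<in> carrier T; \<beta> \<in> carrier \<Gamma>\<rbrakk> \<Longrightarrow>
      P (frag_of (a, \<alpha> \<oplus>\<^bsub>\<Gamma>\<^esub> \<alpha>', b, \<beta>) - frag_of (a, \<alpha>, b, \<beta>) - frag_of (a, \<alpha>', b, \<beta>))"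
    and "\<And>a \<alpha> b b' \<beta>. \<lbrakk>a \<in> carrier T; \<alpha> \<in> carrier \<Gamma>; b \<in> carrier T; b' \<in> carrier T; \<beta> \<in> carrier \<Gamma>\<rbrakk> \<Longrightarrow>
      P (frag_of (a, \<alpha>, b \<oplus>\<^bsub>T\<^esub> b', \<beta>) - frag_of (a, \<alpha>, b, \<beta>) - frag_of (a, \<alpha>, b', \<beta>))"
    and "\<And>a \<alpha> b \<beta> \<beta>'. \<lbrakk>a \<in> carrier T; \<alpha> \<in> carrier \<Gamma>; b \<in> carrier T; \<beta> \<in> carrier \<Gamma>; \<beta>' \<in> carrier \<Gamma>\<rbrakk> \<Longrightarrow>
      P (frag_of (a, \<alpha>, b, \<beta> \<oplus>\<^bsub>\<Gamma>\<^esub> \<beta>') - frag_of (a, \<alpha>, b, \<beta>) - frag_of (a, \<alpha>, b, \<beta>'))"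
  shows "P r"
  using assms(1) unfolding quad_relators_def
  by (elim UnE CollectE exE conjE) (simp_all only: assms(2-5))

lemma quad_relators_closed: "quad_relators T \<Gamma> \<subseteq> carrier quad_group"
proof
  fix r assume "r \<in> quad_relators T \<Gamma>"
  then have "r \<in> carrier FQ"
    by (rule quad_relator_cases[where P = "\<lambda>r. r \<in> carrier FQ"]) (intro FQ_diff_closed; simp add: quads_def)+
  then show "r \<in> carrier quad_group" by simp
qed

sublocale quad_group: comm_group quad_group by (rule abelian_free_Abelian_group)

lemma N_subgroup: "subgroup N quad_group"
  unfolding N_eq by (rule quad_group.generate_is_subgroup[OF quad_relators_closed])

lemma N_zero: "0 \<in> N"
  using subgroup.one_closed[OF N_subgroup] by simp

lemma N_closed: "c \<in> N \<Longrightarrow> Poly_Mapping.keys c \<subseteq> quads T \<Gamma>"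
  using subgroup.mem_carrier[OF N_subgroup] by simp

lemma N_add: "\<lbrakk>c \<in> N; d \<in> N\<rbrakk> \<Longrightarrow> c + d \<in> N"
  using subgroup.m_closed[OF N_subgroup] by simp

lemma N_diff: "\<lbrakk>c \<in> N; d \<in> N\<rbrakk> \<Longrightarrow> c - d \<in> N"
  using N_add[of c "- d"] subgroup.m_inv_closed[OF N_subgroup, of d] N_closed[of d] by simp

text \<open>Closure under differences subsumes the other generation steps: the inverse of a relator
  \<open>r\<close> is \<open>0 - r\<close>, and a sum is \<open>c - (0 - d)\<close>.\<close>

lemma N_induct [consumes 1, case_names zero relator diff]:
  assumes "c \<in> N" "P 0" "\<And>r. r \<in> quad_relators T \<Gamma> \<Longrightarrow> P r"
    and diff: "\<And>c d. \<lbrakk>c \<in> N; d \<in> N; P c; P d\<rbrakk> \<Longrightarrow> P (c - d)"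
  shows "P c"
  using assms(1) unfolding N_eq
proof (induction rule: generate.induct)
  case (inv r)
  then have r: "r \<in> N" unfolding N_eq by (rule generate.incl)
  have "P (0 - r)" by (rule diff[OF N_zero r assms(2) assms(3)[OF inv]])
  with r show ?case using N_closed[of r] by simp
next
  case (eng c d)
  then have cd: "c \<in> N" "d \<in> N" unfolding N_eq by simp_all
  have "P (c - (0 - d))"
    using diff[OF cd(1) N_diff[OF N_zero cd(2)] eng.IH(1) diff[OF N_zero cd(2) assms(2) eng.IH(2)]] .
  then show ?case by simp
qed (use assms in auto)

text \<open>Each of the four kinds of relators acts by zero because the ternary product is additive
  in the corresponding variable.\<close>

lemma act_N:
  assumes "c \<in> N" and x: "x \<in> carrier T"
  shows "act c x = \<zero>\<^bsub>T\<^esub>"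
  using assms(1)
proof (induction rule: N_induct)
  case zero
  then show ?case using x by (rule act_zero)
next
  case (relator r)
  have rel: "act (frag_of u - frag_of v - frag_of w) x = \<zero>\<^bsub>T\<^esub>"
    if "u \<in> quads T \<Gamma>" "v \<in> quads T \<Gamma>" "w \<in> quads T \<Gamma>"
      "quad_apply u x = quad_apply v x \<oplus>\<^bsub>T\<^esub> quad_apply w x" for u v w
  proof -
    have vw: "quad_apply v x \<in> carrier T" "quad_apply w x \<in> carrier T"
      using that x by (simp_all add: quad_apply_closed)
    have "act (frag_of u - frag_of v - frag_of w) x =
        quad_apply w x \<oplus>\<^bsub>T\<^esub> quad_apply v x \<ominus>\<^bsub>T\<^esub> quad_apply v x \<ominus>\<^bsub>T\<^esub> quad_apply w x"
      using that x FQ_diff_closed[of "frag_of u" "frag_of v"] T.a_comm[OF vw]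
      by (simp add: act_diff act_frag_of)
    also have "\<dots> = \<zero>\<^bsub>T\<^esub>" using vw by (simp add: a_minus_def T.a_assoc T.r_neg)
    finally show ?thesis .
  qed
  from relator show ?case
    by (rule quad_relator_cases[where P = "\<lambda>r. act r x = \<zero>\<^bsub>T\<^esub>"])
      (rule rel; use x in \<open>simp add: quads_def quad_apply_def tp_add_1 tp_add_2 tp_add_3 tp_add_4\<close>)+
next
  case (diff c d)
  then show ?case using x by (simp add: act_diff N_closed a_minus_def T.r_neg)
qed

text \<open>Multiplication by a quadruple on the right absorbs all four entries of the left factor
  into the first entry of the product. Relators of every kind therefore become relators of the first
  kind.\<close>

lemma N_mult_right:
  assumes c: "c \<in> N" and d: "Poly_Mapping.keys d \<subseteq> quads T \<Gamma>"
  shows "c \<otimes>\<^bsub>FQ\<^esub> d \<in> N"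
proof (rule free_Abelian_group_induct[OF d, where P = "\<lambda>d. c \<otimes>\<^bsub>FQ\<^esub> d \<in> N"])
  fix q assume "q \<in> quads T \<Gamma>"
  then obtain u \<gamma> v \<delta> where q: "q = (u, \<gamma>, v, \<delta>)"
    and cl: "u \<in> carrier T" "\<gamma> \<in> carrier \<Gamma>" "v \<in> carrier T" "\<delta> \<in> carrier \<Gamma>"
    by (auto simp: quads_def)
  show "c \<otimes>\<^bsub>FQ\<^esub> frag_of q \<in> N"
    using c
  proof (induction rule: N_induct)
    case (relator r)
    have "r \<otimes>\<^bsub>FQ\<^esub> frag_of q \<in> quad_relators T \<Gamma>"
      using relator
      by (rule quad_relator_cases[where P = "\<lambda>r. r \<otimes>\<^bsub>FQ\<^esub> frag_of q \<in> quad_relators T \<Gamma>"])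
        (simp_all add: FQ_mult_diff_left FQ_mult_frag_of q cl tp_add_1 tp_add_2 tp_add_3 tp_add_4
          quad_relator_1 tp_closed)
    then show ?case unfolding N_eq by (rule generate.incl)
  qed (simp_all add: FQ_mult_zero FQ_mult_diff_left N_zero N_diff)
qed (simp_all add: FQ_mult_zero FQ_mult_diff_right N_zero N_diff)

text \<open>Here each relator keeps its kind: only the first entry changes, and it does so
  additively by the fifth variable of the ternary product.\<close>

lemma N_mult_left:
  assumes c: "c \<in> N" and d: "Poly_Mapping.keys d \<subseteq> quads T \<Gamma>"
  shows "d \<otimes>\<^bsub>FQ\<^esub> c \<in> N"
proof (rule free_Abelian_group_induct[OF d, where P = "\<lambda>d. d \<otimes>\<^bsub>FQ\<^esub> c \<in> N"])
  fix q assume "q \<in> quads T \<Gamma>"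
  then obtain u \<gamma> v \<delta> where q: "q = (u, \<gamma>, v, \<delta>)"
    and cl: "u \<in> carrier T" "\<gamma> \<in> carrier \<Gamma>" "v \<in> carrier T" "\<delta> \<in> carrier \<Gamma>"
    by (auto simp: quads_def)
  show "frag_of q \<otimes>\<^bsub>FQ\<^esub> c \<in> N"
    using c
  proof (induction rule: N_induct)
    case (relator r)
    have "frag_of q \<otimes>\<^bsub>FQ\<^esub> r \<in> quad_relators T \<Gamma>"
      using relator
      by (rule quad_relator_cases[where P = "\<lambda>r. frag_of q \<otimes>\<^bsub>FQ\<^esub> r \<in> quad_relators T \<Gamma>"])
        (simp_all add: FQ_mult_diff_right FQ_mult_frag_of q cl tp_add_5 tp_closed
          quad_relator_1 quad_relator_2 quad_relator_3 quad_relator_4)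
    then show ?case unfolding N_eq by (rule generate.incl)
  qed (simp_all add: FQ_mult_zero FQ_mult_diff_right N_zero N_diff)
qed (simp_all add: FQ_mult_zero FQ_mult_diff_left N_zero N_diff)


section \<open>The four-fold tensor product as a group of cosets\<close>

lemma a_r_coset_FQ: "N +>\<^bsub>FQ\<^esub> c = N #>\<^bsub>quad_group\<^esub> c"
  by (simp only: a_r_coset_def add_monoid_FQ)

lemma set_add_FQ: "set_add FQ = set_mult quad_group"
  by (simp only: set_add_def add_monoid_FQ)

lemma a_rcosets_FQ: "a_rcosets\<^bsub>FQ\<^esub> N = rcosets\<^bsub>quad_group\<^esub> N"
  by (simp only: A_RCOSETS_def add_monoid_FQ)

lemma coset_iff:
  "b \<in> N +>\<^bsub>FQ\<^esub> c \<longleftrightarrow> b - c \<in> N"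
proof -
  have "b \<in> N +>\<^bsub>FQ\<^esub> c \<longleftrightarrow> (\<exists>n\<in>N. b = n + c)" by (auto simp: a_r_coset_FQ r_coset_def)
  also have "\<dots> \<longleftrightarrow> b - c \<in> N" by (metis add_diff_cancel diff_add_cancel)
  finally show ?thesis .
qed

lemma coset_eq:
  assumes "b - c \<in> N" "c \<in> carrier FQ"
  shows "N +>\<^bsub>FQ\<^esub> b = N +>\<^bsub>FQ\<^esub> c"
proof -
  have "b \<in> N #>\<^bsub>quad_group\<^esub> c"
    using iffD2[OF coset_iff assms(1)] by (simp only: a_r_coset_FQ)
  moreover have "c \<in> carrier quad_group" using assms(2) by simp
  ultimately show ?thesis
    unfolding a_r_coset_FQ by (rule quad_group.repr_independence[symmetric, OF _ _ N_subgroup])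
qed

lemma add_monoid_F: "add_monoid F = quad_group Mod N"
  by (simp add: tensor_ring_def FactRing_def FactGroup_def set_add_FQ a_rcosets_FQ)

lemma carrier_F: "carrier F = (\<lambda>c. N +>\<^bsub>FQ\<^esub> c) ` carrier FQ"
proof -
  have "carrier F = carrier (add_monoid F)" by simp
  also have "\<dots> = (\<lambda>c. N #>\<^bsub>quad_group\<^esub> c) ` carrier quad_group"
    unfolding add_monoid_F by (rule carrier_FactGroup)
  also have "carrier quad_group = carrier FQ" by (simp add: quad_ring_def free_Abelian_group_def)
  finally show ?thesis by (simp only: a_r_coset_FQ)
qed

lemma F_cases:
  assumes "X \<in> carrier F"
  obtains c where "c \<in> carrier FQ" "X = N +>\<^bsub>FQ\<^esub> c"
  using assms unfolding carrier_F by (elim imageE) (rule that)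

lemma F_closed: "c \<in> carrier FQ \<Longrightarrow> N +>\<^bsub>FQ\<^esub> c \<in> carrier F"
  unfolding carrier_F by (rule imageI)

lemma F_zero: "\<zero>\<^bsub>F\<^esub> = N +>\<^bsub>FQ\<^esub> 0"
  using quad_group.coset_mult_one[OF subgroup.subset[OF N_subgroup]]
  by (simp add: tensor_ring_def FactRing_def a_r_coset_FQ)

lemma abelian_group_F: "abelian_group F"
  by (rule comm_group_abelian_groupI)
    (simp only: add_monoid_F quad_group.abelian_FactGroup[OF N_subgroup])

lemma F_add:
  assumes "c \<in> carrier FQ" "d \<in> carrier FQ"
  shows "(N +>\<^bsub>FQ\<^esub> c) \<oplus>\<^bsub>F\<^esub> (N +>\<^bsub>FQ\<^esub> d) = N +>\<^bsub>FQ\<^esub> (c + d)"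
proof -
  have "add F = set_mult quad_group"
    by (simp add: tensor_ring_def FactRing_def set_add_FQ)
  then show ?thesis
    using normal.rcos_sum[of N quad_group c d] quad_group.normal_iff_subgroup N_subgroup assms
    by (simp add: a_r_coset_FQ)
qed

lemma F_uminus:
  assumes c: "c \<in> carrier FQ"
  shows "\<ominus>\<^bsub>F\<^esub> (N +>\<^bsub>FQ\<^esub> c) = N +>\<^bsub>FQ\<^esub> (- c)"
proof -
  interpret F: abelian_group F by (rule abelian_group_F)
  have c': "- c \<in> carrier FQ" using c by simp
  show ?thesis
    using F_add[OF c' c]
    by (intro F.minus_equality F_closed[OF c] F_closed[OF c']) (simp add: F_zero)
qed

text \<open>For other representatives \<open>a\<close> and \<open>b\<close>, the decomposition
  \<open>a b - c d = (a - c) b + c (b - d)\<close> shows that the product changes by an element of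
  \<open>N\<close>.\<close>

lemma F_mult:
  assumes c: "c \<in> carrier FQ" and d: "d \<in> carrier FQ"
  shows "(N +>\<^bsub>FQ\<^esub> c) \<otimes>\<^bsub>F\<^esub> (N +>\<^bsub>FQ\<^esub> d) = N +>\<^bsub>FQ\<^esub> (c \<otimes>\<^bsub>FQ\<^esub> d)"
proof -
  have eq: "N +>\<^bsub>FQ\<^esub> (a \<otimes>\<^bsub>FQ\<^esub> b) = N +>\<^bsub>FQ\<^esub> (c \<otimes>\<^bsub>FQ\<^esub> d)"
    if a: "a \<in> N +>\<^bsub>FQ\<^esub> c" and b: "b \<in> N +>\<^bsub>FQ\<^esub> d" for a b
  proof (rule coset_eq[OF _ FQ_mult_closed[OF c d]])
    have ac: "a - c \<in> N" "b - d \<in> N" using a b by (simp_all add: coset_iff)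
    have "b = (b - d) + d" by simp
    moreover have "Poly_Mapping.keys ((b - d) + d) \<subseteq> quads T \<Gamma>"
      using keys_add[of "b - d" d] N_closed[OF ac(2)] d by auto
    ultimately have bq: "Poly_Mapping.keys b \<subseteq> quads T \<Gamma>" by simp
    have cq: "Poly_Mapping.keys c \<subseteq> quads T \<Gamma>" using c by simp
    have "(a - c) \<otimes>\<^bsub>FQ\<^esub> b + c \<otimes>\<^bsub>FQ\<^esub> (b - d) \<in> N"
      by (rule N_add[OF N_mult_right[OF ac(1) bq] N_mult_left[OF ac(2) cq]])
    also have "(a - c) \<otimes>\<^bsub>FQ\<^esub> b + c \<otimes>\<^bsub>FQ\<^esub> (b - d) = a \<otimes>\<^bsub>FQ\<^esub> b - c \<otimes>\<^bsub>FQ\<^esub> d"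
      by (simp only: FQ_mult_diff_left FQ_mult_diff_right) simp
    finally show "a \<otimes>\<^bsub>FQ\<^esub> b - c \<otimes>\<^bsub>FQ\<^esub> d \<in> N" .
  qed
  have self: "c \<in> N +>\<^bsub>FQ\<^esub> c" "d \<in> N +>\<^bsub>FQ\<^esub> d" by (simp_all add: coset_iff N_zero)
  have "(\<Union>a\<in>N +>\<^bsub>FQ\<^esub> c. \<Union>b\<in>N +>\<^bsub>FQ\<^esub> d. N +>\<^bsub>FQ\<^esub> (a \<otimes>\<^bsub>FQ\<^esub> b)) = N +>\<^bsub>FQ\<^esub> (c \<otimes>\<^bsub>FQ\<^esub> d)"
  proof (intro equalityI UN_least subsetI)
    fix z assume "z \<in> N +>\<^bsub>FQ\<^esub> (c \<otimes>\<^bsub>FQ\<^esub> d)"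
    then show "z \<in> (\<Union>a\<in>N +>\<^bsub>FQ\<^esub> c. \<Union>b\<in>N +>\<^bsub>FQ\<^esub> d. N +>\<^bsub>FQ\<^esub> (a \<otimes>\<^bsub>FQ\<^esub> b))"
      by (intro UN_I[OF self(1)] UN_I[OF self(2)])
  qed (simp only: eq)
  then show ?thesis by (simp add: tensor_ring_def FactRing_def rcoset_mult_def)
qed

lemma act_coset:
  assumes c: "c \<in> carrier FQ" and x: "x \<in> carrier T" and b: "b \<in> N +>\<^bsub>FQ\<^esub> c"
  shows "act b x = act c x"
proof -
  have n: "b - c \<in> N" using b by (simp add: coset_iff)
  have "act ((b - c) + c) x = act (b - c) x \<oplus>\<^bsub>T\<^esub> act c x"
    using c x N_closed[OF n] by (intro act_add) simp_all
  then show ?thesis using c x by (simp add: act_N[OF n x] act_closed)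
qed

text \<open>
  The tensors which act by zero form a two-sided ideal containing the generators of \<open>J\<close>, so the
  representation descends to the operator ring.
\<close>

definition annihilator where
  "annihilator = {X \<in> carrier F. \<forall>c\<in>X. \<forall>x\<in>carrier T. act c x = \<zero>\<^bsub>T\<^esub>}"

lemma coset_in_annihilator_iff:
  assumes "c \<in> carrier FQ"
  shows "N +>\<^bsub>FQ\<^esub> c \<in> annihilator \<longleftrightarrow> (\<forall>x\<in>carrier T. act c x = \<zero>\<^bsub>T\<^esub>)"
proof -
  have self: "c \<in> N +>\<^bsub>FQ\<^esub> c" by (simp add: coset_iff N_zero)
  show ?thesis
  proof
    assume "N +>\<^bsub>FQ\<^esub> c \<in> annihilator"
    then have "\<forall>b\<in>N +>\<^bsub>FQ\<^esub> c. \<forall>x\<in>carrier T. act b x = \<zero>\<^bsub>T\<^esub>"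
      unfolding annihilator_def mem_Collect_eq by (rule conjunct2)
    then show "\<forall>x\<in>carrier T. act c x = \<zero>\<^bsub>T\<^esub>" using self by (rule bspec)
  next
    assume *: "\<forall>x\<in>carrier T. act c x = \<zero>\<^bsub>T\<^esub>"
    have "\<forall>b\<in>N +>\<^bsub>FQ\<^esub> c. \<forall>x\<in>carrier T. act b x = \<zero>\<^bsub>T\<^esub>"
    proof (intro ballI)
      fix b x assume b: "b \<in> N +>\<^bsub>FQ\<^esub> c" and x: "x \<in> carrier T"
      show "act b x = \<zero>\<^bsub>T\<^esub>" using act_coset[OF assms x b] bspec[OF * x] by (rule trans)
    qed
    with F_closed[OF assms] show "N +>\<^bsub>FQ\<^esub> c \<in> annihilator"
      unfolding annihilator_def by (intro CollectI conjI)
  qed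
qed

lemma annihilator_cases:
  assumes "X \<in> annihilator"
  obtains c where "c \<in> carrier FQ" "X = N +>\<^bsub>FQ\<^esub> c" "\<And>x. x \<in> carrier T \<Longrightarrow> act c x = \<zero>\<^bsub>T\<^esub>"
proof -
  have X: "X \<in> carrier F" using assms by (simp add: annihilator_def)
  obtain c where c: "c \<in> carrier FQ" "X = N +>\<^bsub>FQ\<^esub> c" using F_cases[OF X] .
  have "\<forall>x\<in>carrier T. act c x = \<zero>\<^bsub>T\<^esub>"
    using iffD1[OF coset_in_annihilator_iff[OF c(1)]] assms c(2) by simp
  then show thesis by (intro that[OF c]) (rule bspec)
qed

text \<open>Products act by composition, and composing with the zero map gives zero on either side,
  since every formal sum sends zero to zero.\<close>

lemma annihilator_ideal: "two_sided_ideal annihilator F"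
proof -
  interpret F: abelian_group F by (rule abelian_group_F)
  have "subgroup annihilator (add_monoid F)"
  proof (rule group.subgroupI[OF F.a_group])
    show "annihilator \<subseteq> carrier (add_monoid F)" by (auto simp: annihilator_def)
    have "N +>\<^bsub>FQ\<^esub> 0 \<in> annihilator" by (subst coset_in_annihilator_iff) (simp_all add: act_zero)
    then show "annihilator \<noteq> {}" by blast
  next
    fix X assume "X \<in> annihilator"
    then obtain c where c: "c \<in> carrier FQ" "X = N +>\<^bsub>FQ\<^esub> c"
      and act: "\<And>x. x \<in> carrier T \<Longrightarrow> act c x = \<zero>\<^bsub>T\<^esub>" by (rule annihilator_cases) blast
    have "act (- c) x = \<zero>\<^bsub>T\<^esub>" if "x \<in> carrier T" for x
      using act_diff[of 0 c x] c that by (simp add: act act_zero a_minus_def T.r_neg)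
    then have "N +>\<^bsub>FQ\<^esub> (- c) \<in> annihilator"
      using c by (subst coset_in_annihilator_iff) simp_all
    then show "inv\<^bsub>add_monoid F\<^esub> X \<in> annihilator"
      using F_uminus[OF c(1)] c(2) by (simp add: a_inv_def)
  next
    fix X Y assume X: "X \<in> annihilator" and Y: "Y \<in> annihilator"
    obtain c where c: "c \<in> carrier FQ" "X = N +>\<^bsub>FQ\<^esub> c"
      and act_c: "\<And>x. x \<in> carrier T \<Longrightarrow> act c x = \<zero>\<^bsub>T\<^esub>" using annihilator_cases[OF X] by blast
    obtain d where d: "d \<in> carrier FQ" "Y = N +>\<^bsub>FQ\<^esub> d"
      and act_d: "\<And>x. x \<in> carrier T \<Longrightarrow> act d x = \<zero>\<^bsub>T\<^esub>" using annihilator_cases[OF Y] by blast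
    have cd: "c + d \<in> carrier FQ" using c d keys_add[of c d] by auto
    have "N +>\<^bsub>FQ\<^esub> (c + d) \<in> annihilator"
      using coset_in_annihilator_iff[OF cd] c d by (simp add: act_add act_c act_d)
    then show "X \<otimes>\<^bsub>add_monoid F\<^esub> Y \<in> annihilator" using F_add[OF c(1) d(1)] c d by simp
  qed
  moreover have "Y \<otimes>\<^bsub>F\<^esub> X \<in> annihilator \<and> X \<otimes>\<^bsub>F\<^esub> Y \<in> annihilator"
    if X: "X \<in> annihilator" and Y: "Y \<in> carrier F" for X Y
  proof -
    obtain c where c: "c \<in> carrier FQ" "X = N +>\<^bsub>FQ\<^esub> c"
      and act: "\<And>x. x \<in> carrier T \<Longrightarrow> act c x = \<zero>\<^bsub>T\<^esub>" using annihilator_cases[OF X] by blast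
    obtain d where d: "d \<in> carrier FQ" "Y = N +>\<^bsub>FQ\<^esub> d" using F_cases[OF Y] .
    have cd: "Poly_Mapping.keys c \<subseteq> quads T \<Gamma>" "Poly_Mapping.keys d \<subseteq> quads T \<Gamma>" using c d by simp_all
    have "N +>\<^bsub>FQ\<^esub> (d \<otimes>\<^bsub>FQ\<^esub> c) \<in> annihilator"
      using coset_in_annihilator_iff[OF FQ_mult_closed[OF d(1) c(1)]]
      by (simp add: act_mult cd act act_zero_right)
    moreover have "N +>\<^bsub>FQ\<^esub> (c \<otimes>\<^bsub>FQ\<^esub> d) \<in> annihilator"
      using coset_in_annihilator_iff[OF FQ_mult_closed[OF c(1) d(1)]]
      by (simp add: act_mult cd act act_closed)
    ultimately show ?thesis using c d by (simp only: F_mult)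
  qed
  ultimately show ?thesis
    by (simp add: two_sided_ideal_def additive_subgroup_def)
qed

text \<open>\<open>J\<close> is the smallest ideal containing its generators, and on a generator the
  two terms act alike by the first associativity law with \<open>x\<close> in the last
  place.\<close>

lemma J_subset_annihilator: "J \<subseteq> annihilator"
proof -
  have gen: "pure_tensor T \<Gamma> tp (tp a \<alpha> b \<beta> c) \<gamma> e \<delta> \<ominus>\<^bsub>F\<^esub> pure_tensor T \<Gamma> tp a \<alpha> (tp b \<beta> c \<gamma> e) \<delta> \<in> annihilator"
    if "a \<in> carrier T" "b \<in> carrier T" "c \<in> carrier T" "e \<in> carrier T"
      "\<alpha> \<in> carrier \<Gamma>" "\<beta> \<in> carrier \<Gamma>" "\<gamma> \<in> carrier \<Gamma>" "\<delta> \<in> carrier \<Gamma>" for a b c e \<alpha> \<beta> \<gamma> \<delta>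
  proof -
    let ?u = "(tp a \<alpha> b \<beta> c, \<gamma>, e, \<delta>)" and ?v = "(a, \<alpha>, tp b \<beta> c \<gamma> e, \<delta>)"
    have uv: "?u \<in> quads T \<Gamma>" "?v \<in> quads T \<Gamma>" using that by (simp_all add: quads_def tp_closed)
    have "act (frag_of ?u - frag_of ?v) x = \<zero>\<^bsub>T\<^esub>" if x: "x \<in> carrier T" for x
    proof -
      have "act (frag_of ?u - frag_of ?v) x = quad_apply ?u x \<ominus>\<^bsub>T\<^esub> quad_apply ?v x"
        using uv x by (simp add: act_diff act_frag_of)
      also have "quad_apply ?u x = quad_apply ?v x"
        using \<open>a \<in> carrier T\<close> \<open>b \<in> carrier T\<close> \<open>c \<in> carrier T\<close> \<open>e \<in> carrier T\<close> \<open>\<alpha> \<in> carrier \<Gamma>\<close>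
          \<open>\<beta> \<in> carrier \<Gamma>\<close> \<open>\<gamma> \<in> carrier \<Gamma>\<close> \<open>\<delta> \<in> carrier \<Gamma>\<close> x
        by (simp add: quad_apply_def tp_assoc_12)
      finally show ?thesis using quad_apply_closed[OF uv(2) x] by (simp add: a_minus_def T.r_neg)
    qed
    then have "N +>\<^bsub>FQ\<^esub> (frag_of ?u - frag_of ?v) \<in> annihilator"
      using uv FQ_diff_closed[of "frag_of ?u" "frag_of ?v"] by (subst coset_in_annihilator_iff) simp_all
    then show ?thesis
      using uv F_add[of "frag_of ?u" "- frag_of ?v"] F_uminus[of "frag_of ?v"]
      by (simp add: pure_tensor_def a_minus_def)
  qed
  have "{pure_tensor T \<Gamma> tp (tp a \<alpha> b \<beta> c) \<gamma> d \<delta> \<ominus>\<^bsub>F\<^esub> pure_tensor T \<Gamma> tp a \<alpha> (tp b \<beta> c \<gamma> d) \<delta> | a \<alpha> b \<beta> c \<gamma> d \<delta>.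
       a \<in> carrier T \<and> b \<in> carrier T \<and> c \<in> carrier T \<and> d \<in> carrier T \<and>
       \<alpha> \<in> carrier \<Gamma> \<and> \<beta> \<in> carrier \<Gamma> \<and> \<gamma> \<in> carrier \<Gamma> \<and> \<delta> \<in> carrier \<Gamma>} \<subseteq> annihilator"
  proof
    fix X assume "X \<in> {pure_tensor T \<Gamma> tp (tp a \<alpha> b \<beta> c) \<gamma> d \<delta> \<ominus>\<^bsub>F\<^esub> pure_tensor T \<Gamma> tp a \<alpha> (tp b \<beta> c \<gamma> d) \<delta> | a \<alpha> b \<beta> c \<gamma> d \<delta>.
       a \<in> carrier T \<and> b \<in> carrier T \<and> c \<in> carrier T \<and> d \<in> carrier T \<and>
       \<alpha> \<in> carrier \<Gamma> \<and> \<beta> \<in> carrier \<Gamma> \<and> \<gamma> \<in> carrier \<Gamma> \<and> \<delta> \<in> carrier \<Gamma>}"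
    then show "X \<in> annihilator"
      by (elim CollectE exE conjE) (simp only: gen)
  qed
  then show ?thesis
    unfolding J_ideal_def generated_ideal_def using annihilator_ideal by (intro Inter_lower) blast
qed

text \<open>\<open>N\<close> is the zero of the tensor ring. Its membership in \<open>J\<close>
  ensures that the coset of \<open>X\<close> contains \<open>X\<close> and that the formal sum
  \<open>0\<close> represents the zero operator.\<close>

lemma N_in_J: "N \<in> J"
proof -
  have "\<zero>\<^bsub>F\<^esub> = N" by (simp add: tensor_ring_def FactRing_def)
  moreover have "\<zero>\<^bsub>F\<^esub> \<in> I" if "two_sided_ideal I F" for I
    using that additive_subgroup.zero_closed by (auto simp: two_sided_ideal_def)
  ultimately show ?thesis by (auto simp: J_ideal_def generated_ideal_def)
qed

section \<open>The representation on the operator ring and its image\<close>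

abbreviation "OR \<equiv> operator_ring T \<Gamma> tp"
abbreviation "A \<equiv> unital_operator_ring T \<Gamma> tp"
abbreviation "\<rho> \<equiv> unital_regular_rep T tp"
abbreviation "RT \<equiv> regular_operator_ring T \<Gamma> tp"

lemma act_extensional: "act c \<in> extensional (carrier T)"
  by (simp add: quad_action_def)

lemma act_eqI: "(\<And>x. x \<in> carrier T \<Longrightarrow> act b x = act c x) \<Longrightarrow> act b = act c"
  by (rule extensionalityI[OF act_extensional act_extensional])

lemma End_ring_simps:
  "f \<in> carrier (End_ring T) \<longleftrightarrow> f \<in> hom (add_monoid T) (add_monoid T) \<and> f \<in> extensional (carrier T)"
  "f \<otimes>\<^bsub>End_ring T\<^esub> g = compose (carrier T) f g" "\<one>\<^bsub>End_ring T\<^esub> = (\<lambda>x\<in>carrier T. x)"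
  "\<zero>\<^bsub>End_ring T\<^esub> = (\<lambda>x\<in>carrier T. \<zero>\<^bsub>T\<^esub>)" "f \<oplus>\<^bsub>End_ring T\<^esub> g = (\<lambda>x\<in>carrier T. f x \<oplus>\<^bsub>T\<^esub> g x)"
  by (simp_all add: End_ring_def)

lemma End_closed: "\<lbrakk>f \<in> carrier (End_ring T); x \<in> carrier T\<rbrakk> \<Longrightarrow> f x \<in> carrier T"
  by (auto simp: End_ring_simps hom_def)

lemma End_add: "\<lbrakk>f \<in> carrier (End_ring T); x \<in> carrier T; y \<in> carrier T\<rbrakk> \<Longrightarrow> f (x \<oplus>\<^bsub>T\<^esub> y) = f x \<oplus>\<^bsub>T\<^esub> f y"
  by (simp add: End_ring_simps hom_def)

lemma End_memI:
  assumes "\<And>x. x \<in> carrier T \<Longrightarrow> f x \<in> carrier T"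
    and "\<And>x y. \<lbrakk>x \<in> carrier T; y \<in> carrier T\<rbrakk> \<Longrightarrow> f (x \<oplus>\<^bsub>T\<^esub> y) = f x \<oplus>\<^bsub>T\<^esub> f y"
    and "f \<in> extensional (carrier T)"
  shows "f \<in> carrier (End_ring T)"
  using assms by (simp add: End_ring_simps hom_def)

text \<open>The integer multiples of the identity in \<open>unital_regular_rep\<close> are powers in
  this additive group.\<close>

lemma abelian_group_End: "abelian_group (End_ring T)"
proof (rule abelian_groupI)
  fix f g assume f: "f \<in> carrier (End_ring T)" and g: "g \<in> carrier (End_ring T)"
  show "f \<oplus>\<^bsub>End_ring T\<^esub> g \<in> carrier (End_ring T)"
    using End_closed[OF f] End_closed[OF g] End_add[OF f] End_add[OF g]
    by (intro End_memI) (simp_all add: End_ring_simps T.a_ac)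
  show "f \<oplus>\<^bsub>End_ring T\<^esub> g = g \<oplus>\<^bsub>End_ring T\<^esub> f"
    unfolding End_ring_simps
    by (rule restrict_ext) (simp add: T.a_comm End_closed[OF f] End_closed[OF g])
  fix h assume h: "h \<in> carrier (End_ring T)"
  show "f \<oplus>\<^bsub>End_ring T\<^esub> g \<oplus>\<^bsub>End_ring T\<^esub> h = f \<oplus>\<^bsub>End_ring T\<^esub> (g \<oplus>\<^bsub>End_ring T\<^esub> h)"
    unfolding End_ring_simps
    by (rule restrict_ext) (simp add: T.a_assoc End_closed[OF f] End_closed[OF g] End_closed[OF h])
next
  show "\<zero>\<^bsub>End_ring T\<^esub> \<in> carrier (End_ring T)"
    by (rule End_memI) (simp_all add: End_ring_simps)
next
  fix f assume f: "f \<in> carrier (End_ring T)"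
  show "\<zero>\<^bsub>End_ring T\<^esub> \<oplus>\<^bsub>End_ring T\<^esub> f = f"
  proof (rule extensionalityI[where A = "carrier T"])
    show "f \<in> extensional (carrier T)" using f by (simp add: End_ring_simps)
  qed (simp_all add: End_ring_simps End_closed[OF f])
  show "\<exists>g\<in>carrier (End_ring T). g \<oplus>\<^bsub>End_ring T\<^esub> f = \<zero>\<^bsub>End_ring T\<^esub>"
  proof
    show "(\<lambda>x\<in>carrier T. \<ominus>\<^bsub>T\<^esub> f x) \<in> carrier (End_ring T)"
      using End_closed[OF f] End_add[OF f] by (intro End_memI) (simp_all add: T.minus_add T.a_comm)
    show "(\<lambda>x\<in>carrier T. \<ominus>\<^bsub>T\<^esub> f x) \<oplus>\<^bsub>End_ring T\<^esub> f = \<zero>\<^bsub>End_ring T\<^esub>"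
      unfolding End_ring_simps by (rule restrict_ext) (simp add: T.l_neg End_closed[OF f])
  qed
qed

lemma one_End: "\<one>\<^bsub>End_ring T\<^esub> \<in> carrier (End_ring T)"
  by (rule End_memI) (simp_all add: End_ring_simps)

lemma act_End: "c \<in> carrier FQ \<Longrightarrow> act c \<in> carrier (End_ring T)"
  by (rule End_memI) (simp_all add: act_closed act_add_right act_extensional)

lemma regular_rep_eq_act:
  assumes "c \<in> \<Union>u" and "\<And>b x. \<lbrakk>b \<in> \<Union>u; x \<in> carrier T\<rbrakk> \<Longrightarrow> act b x = act c x"
  shows "regular_rep T tp u = act c"
proof -
  have "act b = act c" if "b \<in> \<Union>u" for b using assms(2)[OF that] by (rule act_eqI)
  then have "act ` \<Union>u = {act c}" using assms(1) by blast
  then show ?thesis by (simp add: regular_rep_def)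
qed

lemma act_J:
  assumes X: "X \<in> J" and b: "b \<in> X" and x: "x \<in> carrier T"
  shows "act b x = \<zero>\<^bsub>T\<^esub>"
proof -
  have "X \<in> annihilator" using X J_subset_annihilator by (rule subsetD[rotated])
  then show ?thesis using b x by (simp add: annihilator_def)
qed

lemma regular_rep_zero: "regular_rep T tp J = \<zero>\<^bsub>End_ring T\<^esub>"
proof -
  have "regular_rep T tp J = act 0"
  proof (rule regular_rep_eq_act)
    show "0 \<in> \<Union>J" by (rule UnionI[OF N_in_J N_zero])
    fix b x assume "b \<in> \<Union>J" and x: "x \<in> carrier T"
    then obtain X where "X \<in> J" "b \<in> X" by (elim UnionE)
    then show "act b x = act 0 x" by (simp only: act_J[OF _ _ x] act_zero[OF x])
  qed
  also have "\<dots> = \<zero>\<^bsub>End_ring T\<^esub>" by (simp add: End_ring_simps quad_action_def)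
  finally show ?thesis .
qed

text \<open>Every member of \<open>u\<close> is \<open>W + X\<close> with \<open>W\<close> in
  \<open>J\<close>, which acts by zero. So all formal sums representing \<open>u\<close> act like
  one representative \<open>c\<close> of \<open>X\<close>, and the value is an endomorphism.\<close>

lemma regular_rep_End:
  assumes u: "u \<in> carrier OR"
  shows "regular_rep T tp u \<in> carrier (End_ring T)"
proof -
  have "carrier OR = (\<Union>X\<in>carrier F. {J #>\<^bsub>add_monoid F\<^esub> X})"
    by (simp add: operator_ring_def FactRing_def A_RCOSETS_def RCOSETS_def)
  with u obtain X where X: "X \<in> carrier F" and u_eq: "u = J #>\<^bsub>add_monoid F\<^esub> X" by blast
  obtain c where c: "c \<in> carrier FQ" "X = N +>\<^bsub>FQ\<^esub> c" using F_cases[OF X] .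
  have mem: "Y \<in> u \<longleftrightarrow> (\<exists>W\<in>J. Y = W \<oplus>\<^bsub>F\<^esub> X)" for Y
    by (simp add: u_eq r_coset_def)
  have "regular_rep T tp u = act c"
  proof (rule regular_rep_eq_act)
    have N_eq_coset: "N +>\<^bsub>FQ\<^esub> 0 = N" using F_zero by (simp add: tensor_ring_def FactRing_def)
    have "(N +>\<^bsub>FQ\<^esub> 0) \<oplus>\<^bsub>F\<^esub> (N +>\<^bsub>FQ\<^esub> c) = N +>\<^bsub>FQ\<^esub> (0 + c)"
      using c(1) by (intro F_add) simp_all
    then have "X = N \<oplus>\<^bsub>F\<^esub> X" by (simp only: N_eq_coset c(2) add_0)
    then have "X \<in> u" unfolding mem using N_in_J by (rule bexI)
    moreover have "c \<in> X" by (simp add: c(2) coset_iff N_zero)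
    ultimately show "c \<in> \<Union>u" by (rule UnionI)
  next
    fix b x assume "b \<in> \<Union>u" and x: "x \<in> carrier T"
    then obtain Y where "Y \<in> u" and bY: "b \<in> Y" by (elim UnionE)
    then obtain W where W: "W \<in> J" and Y: "Y = W \<oplus>\<^bsub>F\<^esub> X" unfolding mem by (elim bexE)
    have b: "b \<in> W \<oplus>\<^bsub>F\<^esub> X" using bY by (simp only: Y)
    have "W \<in> annihilator" using W J_subset_annihilator by (rule subsetD[rotated])
    then obtain w where w: "w \<in> carrier FQ" "W = N +>\<^bsub>FQ\<^esub> w"
      and act_w: "\<And>x. x \<in> carrier T \<Longrightarrow> act w x = \<zero>\<^bsub>T\<^esub>" by (rule annihilator_cases) blast
    have wc: "w + c \<in> carrier FQ" using w c keys_add[of w c] by auto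
    have "b \<in> N +>\<^bsub>FQ\<^esub> (w + c)" using b F_add[OF w(1) c(1)] w(2) c(2) by simp
    then have "act b x = act (w + c) x" by (rule act_coset[OF wc x])
    also have "\<dots> = act w x \<oplus>\<^bsub>T\<^esub> act c x" using w c x by (intro act_add) simp_all
    also have "\<dots> = act c x" using c x by (simp add: act_w act_closed)
    finally show "act b x = act c x" .
  qed
  then show ?thesis using act_End[OF c(1)] by simp
qed

lemma \<rho>_End:
  assumes a: "a \<in> carrier A"
  shows "\<rho> a \<in> carrier (End_ring T)"
proof -
  interpret E: abelian_group "End_ring T" by (rule abelian_group_End)
  obtain n u where nu: "a = (n, u)" "u \<in> carrier OR"
    using a by (auto simp: unital_operator_ring_def Let_def)
  have "add_pow (End_ring T) n \<one>\<^bsub>End_ring T\<^esub> \<in> carrier (End_ring T)"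
    using group.int_pow_closed[OF E.a_group, of "\<one>\<^bsub>End_ring T\<^esub>" n] one_End by (simp add: add_pow_def)
  then show ?thesis
    using regular_rep_End[OF nu(2)] by (simp add: nu(1) unital_regular_rep_def)
qed

lemma \<rho>_one: "\<rho> \<one>\<^bsub>A\<^esub> = \<one>\<^bsub>End_ring T\<^esub>"
proof -
  interpret E: abelian_group "End_ring T" by (rule abelian_group_End)
  have "\<one>\<^bsub>A\<^esub> = (1, J)"
    by (simp add: unital_operator_ring_def Let_def operator_ring_def FactRing_def)
  moreover have "add_pow (End_ring T) (1 :: int) \<one>\<^bsub>End_ring T\<^esub> = \<one>\<^bsub>End_ring T\<^esub>"
    using group.int_pow_1[OF E.a_group, of "\<one>\<^bsub>End_ring T\<^esub>"] one_End by (simp add: add_pow_def)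
  ultimately show ?thesis
    using one_End by (simp add: unital_regular_rep_def regular_rep_zero)
qed

lemma RT_simps:
  "carrier RT = \<rho> ` carrier A" "\<one>\<^bsub>RT\<^esub> = \<one>\<^bsub>End_ring T\<^esub>" "\<zero>\<^bsub>RT\<^esub> = \<zero>\<^bsub>End_ring T\<^esub>"
  "f \<otimes>\<^bsub>RT\<^esub> g = f \<otimes>\<^bsub>End_ring T\<^esub> g"
  by (simp_all add: regular_operator_ring_def)

lemma RT_End: "f \<in> carrier RT \<Longrightarrow> f \<in> carrier (End_ring T)"
  using \<rho>_End by (auto simp: RT_simps)

text \<open>Laws of composition for extensional maps. Closure of \<open>RT\<close> under composition
  is not claimed here; it is read off from the module structure in
  \<open>surjective_ring_hom_of_module\<close>.\<close>

lemma RT_monoid: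
  "\<lbrakk>f \<in> carrier RT; g \<in> carrier RT; h \<in> carrier RT\<rbrakk> \<Longrightarrow> f \<otimes>\<^bsub>RT\<^esub> g \<otimes>\<^bsub>RT\<^esub> h = f \<otimes>\<^bsub>RT\<^esub> (g \<otimes>\<^bsub>RT\<^esub> h)"
  "f \<in> carrier RT \<Longrightarrow> \<one>\<^bsub>RT\<^esub> \<otimes>\<^bsub>RT\<^esub> f = f"
  "f \<in> carrier RT \<Longrightarrow> f \<otimes>\<^bsub>RT\<^esub> \<one>\<^bsub>RT\<^esub> = f"
proof -
  have maps: "f \<in> carrier T \<rightarrow> carrier T" "f \<in> extensional (carrier T)" if "f \<in> carrier RT" for f
    using RT_End[OF that] by (auto simp: End_ring_simps hom_def)
  show "f \<otimes>\<^bsub>RT\<^esub> g \<otimes>\<^bsub>RT\<^esub> h = f \<otimes>\<^bsub>RT\<^esub> (g \<otimes>\<^bsub>RT\<^esub> h)"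
    if "f \<in> carrier RT" "g \<in> carrier RT" "h \<in> carrier RT"
    by (simp only: RT_simps End_ring_simps compose_assoc[OF maps(1)[OF that(3)]])
  show "\<one>\<^bsub>RT\<^esub> \<otimes>\<^bsub>RT\<^esub> f = f" "f \<otimes>\<^bsub>RT\<^esub> \<one>\<^bsub>RT\<^esub> = f" if "f \<in> carrier RT"
    using maps[OF that] by (simp_all add: RT_simps End_ring_simps Id_compose compose_Id)
qed

text \<open>The hypothesis is part of every projective resolution of this module, and it contains
  the ring axioms of \<open>A\<close>.\<close>

lemma surjective_\<rho>_left:
  assumes "left_module A (regular_left T \<Gamma> tp)"
  shows "surjective_ring_hom A RT \<rho>"
  using assms unfolding regular_left_def
  by (rule surjective_ring_hom_of_module) (simp_all only: RT_simps(1) \<rho>_one RT_simps(2) RT_monoid[unfolded RT_simps(1,2)])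

lemma surjective_\<rho>_right:
  assumes "left_module (op_ring A) (regular_right T \<Gamma> tp)"
  shows "surjective_ring_hom (op_ring A) (op_ring RT) \<rho>"
  using assms unfolding regular_right_def
proof (rule surjective_ring_hom_of_module)
  show "\<rho> ` carrier (op_ring A) = carrier (op_ring RT)" by (simp add: RT_simps)
  show "\<rho> \<one>\<^bsub>op_ring A\<^esub> = \<one>\<^bsub>op_ring RT\<^esub>" by (simp add: RT_simps \<rho>_one)
qed (simp_all add: RT_monoid)

text \<open>A kernel depends on its target only through the zero element, which the image shares
  with the whole endomorphism ring.\<close>

lemma defect_eq: "unital_regular_defect T \<Gamma> tp = a_kernel A RT \<rho>"
  by (simp only: unital_regular_defect_def a_kernel_def' RT_simps)

lemma conormal_left_eq: "conormal_left T \<Gamma> tp = conormal A RT \<rho>"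
  by (simp only: conormal_left_def conormal_def defect_eq Let_def)

text \<open>Passing to opposite rings swaps \<open>k a\<close> with \<open>a k\<close> but leaves
  cosets and \<open>K\<close> unchanged, and \<open>K2\<close> too, because both factors of the
  ideal product are equal.\<close>

lemma conormal_right_eq: "conormal_right T \<Gamma> tp = conormal (op_ring A) (op_ring RT) \<rho>"
  by (simp only: conormal_right_def conormal_def defect_eq a_kernel_op_ring ideal_prod_op_ring
      a_r_coset_op_ring set_add_op_ring op_ring_simps Let_def)

end

theorem theorem7p2:
  fixes T :: "'t ring" and \<Gamma> :: "'g ring" and tp :: "'t \<Rightarrow> 'g \<Rightarrow> 't \<Rightarrow> 'g \<Rightarrow> 't \<Rightarrow> 't"
    and P :: "nat \<Rightarrow> (('t, 'g) unital_operator, 'p) module" and d :: "nat \<Rightarrow> 'p \<Rightarrow> 'p"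
    and \<epsilon> :: "'p \<Rightarrow> 't \<Rightarrow> 't"
    and Q :: "nat \<Rightarrow> (('t, 'g) unital_operator, 'q) module" and e :: "nat \<Rightarrow> 'q \<Rightarrow> 'q"
    and \<eta> :: "'q \<Rightarrow> 't \<Rightarrow> 't"
  assumes "ternary_gamma_ring T \<Gamma> tp"
  shows "(projective_resolution (op_ring (unital_operator_ring T \<Gamma> tp)) (regular_right T \<Gamma> tp) P d \<epsilon> \<longrightarrow>
           naturally_isomorphic (regular_operator_ring T \<Gamma> tp)
             (\<lambda>M :: ('t \<Rightarrow> 't, 'm) module.
               tor (unital_operator_ring T \<Gamma> tp) P d (restrict_scalars (unital_regular_rep T tp) M) 1)
             (\<lambda>M N f.
               tor_map (unital_operator_ring T \<Gamma> tp) P d (restrict_scalars (unital_regular_rep T tp) N) f 1)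
             (\<lambda>M. tensor (regular_operator_ring T \<Gamma> tp) (conormal_right T \<Gamma> tp) M)
             (\<lambda>M N f. tensor_map (regular_operator_ring T \<Gamma> tp) (conormal_right T \<Gamma> tp) N id f)) \<and>
         (projective_resolution (unital_operator_ring T \<Gamma> tp) (regular_left T \<Gamma> tp) Q e \<eta> \<longrightarrow>
           naturally_isomorphic (regular_operator_ring T \<Gamma> tp)
             (\<lambda>M :: ('t \<Rightarrow> 't, 'm) module.
               ext (unital_operator_ring T \<Gamma> tp) Q e (restrict_scalars (unital_regular_rep T tp) M) 1)
             (\<lambda>M N f.
               ext_map (unital_operator_ring T \<Gamma> tp) Q e (restrict_scalars (unital_regular_rep T tp) N) f 1)
             (\<lambda>M. hom_group (regular_operator_ring T \<Gamma> tp) (conormal_left T \<Gamma> tp) M)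
             (\<lambda>M N f \<phi>. compose (carrier (conormal_left T \<Gamma> tp)) f \<phi>))"
proof (intro conjI impI)
  interpret ternary_gamma_ring T \<Gamma> tp by fact
  {
    assume res: "projective_resolution (op_ring A) (regular_right T \<Gamma> tp) P d \<epsilon>"
    note surj = surjective_\<rho>_right[OF projective_resolutionD(1)[OF res]]
    \<comment> \<open>The right module structures are handled by comparing over the opposite rings;
      the opposites taken once more in the Tor statement then collapse to \<open>A\<close> and
      \<open>RT\<close>.\<close>
    obtain s p H where "conormal_comparison (op_ring A) (op_ring RT) \<rho> P d s p H"
      by (rule surjective_ring_hom.conormal_comparison_exists[OF surj res[unfolded regular_right_def]])
    note iso = conormal_comparison.tor_naturally_isomorphic[OF this]
    show "naturally_isomorphic RT
      (\<lambda>M :: ('t \<Rightarrow> 't, 'm) module. tor A P d (restrict_scalars \<rho> M) 1)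
      (\<lambda>M N f. tor_map A P d (restrict_scalars \<rho> N) f 1)
      (\<lambda>M. tensor RT (conormal_right T \<Gamma> tp) M)
      (\<lambda>M N f. tensor_map RT (conormal_right T \<Gamma> tp) N id f)"
      using iso unfolding conormal_right_eq op_ring_op_ring .
  next
    assume res: "projective_resolution A (regular_left T \<Gamma> tp) Q e \<eta>"
    note surj = surjective_\<rho>_left[OF projective_resolutionD(1)[OF res]]
    obtain s p H where "conormal_comparison A RT \<rho> Q e s p H"
      by (rule surjective_ring_hom.conormal_comparison_exists[OF surj res[unfolded regular_left_def]])
    note iso = conormal_comparison.ext_naturally_isomorphic[OF this]
    show "naturally_isomorphic RT
      (\<lambda>M :: ('t \<Rightarrow> 't, 'm) module. ext A Q e (restrict_scalars \<rho> M) 1)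
      (\<lambda>M N f. ext_map A Q e (restrict_scalars \<rho> N) f 1)
      (\<lambda>M. hom_group RT (conormal_left T \<Gamma> tp) M)
      (\<lambda>M N f \<phi>. compose (carrier (conormal_left T \<Gamma> tp)) f \<phi>)"
      using iso unfolding conormal_left_eq .
  }
qed

end
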